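(* For every integer $g \geq 2$, the space $\Delta_g$, i.e. the moduli space of stable tropical curves of genus $g$ and volume $1$, is simply connected.
   Context: All graphs are finite and connected, and may have loops and multiple edges; $V(G)$ and $E(G)$ denote the vertex and edge sets. A weighted graph is a pair $(G,w)$ with $w\colon V(G)\to\mathbb{Z}_{\ge 0}$. Its genus is $h^1(G)+\sum_{v\in V(G)}w(v)$, where $h^1(G)=|E(G)|-|V(G)|+1$. It is stable if every vertex $v$ with $w(v)=0$ has valence at least $3$ (loops count twice). A stable tropical curve of genus $g$ is a stable weighted graph of genus $g$ together with a length $\ell(e)>0$ for each edge; its volume is $\sum_{e}\ell(e)$. Contracting an edge $e$ of a weighted graph: if $e$ is not a loop, its two endpoints are identified and the new vertex gets the sum of their weights; if $e$ is a loop at $v$, it is deleted and $w(v)$ is increased by $1$. Contraction preserves genus and stability. The points of $\Delta_g$ ($g\ge 2$) are the isomorphism classes of stable tropical curves of genus $g$ and volume $1$; it is the link of the cone point in the moduli space $M_g^{\mathrm{trop}}$ of stable tropical curves of genus $g$. As a topological space it is the following. Let $[p]=\{0,\dots,p\}$ and let $\Delta^p$ be the standard $p$-simplex with vertices indexed by $[p]$. For $p\ge0$ let $X_p$ be the set of isomorphism classes of pairs $(\mathbf G,\tau)$ with $\mathbf G$ a stable weighted graph of genus $g$ having $p+1$ edges and $\tau\colon E(G)\to[p]$ a bijection. For an injection $\theta\colon[p]\to[q]$ let $\theta^*\colon X_q\to X_p$ send $(\mathbf G,\tau)$ to the graph obtained by contracting all edges $e$ with $\tau(e)\notin\theta([p])$,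 with edge labelling $\theta^{-1}\circ\tau$ on the remaining edges; let $\theta_*\colon\Delta^p\to\Delta^q$ be the induced inclusion of simplices. Then $$\Delta_g=\Big(\coprod_{p\ge0}X_p\times\Delta^p\Big)\big/\sim,$$ where $X_p$ is discrete and $\sim$ is the equivalence relation generated by $(x,\theta_*a)\sim(\theta^*x,a)$ for all injections $\theta\colon[p]\to[q]$, $x\in X_q$, $a\in\Delta^p$. The point $((\mathbf G,\tau),a)$ corresponds to the tropical curve with lengths $\ell(e)=a_{\tau(e)}$, edges of length $0$ being contracted. *)

theory Defs
  imports "HOL-Analysis.Analysis" "HOL-Homology.Simplices" "HOL-Library.Multiset"
begin

section \<open>Stable weighted graphs\<close>

text \<open>
  The ends of an edge form a two-element multiset, so that \<open>{#v, v#}\<close> encodes a loop at \<open>v\<close>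
  and parallel edges are edges with equal ends.  The values of \<open>ends\<close> and \<open>weight\<close> outside
  \<open>edges\<close> and \<open>verts\<close> are irrelevant.
\<close>

record ('v, 'e) wgraph =
  verts :: "'v set"
  edges :: "'e set"
  ends :: "'e \<Rightarrow> 'v multiset"
  weight :: "'v \<Rightarrow> nat"

definition finite_graph :: "('v, 'e) wgraph \<Rightarrow> bool" where
  "finite_graph G \<longleftrightarrow> finite (verts G) \<and> finite (edges G) \<and>
     (\<forall>e\<in>edges G. size (ends G e) = 2 \<and> set_mset (ends G e) \<subseteq> verts G)"

definition connected_graph :: "('v, 'e) wgraph \<Rightarrow> bool" where
  "connected_graph G \<longleftrightarrow> verts G \<noteq> {} \<and>
     (\<forall>u\<in>verts G. \<forall>v\<in>verts G. (u, v) \<in> {(x, y). \<exists>e\<in>edges G. ends G e = {#x, y#}}\<^sup>*)"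

definition first_betti :: "('v, 'e) wgraph \<Rightarrow> int" where
  "first_betti G = int (card (edges G)) - int (card (verts G)) + 1"

definition genus :: "('v, 'e) wgraph \<Rightarrow> int" where
  "genus G = first_betti G + int (\<Sum>v\<in>verts G. weight G v)"

definition valence :: "('v, 'e) wgraph \<Rightarrow> 'v \<Rightarrow> nat" where
  "valence G v = (\<Sum>e\<in>edges G. count (ends G e) v)"

definition stable :: "('v, 'e) wgraph \<Rightarrow> bool" where
  "stable G \<longleftrightarrow> (\<forall>v\<in>verts G. weight G v = 0 \<longrightarrow> 3 \<le> valence G v)"

definition stable_wgraph :: "nat \<Rightarrow> ('v, 'e) wgraph \<Rightarrow> bool" where
  "stable_wgraph g G \<longleftrightarrow> finite_graph G \<and> connected_graph G \<and> stable G \<and> genus G = int g"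


section \<open>Contraction of edges\<close>

definition is_loop :: "('v, 'e) wgraph \<Rightarrow> 'e \<Rightarrow> bool" where
  "is_loop G e \<longleftrightarrow> (\<exists>v. ends G e = {#v, v#})"

text \<open>
  The vertex obtained by identifying the ends of \<open>e\<close> is represented by the smaller of the two.
  If \<open>e\<close> is a loop at \<open>v\<close>, then \<open>A = {v}\<close> and \<open>f\<close> is the identity.
\<close>

definition contract_edge :: "'e \<Rightarrow> ('v::linorder, 'e) wgraph \<Rightarrow> ('v, 'e) wgraph" where
  "contract_edge e G =
     (let A = set_mset (ends G e); m = Min A; f = (\<lambda>x. if x \<in> A then m else x)
      in \<lparr>verts = f ` verts G,
          edges = edges G - {e},
          ends = (\<lambda>e'. image_mset f (ends G e')),
          weight = (weight G)(m := if is_loop G e then weight G m + 1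
                                   else (\<Sum>v\<in>A. weight G v))\<rparr>)"

text \<open>Up to isomorphism, the order in which the edges are contracted does not matter.\<close>

definition contract_edges ::
    "'e::linorder set \<Rightarrow> ('v::linorder, 'e) wgraph \<Rightarrow> ('v, 'e) wgraph" where
  "contract_edges F G = fold contract_edge (sorted_list_of_set F) G"


section \<open>Isomorphism classes of edge-labelled stable graphs\<close>

text \<open>
  Every finite graph is isomorphic to one whose vertices and edges are natural numbers, so
  such graphs suffice to represent all isomorphism classes.
\<close>

type_synonym lgraph = "(nat, nat) wgraph \<times> (nat \<Rightarrow> nat)"

definition labelled_graphs :: "nat \<Rightarrow> nat \<Rightarrow> lgraph set" where
  "labelled_graphs g p =
     {(G, \<tau>). stable_wgraph g G \<and> card (edges G) = p + 1 \<and> bij_betw \<tau> (edges G) {..p}}"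

definition labelled_isomorphic :: "lgraph \<Rightarrow> lgraph \<Rightarrow> bool" where
  "labelled_isomorphic = (\<lambda>(G, \<tau>) (H, \<sigma>). \<exists>f h.
     bij_betw f (verts G) (verts H) \<and> bij_betw h (edges G) (edges H) \<and>
     (\<forall>e\<in>edges G. ends H (h e) = image_mset f (ends G e)) \<and>
     (\<forall>v\<in>verts G. weight H (f v) = weight G v) \<and>
     (\<forall>e\<in>edges G. \<sigma> (h e) = \<tau> e))"

definition iso_rel :: "nat \<Rightarrow> nat \<Rightarrow> (lgraph \<times> lgraph) set" where
  "iso_rel g p = {(A, B). A \<in> labelled_graphs g p \<and> B \<in> labelled_graphs g p \<and>
                          labelled_isomorphic A B}"

text \<open>The set \<open>X\<^sub>p\<close>.\<close>

definition labelled_classes :: "nat \<Rightarrow> nat \<Rightarrow> lgraph set set" where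
  "labelled_classes g p = labelled_graphs g p // iso_rel g p"

text \<open>
  The map \<open>\<theta>\<^sup>* : X\<^sub>q \<rightarrow> X\<^sub>p\<close> induced by an injection \<open>\<theta> : [p] \<rightarrow> [q]\<close>: all representatives
  of a class \<open>x\<close> yield the same class, which is therefore the union over them.
\<close>

definition face_map :: "nat \<Rightarrow> nat \<Rightarrow> (nat \<Rightarrow> nat) \<Rightarrow> lgraph set \<Rightarrow> lgraph set" where
  "face_map g p \<theta> x = (\<Union>(G, \<tau>)\<in>x. iso_rel g p ``
     {(contract_edges {e \<in> edges G. \<tau> e \<notin> \<theta> ` {..p}} G, inv_into {..p} \<theta> \<circ> \<tau>)})"

text \<open>The affine map \<open>\<theta>\<^sub>*\<close> of standard simplices sending the vertex \<open>i\<close> to the vertex \<open>\<theta> i\<close>.\<close>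

definition simplex_push :: "nat \<Rightarrow> (nat \<Rightarrow> nat) \<Rightarrow> (nat \<Rightarrow> real) \<Rightarrow> (nat \<Rightarrow> real)" where
  "simplex_push p \<theta> a = (\<lambda>j. \<Sum>i | i \<le> p \<and> \<theta> i = j. a i)"


section \<open>Quotient spaces\<close>

definition quotient_topology :: "'a topology \<Rightarrow> ('a \<times> 'a) set \<Rightarrow> 'a set topology" where
  "quotient_topology T R =
     topology (\<lambda>U. U \<subseteq> topspace T // R \<and> openin T {x \<in> topspace T. R `` {x} \<in> U})"

lemma openin_quotient_topology:
  "openin (quotient_topology T R) U \<longleftrightarrow>
     U \<subseteq> topspace T // R \<and> openin T {x \<in> topspace T. R `` {x} \<in> U}"
proof -
  have 1: "{x \<in> topspace T. R `` {x} \<in> U \<inter> V} =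
      {x \<in> topspace T. R `` {x} \<in> U} \<inter> {x \<in> topspace T. R `` {x} \<in> V}" for U V
    by auto
  have 2: "{x \<in> topspace T. R `` {x} \<in> \<Union>\<K>} = (\<Union>K\<in>\<K>. {x \<in> topspace T. R `` {x} \<in> K})" for \<K>
    by auto
  have "istopology (\<lambda>U. U \<subseteq> topspace T // R \<and> openin T {x \<in> topspace T. R `` {x} \<in> U})"
    unfolding istopology_def 1 2 by blast
  then show ?thesis
    by (simp add: quotient_topology_def)
qed

lemma topspace_quotient_topology [simp]:
  "topspace (quotient_topology T R) = topspace T // R"
proof -
  have "{x \<in> topspace T. R `` {x} \<in> topspace T // R} = topspace T"
    by (auto intro: quotientI)
  then have "openin (quotient_topology T R) (topspace T // R)"
    by (simp add: openin_quotient_topology)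
  then show ?thesis
    by (metis openin_quotient_topology openin_subset openin_topspace subset_antisym)
qed

lemma quotient_map_quotient_topology:
  "quotient_map T (quotient_topology T R) (\<lambda>x. R `` {x})"
  by (auto simp: quotient_map_def openin_quotient_topology quotient_def)


section \<open>The space \<open>\<Delta>\<^sub>g\<close>\<close>

definition simplex_coproduct :: "nat \<Rightarrow> (nat \<times> lgraph set \<times> (nat \<Rightarrow> real)) topology" where
  "simplex_coproduct g =
     sum_topology (\<lambda>p. prod_topology (discrete_topology (labelled_classes g p))
                         (subtopology (powertop_real UNIV) (standard_simplex p))) UNIV"

inductive glue ::
    "nat \<Rightarrow> nat \<times> lgraph set \<times> (nat \<Rightarrow> real) \<Rightarrow> nat \<times> lgraph set \<times> (nat \<Rightarrow> real) \<Rightarrow> bool"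
  for g where
  "glue g (q, x, simplex_push p \<theta> a) (p, face_map g p \<theta> x, a)"
    if "inj_on \<theta> {..p}" and "\<theta> ` {..p} \<subseteq> {..q}" and "x \<in> labelled_classes g q" and "a \<in> standard_simplex p"

definition glue_rel ::
    "nat \<Rightarrow> ((nat \<times> lgraph set \<times> (nat \<Rightarrow> real)) \<times> (nat \<times> lgraph set \<times> (nat \<Rightarrow> real))) set" where
  "glue_rel g = {(s, t). s \<in> topspace (simplex_coproduct g) \<and>
                         t \<in> topspace (simplex_coproduct g) \<and> equivclp (glue g) s t}"

definition tropical_Delta :: "nat \<Rightarrow> (nat \<times> lgraph set \<times> (nat \<Rightarrow> real)) set topology" where
  "tropical_Delta g = quotient_topology (simplex_coproduct g) (glue_rel g)"


section \<open>Simple connectedness of abstract topological spaces\<close>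

text \<open>
  Nonempty, path connected, and every loop is homotopic to the constant loop relative to its
  base point.  The library's \<open>simply_connected\<close> only concerns subsets of type-class spaces.
\<close>

definition simply_connected_space :: "'a topology \<Rightarrow> bool" where
  "simply_connected_space T \<longleftrightarrow> topspace T \<noteq> {} \<and> path_connected_space T \<and>
     (\<forall>x c. pathin T c \<and> c 0 = x \<and> c 1 = x \<longrightarrow>
        homotopic_with (\<lambda>d. d 0 = x \<and> d 1 = x) (top_of_set {0..1}) T c (\<lambda>_. x))"

end

theory Submission
  imports Defs
begin

text \<open>
  Every point lies in a simplex, from which a straight segment leads to a vertex, a stable graph with
  one edge \<open>e\<close>.  Such a graph has positive weight at every vertex, so a loop can be added to it at
  the cost of one unit of weight; contracting \<open>e\<close> in the resulting graph with two edges leaves the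
  loop on a vertex of weight \<open>g - 1\<close>, which is the base point.  This yields a path from the base
  point to every point.  Up to homotopy it is independent of the choices made: adding two loops, or
  adding a loop to a graph with two edges, gives triangles of \<open>\<Delta>\<^sub>g\<close> that compare the choices, and the
  sides of these triangles given by two loops on one vertex are folded by the automorphism exchanging the
  loops, hence null-homotopic.  The only graphs with two edges to which no loop can be added have one
  vertex and are folded as well.

  These paths are compatible with segments in simplices.  A path near a given point can be deformed to
  segments, because a neighbourhood of the point contracts along segments: if \<open>k\<close> edges are strictly
  longer than all others, move linearly towards the graph in which just these \<open>k\<close> edges survive, with
  equal lengths.  Hence the paths from the base point are compatible with all paths, and all loops
  are null-homotopic.
\<close>

section \<open>Contractions of weighted graphs\<close>

text \<open>Graph automorphisms glue simplices to themselves, so a cell is only a quotient of a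
  simplex, and its vertices and edges need not be distinct. Homotopies are therefore built in one
  simplex at a time, by convexity, and then mapped to the quotient. The local contraction must
  respect the same symmetries. This is why it equalises all of the longest edges: the target is
  invariant under relabelling and is read off from the coordinates alone. Let \<open>Q z\<close> be
  the chosen path to \<open>z\<close>. Compatibility with a path \<open>d\<close> from
  \<open>x\<close> to \<open>y\<close> means that \<open>Q x\<close> followed by \<open>d\<close> is
  homotopic to \<open>Q y\<close>; for a loop the two ends agree, \<open>Q x\<close> cancels and
  \<open>d\<close> is null-homotopic. On the combinatorial side, contracting edges one by one picks
  vertex names that do not compose. Contraction is therefore treated as a relation: it composes, and
  its target is determined up to isomorphism by the surviving labels. Adding a loop is the inverse
  of contracting it, so the enlarged graph has the old one as a face.\<close>

definition adjacency :: "('v, 'e) wgraph \<Rightarrow> 'e set \<Rightarrow> ('v \<times> 'v) set" where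
  "adjacency G F = {(x, y). \<exists>e\<in>F. ends G e = {#x, y#}}"

text \<open>
  A contraction is described without reference to the order of the contracted edges or to the choice
  of representatives for merged vertices: the fibres of \<open>\<pi>\<close> are the components of the subgraph of
  contracted edges, and the weight of a vertex is the genus of its fibre, written with summands
  \<open>w(v) - 1\<close> so that the condition is stable under composition.  The map \<open>h\<close> sends surviving
  edges back to the original graph.
\<close>

definition contraction_via ::
    "('v, 'e) wgraph \<Rightarrow> ('w, 'f) wgraph \<Rightarrow> ('v \<Rightarrow> 'w) \<Rightarrow> ('f \<Rightarrow> 'e) \<Rightarrow> bool" where
  "contraction_via G G' \<pi> h \<longleftrightarrow>
     \<pi> ` verts G = verts G' \<and> inj_on h (edges G') \<and> h ` edges G' \<subseteq> edges G \<and>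
     (\<forall>e\<in>edges G'. ends G' e = image_mset \<pi> (ends G (h e))) \<and>
     (\<forall>u\<in>verts G. \<forall>v\<in>verts G. \<pi> u = \<pi> v \<longleftrightarrow> (u, v) \<in> (adjacency G (edges G - h ` edges G'))\<^sup>*) \<and>
     (\<forall>v'\<in>verts G'. int (weight G' v') =
        (\<Sum>v | v \<in> verts G \<and> \<pi> v = v'. int (weight G v) - 1)
        + int (card {e \<in> edges G - h ` edges G'. image_mset \<pi> (ends G e) = {#v', v'#}}) + 1)"

lemma contraction_viaD:
  assumes "contraction_via G G' \<pi> h"
  shows "\<pi> ` verts G = verts G'" "inj_on h (edges G')" "h ` edges G' \<subseteq> edges G"
    "\<And>e. e \<in> edges G' \<Longrightarrow> ends G' e = image_mset \<pi> (ends G (h e))"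
    "\<And>u v. u \<in> verts G \<Longrightarrow> v \<in> verts G \<Longrightarrow>
       \<pi> u = \<pi> v \<longleftrightarrow> (u, v) \<in> (adjacency G (edges G - h ` edges G'))\<^sup>*"
    "\<And>v'. v' \<in> verts G' \<Longrightarrow> int (weight G' v') =
        (\<Sum>v | v \<in> verts G \<and> \<pi> v = v'. int (weight G v) - 1)
        + int (card {e \<in> edges G - h ` edges G'. image_mset \<pi> (ends G e) = {#v', v'#}}) + 1"
  using assms unfolding contraction_via_def by blast+

section \<open>Composition of contractions, and what they preserve\<close>

lemma finite_graph_ends:
  assumes "finite_graph G" "e \<in> edges G"
  obtains x y where "ends G e = {#x, y#}" "x \<in> verts G" "y \<in> verts G"
proof -
  from assms have "size (ends G e) = Suc (Suc 0)" and V: "set_mset (ends G e) \<subseteq> verts G"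
    by (auto simp: finite_graph_def)
  then obtain x M where "ends G e = add_mset x M" "size M = Suc 0"
    by (metis size_Suc_Diff1 size_eq_Suc_imp_elem insert_DiffM size_add_mset Suc_inject)
  moreover then obtain y where "M = {#y#}" by (metis size_1_singleton_mset One_nat_def)
  ultimately show ?thesis using V that by auto
qed

lemma adjacency_verts:
  assumes "finite_graph G" "F \<subseteq> edges G" "(x, y) \<in> adjacency G F"
  shows "x \<in> verts G" "y \<in> verts G"
proof -
  obtain e where "e \<in> F" "ends G e = {#x, y#}" using assms(3) by (auto simp: adjacency_def)
  moreover have "\<forall>e\<in>edges G. set_mset (ends G e) \<subseteq> verts G" using assms(1) by (auto simp: finite_graph_def)
  ultimately have "set_mset {#x, y#} \<subseteq> verts G" using assms(2) by (metis subsetD)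
  then show "x \<in> verts G" "y \<in> verts G" by auto
qed

lemma contraction_via_id: "contraction_via G G id id" if "finite_graph G"
proof -
  have *: "{v \<in> verts G. v = v'} = {v'}" if "v' \<in> verts G" for v' using that by auto
  show ?thesis
    by (auto simp: contraction_via_def adjacency_def *)
qed

text \<open>Its ends are adjacent through a contracted edge, hence lie in one fibre. So the weight
  formula counts every contracted edge at exactly one vertex.\<close>

lemma contraction_via_contracted_end:
  assumes G: "finite_graph G" and c: "contraction_via G G' \<pi> h" and e: "e \<in> edges G - h ` edges G'"
  shows "\<exists>v'\<in>verts G'. image_mset \<pi> (ends G e) = {#v', v'#}"
proof -
  obtain x y where xy: "ends G e = {#x, y#}" "x \<in> verts G" "y \<in> verts G"
    using finite_graph_ends[OF G] e by blast
  then have "(x, y) \<in> adjacency G (edges G - h ` edges G')" using e by (auto simp: adjacency_def)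
  then have "\<pi> x = \<pi> y" using contraction_viaD(5)[OF c xy(2,3)] by blast
  then show ?thesis using xy contraction_viaD(1)[OF c] by auto
qed

text \<open>The edges contracted by the composite are those contracted first together with the lifts
  of those contracted second. In terms of \<open>weight - 1\<close> the weight formula is purely
  additive over fibres, so it composes.\<close>

lemma contraction_via_trans:
  assumes G: "finite_graph G" and G': "finite_graph G'"
    and c: "contraction_via G G' \<pi> h" and c': "contraction_via G' G'' \<pi>' h'"
  shows "contraction_via G G'' (\<pi>' \<circ> \<pi>) (h \<circ> h')"
proof -
  note d = contraction_viaD[OF c] and d' = contraction_viaD[OF c']
  define F where "F = edges G - h ` edges G'"
  define F' where "F' = edges G' - h' ` edges G''"
  have F'': "edges G - (h \<circ> h') ` edges G'' = F \<union> h ` F'" and disj: "F \<inter> h ` F' = {}"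
    using d(2,3) d'(3) by (auto simp: F_def F'_def image_iff inj_on_def)
  have finV: "finite (verts G)" "finite (verts G')" and finE: "finite F" "finite F'"
    using G G' by (auto simp: finite_graph_def F_def F'_def)
  have Fsub: "F \<subseteq> edges G" "h ` F' \<subseteq> edges G" using d(3) by (auto simp: F_def F'_def)
  have conn: "\<pi>' (\<pi> u) = \<pi>' (\<pi> v) \<longleftrightarrow> (u, v) \<in> (adjacency G (F \<union> h ` F'))\<^sup>*"
    if uv: "u \<in> verts G" "v \<in> verts G" for u v
  proof
    assume "(u, v) \<in> (adjacency G (F \<union> h ` F'))\<^sup>*"
    then show "\<pi>' (\<pi> u) = \<pi>' (\<pi> v)"
    proof (induction rule: rtrancl_induct)
      case (step y z)
      have yz: "y \<in> verts G" "z \<in> verts G"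
        using adjacency_verts[OF G _ step(2)] Fsub by auto
      from step(2) obtain e where e: "e \<in> F \<union> h ` F'" "ends G e = {#y, z#}" by (auto simp: adjacency_def)
      show ?case
      proof (cases "e \<in> F")
        case True
        then have "(y, z) \<in> adjacency G F" using e by (auto simp: adjacency_def)
        then show ?thesis using d(5)[OF yz] step by (auto simp: F_def)
      next
        case False
        then obtain e' where e': "e' \<in> F'" "e = h e'" using e by auto
        then have "ends G' e' = {#\<pi> y, \<pi> z#}" using d(4)[of e'] e by (auto simp: F'_def)
        then have "(\<pi> y, \<pi> z) \<in> adjacency G' F'" using e' by (auto simp: adjacency_def)
        then show ?thesis using d'(5)[of "\<pi> y" "\<pi> z"] yz d(1) step by (auto simp: F'_def)
      qed
    qed simp
  next
    have sub: "(adjacency G F)\<^sup>* \<subseteq> (adjacency G (F \<union> h ` F'))\<^sup>*"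
      by (rule rtrancl_mono) (auto simp: adjacency_def)
    assume "\<pi>' (\<pi> u) = \<pi>' (\<pi> v)"
    then have "(\<pi> u, \<pi> v) \<in> (adjacency G' F')\<^sup>*"
      using d'(5)[of "\<pi> u" "\<pi> v"] d(1) uv by (auto simp: F'_def)
    \<comment> \<open>Lifting a path edge by edge leaves its end undetermined within a fibre, so the
      induction reaches every vertex of the fibre; these are joined by edges of \<open>F\<close>
      alone.\<close>
    then have "\<forall>w\<in>verts G. \<pi> w = \<pi> v \<longrightarrow> (u, w) \<in> (adjacency G (F \<union> h ` F'))\<^sup>*"
    proof (induction rule: rtrancl_induct)
      case base
      show ?case
      proof (intro ballI impI)
        fix w assume "w \<in> verts G" "\<pi> w = \<pi> u"
        then have "(u, w) \<in> (adjacency G F)\<^sup>*" using d(5)[OF uv(1), of w] by (simp add: F_def)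
        then show "(u, w) \<in> (adjacency G (F \<union> h ` F'))\<^sup>*" using sub by blast
      qed
    next
      case (step y z)
      show ?case
      proof (intro ballI impI)
        fix w assume w: "w \<in> verts G" "\<pi> w = z"
        from step(2) obtain e' where e': "e' \<in> F'" "ends G' e' = {#y, z#}" by (auto simp: adjacency_def)
        then have he: "h e' \<in> edges G" using Fsub by auto
        then obtain a b where ab: "ends G (h e') = {#a, b#}" "a \<in> verts G" "b \<in> verts G"
          using finite_graph_ends[OF G] by metis
        have "{#y, z#} = {#\<pi> a, \<pi> b#}" using d(4)[of e'] e' ab by (auto simp: F'_def)
        \<comment> \<open>The lifted edge is unordered; its ends are named so that it leads from the
          fibre of \<open>y\<close> to that of \<open>z\<close>.\<close>
        then consider "y = \<pi> a" "z = \<pi> b" | "y = \<pi> b" "z = \<pi> a" by (auto simp: add_eq_conv_ex)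
        then obtain a' b' where ab': "ends G (h e') = {#a', b'#}" "a' \<in> verts G" "b' \<in> verts G" "y = \<pi> a'" "z = \<pi> b'"
          using ab by cases (blast, metis add_mset_commute)
        have 1: "(u, a') \<in> (adjacency G (F \<union> h ` F'))\<^sup>*" using step ab' by auto
        have 2: "(a', b') \<in> adjacency G (F \<union> h ` F')" using ab' e' by (auto simp: adjacency_def)
        have 3: "(b', w) \<in> (adjacency G (F \<union> h ` F'))\<^sup>*"
          using d(5)[OF ab'(3) w(1)] w(2) ab'(5) sub by (auto simp: F_def)
        show "(u, w) \<in> (adjacency G (F \<union> h ` F'))\<^sup>*" using 1 2 3 by (meson rtrancl_trans rtrancl_into_rtrancl)
      qed
    qed
    then show "(u, v) \<in> (adjacency G (F \<union> h ` F'))\<^sup>*" using uv by auto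
  qed
  have wt: "int (weight G'' v'') =
        (\<Sum>v | v \<in> verts G \<and> \<pi>' (\<pi> v) = v''. int (weight G v) - 1)
        + int (card {e \<in> F \<union> h ` F'. image_mset \<pi>' (image_mset \<pi> (ends G e)) = {#v'', v''#}}) + 1"
    if v'': "v'' \<in> verts G''" for v''
  proof -
    define V' where "V' = {v' \<in> verts G'. \<pi>' v' = v''}"
    define A where "A v' = {e \<in> F. image_mset \<pi> (ends G e) = {#v', v'#}}" for v'
    have finV': "finite V'" using finV by (auto simp: V'_def)
    have "int (weight G'' v'') = (\<Sum>v'\<in>V'. int (weight G' v') - 1)
        + int (card {e \<in> F'. image_mset \<pi>' (ends G' e) = {#v'', v''#}}) + 1"
      using d'(6)[OF v''] by (simp add: V'_def F'_def)
    also have "(\<Sum>v'\<in>V'. int (weight G' v') - 1) =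
        (\<Sum>v'\<in>V'. (\<Sum>v | v \<in> verts G \<and> \<pi> v = v'. int (weight G v) - 1)) + (\<Sum>v'\<in>V'. int (card (A v')))"
      unfolding sum.distrib[symmetric]
      by (rule sum.cong[OF refl]) (use d(6) in \<open>auto simp: V'_def A_def F_def\<close>)
    also have "(\<Sum>v'\<in>V'. (\<Sum>v | v \<in> verts G \<and> \<pi> v = v'. int (weight G v) - 1)) =
      (\<Sum>v\<in>(\<Union>v'\<in>V'. {v. v \<in> verts G \<and> \<pi> v = v'}). int (weight G v) - 1)"
      by (rule sum.UNION_disjoint[symmetric]) (use finV' finV in auto)
    also have "(\<Union>v'\<in>V'. {v. v \<in> verts G \<and> \<pi> v = v'}) = {v. v \<in> verts G \<and> \<pi>' (\<pi> v) = v''}"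
      using d(1) by (auto simp: V'_def)
    also have "(\<Sum>v'\<in>V'. int (card (A v'))) = int (card (\<Union>v'\<in>V'. A v'))"
      unfolding of_nat_sum[symmetric]
      by (subst card_UN_disjoint) (use finV' finE in \<open>auto simp: A_def add_eq_conv_ex\<close>)
    \<comment> \<open>An edge of \<open>F\<close> is already a loop after the first contraction, so
      it determines the vertex of \<open>G'\<close> at which it is counted.\<close>
    also have "(\<Union>v'\<in>V'. A v') = {e \<in> F. image_mset \<pi>' (image_mset \<pi> (ends G e)) = {#v'', v''#}}"
    proof (intro equalityI subsetI)
      fix e assume e: "e \<in> {e \<in> F. image_mset \<pi>' (image_mset \<pi> (ends G e)) = {#v'', v''#}}"
      then obtain v' where v': "v' \<in> verts G'" "image_mset \<pi> (ends G e) = {#v', v'#}"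
        using contraction_via_contracted_end[OF G c, of e] by (auto simp: F_def)
      moreover have "\<pi>' v' = v''" using e v' by (auto simp: add_eq_conv_ex)
      ultimately show "e \<in> (\<Union>v'\<in>V'. A v')" using e by (auto simp: V'_def A_def intro!: bexI[of _ v'])
    qed (auto simp: V'_def A_def)
    also have "card {e \<in> F'. image_mset \<pi>' (ends G' e) = {#v'', v''#}} =
       card {e \<in> h ` F'. image_mset \<pi>' (image_mset \<pi> (ends G e)) = {#v'', v''#}}"
    proof (rule bij_betw_same_card[of h], rule bij_betw_imageI)
      show "inj_on h {e \<in> F'. image_mset \<pi>' (ends G' e) = {#v'', v''#}}"
        by (rule inj_on_subset[OF d(2)]) (auto simp: F'_def)
      have "ends G' e = image_mset \<pi> (ends G (h e))" if "e \<in> F'" for e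
        using d(4) that by (auto simp: F'_def)
      then have "h ` {e \<in> F'. P (ends G' e)} = {e \<in> h ` F'. P (image_mset \<pi> (ends G e))}" for P
        by auto
      from this[of "\<lambda>M. image_mset \<pi>' M = {#v'', v''#}"]
      show "h ` {e \<in> F'. image_mset \<pi>' (ends G' e) = {#v'', v''#}} =
         {e \<in> h ` F'. image_mset \<pi>' (image_mset \<pi> (ends G e)) = {#v'', v''#}}" .
    qed
    finally have *: "int (weight G'' v'') = (\<Sum>v | v \<in> verts G \<and> \<pi>' (\<pi> v) = v''. int (weight G v) - 1) +
        int (card {e \<in> F. image_mset \<pi>' (image_mset \<pi> (ends G e)) = {#v'', v''#}}) +
        int (card {e \<in> h ` F'. image_mset \<pi>' (image_mset \<pi> (ends G e)) = {#v'', v''#}}) + 1" .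
    have "card {e \<in> F \<union> h ` F'. P e} = card {e \<in> F. P e} + card {e \<in> h ` F'. P e}" for P
    proof -
      have "{e \<in> F \<union> h ` F'. P e} = {e \<in> F. P e} \<union> {e \<in> h ` F'. P e}" by blast
      then show ?thesis using finE disj by (simp add: card_Un_disjoint disjoint_iff)
    qed
    then show ?thesis using * by simp
  qed
  have 1: "(\<pi>' \<circ> \<pi>) ` verts G = verts G''" using d(1) d'(1) by (metis image_comp)
  have 2: "inj_on (h \<circ> h') (edges G'')" using d(2) d'(2,3) by (meson comp_inj_on inj_on_subset)
  have 3: "(h \<circ> h') ` edges G'' \<subseteq> edges G" using d(3) d'(3) by auto
  have 4: "ends G'' e = image_mset (\<pi>' \<circ> \<pi>) (ends G ((h \<circ> h') e))" if "e \<in> edges G''" for e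
  proof -
    have "h' e \<in> edges G'" using that d'(3) by auto
    then show ?thesis using d(4) d'(4)[OF that] by (simp add: multiset.map_comp)
  qed
  show ?thesis
    unfolding contraction_via_def F''
    using 1 2 3 4 conn wt by (simp add: multiset.map_comp comp_def)
qed

text \<open>The summands \<open>weight - 1\<close> absorb the vertex count; this is the form that
  \<open>contraction_via\<close> sums over fibres.\<close>

lemma genus_alt: "finite (verts G) \<Longrightarrow> genus G = int (card (edges G)) + 1 + (\<Sum>v\<in>verts G. int (weight G v) - 1)"
  by (simp add: genus_def first_betti_def sum_subtractf)

lemma contraction_via_finite_graph:
  assumes G: "finite_graph G" and c: "contraction_via G G' \<pi> h"
  shows "finite_graph G'"
proof -
  note d = contraction_viaD[OF c]
  have "finite (edges G')"
    using d(2,3) G by (meson finite_graph_def finite_imageD finite_subset)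
  moreover have "size (ends G' e) = 2 \<and> set_mset (ends G' e) \<subseteq> verts G'" if "e \<in> edges G'" for e
  proof -
    have "h e \<in> edges G" using d(3) that by auto
    then have "size (ends G (h e)) = 2" "set_mset (ends G (h e)) \<subseteq> verts G"
      using G unfolding finite_graph_def by blast+
    then show ?thesis using d(4)[OF that] d(1) by auto
  qed
  moreover have "finite (verts G')" using G d(1) unfolding finite_graph_def by (metis finite_imageI)
  ultimately show ?thesis unfolding finite_graph_def by auto
qed

text \<open>Every contracted edge lowers the edge count by one and raises the sum of
  \<open>weight - 1\<close> by one, at the vertex where it becomes a loop.\<close>

lemma contraction_via_genus:
  assumes G: "finite_graph G" and c: "contraction_via G G' \<pi> h"
  shows "genus G' = genus G"
proof -
  note d = contraction_viaD[OF c]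
  have G': "finite_graph G'" using contraction_via_finite_graph[OF G c] .
  have fin: "finite (verts G)" "finite (edges G)" "finite (verts G')" "finite (edges G')"
    using G G' by (auto simp: finite_graph_def)
  define F where "F = edges G - h ` edges G'"
  have finF: "finite F" using fin by (auto simp: F_def)
  have "card (h ` edges G') \<le> card (edges G)" "card F = card (edges G) - card (h ` edges G')"
    using d(3) fin unfolding F_def by (auto simp: card_Diff_subset card_mono)
  then have cE: "int (card (edges G)) = int (card (edges G')) + int (card F)"
    using d(2) by (simp add: card_image)
  have "(\<Sum>v'\<in>verts G'. int (weight G' v') - 1) = (\<Sum>v'\<in>verts G'.
        (\<Sum>v | v \<in> verts G \<and> \<pi> v = v'. int (weight G v) - 1)
        + int (card {e \<in> F. image_mset \<pi> (ends G e) = {#v', v'#}}))"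
    by (rule sum.cong) (use d(6) in \<open>auto simp: F_def\<close>)
  also have "\<dots> = (\<Sum>v'\<in>verts G'. \<Sum>v | v \<in> verts G \<and> \<pi> v = v'. int (weight G v) - 1)
     + (\<Sum>v'\<in>verts G'. int (card {e \<in> F. image_mset \<pi> (ends G e) = {#v', v'#}}))"
    by (rule sum.distrib)
  also have "(\<Sum>v'\<in>verts G'. \<Sum>v | v \<in> verts G \<and> \<pi> v = v'. int (weight G v) - 1)
    = (\<Sum>v\<in>verts G. int (weight G v) - 1)"
    by (rule sum.group) (use d(1) fin in auto)
  also have "(\<Sum>v'\<in>verts G'. int (card {e \<in> F. image_mset \<pi> (ends G e) = {#v', v'#}}))
     = int (card (\<Union>v'\<in>verts G'. {e \<in> F. image_mset \<pi> (ends G e) = {#v', v'#}}))"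
    unfolding of_nat_sum[symmetric] by (subst card_UN_disjoint) (use fin finF in \<open>auto simp: add_eq_conv_ex\<close>)
  also have "(\<Union>v'\<in>verts G'. {e \<in> F. image_mset \<pi> (ends G e) = {#v', v'#}}) = F"
    using contraction_via_contracted_end[OF G c] by (auto simp: F_def)
  finally show ?thesis
    using fin cE by (simp add: genus_alt)
qed

lemma connected_graph_alt:
  "connected_graph G \<longleftrightarrow> verts G \<noteq> {} \<and> (\<forall>u\<in>verts G. \<forall>v\<in>verts G. (u, v) \<in> (adjacency G (edges G))\<^sup>*)"
  by (simp add: connected_graph_def adjacency_def)

lemma contraction_via_connected:
  assumes G: "finite_graph G" and con: "connected_graph G" and c: "contraction_via G G' \<pi> h"
  shows "connected_graph G'"
proof -
  note d = contraction_viaD[OF c]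
  have "(\<pi> u, \<pi> v) \<in> (adjacency G' (edges G'))\<^sup>*"
    if uv: "u \<in> verts G" "(u, v) \<in> (adjacency G (edges G))\<^sup>*" for u v
    using uv(2)
  proof (induction rule: rtrancl_induct)
    case (step y z)
    have yz: "y \<in> verts G" "z \<in> verts G" using adjacency_verts[OF G _ step(2)] by auto
    from step(2) obtain e where e: "e \<in> edges G" "ends G e = {#y, z#}" by (auto simp: adjacency_def)
    show ?case
    proof (cases "e \<in> h ` edges G'")
      case True
      then obtain e' where "e' \<in> edges G'" "e = h e'" by auto
      then have "(\<pi> y, \<pi> z) \<in> adjacency G' (edges G')"
        using d(4)[of e'] e by (auto simp: adjacency_def intro!: bexI[of _ e'])
      then show ?thesis using step by (meson rtrancl_into_rtrancl)
    next
      case False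
      then have "(y, z) \<in> adjacency G (edges G - h ` edges G')" using e by (auto simp: adjacency_def)
      then show ?thesis using d(5)[OF yz] step by auto
    qed
  qed simp
  then have "\<forall>u\<in>\<pi> ` verts G. \<forall>v\<in>\<pi> ` verts G. (u, v) \<in> (adjacency G' (edges G'))\<^sup>*"
    using con unfolding connected_graph_alt by blast
  then show ?thesis using con d(1) unfolding connected_graph_alt by auto
qed

section \<open>Contraction of one edge and of a set of edges\<close>

definition merge :: "'v::linorder set \<Rightarrow> 'v \<Rightarrow> 'v" where
  "merge A x = (if x \<in> A then Min A else x)"

lemma contract_edge_simps:
  "verts (contract_edge e G) = merge (set_mset (ends G e)) ` verts G"
  "edges (contract_edge e G) = edges G - {e}"
  "ends (contract_edge e G) e' = image_mset (merge (set_mset (ends G e))) (ends G e')"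
  "weight (contract_edge e G) = (weight G)(Min (set_mset (ends G e)) :=
     if is_loop G e then weight G (Min (set_mset (ends G e))) + 1 else (\<Sum>v\<in>set_mset (ends G e). weight G v))"
  by (simp_all add: contract_edge_def Let_def merge_def[abs_def])

text \<open>The weight formula covers both cases of \<open>contract_edge\<close>: a loop gives
  \<open>(w - 1) + 1 + 1\<close>, and two distinct ends give
  \<open>(w - 1) + (w' - 1) + 1 + 1\<close>.\<close>

lemma contract_edge_contraction:
  assumes G: "finite_graph G" and e: "e \<in> edges G"
  shows "contraction_via G (contract_edge e G) (merge (set_mset (ends G e))) id"
proof -
  \<comment> \<open>Ordering the ends makes \<open>x\<close> the representative chosen by
    \<open>Min\<close>.\<close>
  obtain x y where xy: "ends G e = {#x, y#}" "x \<in> verts G" "y \<in> verts G" "x \<le> y"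
    using finite_graph_ends[OF G e] by (metis add_mset_commute linear)
  have A: "set_mset (ends G e) = {x, y}" and m: "Min {x, y} = x" using xy by (auto simp: min_def)
  have loop: "is_loop G e \<longleftrightarrow> x = y" using xy by (auto simp: is_loop_def add_eq_conv_ex)
  have adj: "adjacency G {e} = {(x, y), (y, x)}" using xy by (auto simp: adjacency_def add_eq_conv_ex)
  have rt: "(u, v) \<in> {(x, y), (y, x)}\<^sup>* \<longleftrightarrow> u = v \<or> u \<in> {x, y} \<and> v \<in> {x, y}" for u v
  proof
    assume "(u, v) \<in> {(x, y), (y, x)}\<^sup>*"
    then show "u = v \<or> u \<in> {x, y} \<and> v \<in> {x, y}" by (induction rule: rtrancl_induct) auto
  qed auto
  have E: "edges G - (edges G - {e}) = {e}" using e by auto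
  have I: "id ` X = X" for X :: "'b set" by simp
  have M: "merge {x, y} v = (if v = y then x else v)" for v using m by (auto simp: merge_def)
  have wt: "int (((weight G)(x := if x = y then weight G x + 1 else sum (weight G) {x, y})) v') =
      (\<Sum>v | v \<in> verts G \<and> merge {x, y} v = v'. int (weight G v) - 1) +
       int (card {e' \<in> {e}. image_mset (merge {x, y}) (ends G e') = {#v', v'#}}) + 1"
    if "v' \<in> merge {x, y} ` verts G" for v'
  proof (cases "v' = x")
    case True
    then have 1: "{v. v \<in> verts G \<and> merge {x, y} v = v'} = {x, y}"
      and 2: "{e' \<in> {e}. image_mset (merge {x, y}) (ends G e') = {#v', v'#}} = {e}"
      using xy by (auto simp: M)
    show ?thesis unfolding 1 2 using True by auto
  next
    case False
    then have 1: "{v. v \<in> verts G \<and> merge {x, y} v = v'} = {v'}"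
      and 2: "{e' \<in> {e}. image_mset (merge {x, y}) (ends G e') = {#v', v'#}} = {}"
      using xy that by (auto simp: M add_eq_conv_ex)
    show ?thesis unfolding 1 2 using False by auto
  qed
  have conn: "merge {x, y} u = merge {x, y} v \<longleftrightarrow> (u, v) \<in> {(x, y), (y, x)}\<^sup>*" for u v
    unfolding rt M by auto
  show ?thesis
    unfolding contraction_via_def contract_edge_simps A m loop I E adj
    using wt conn by (intro conjI) simp_all
qed

lemma count_image_mset_sum:
  assumes "finite S" "set_mset N \<subseteq> S"
  shows "count (image_mset f N) y = (\<Sum>x | x \<in> S \<and> f x = y. count N x)"
proof -
  have "count (image_mset f N) y = (\<Sum>x\<in>f -` {y} \<inter> set_mset N. count N x)" by (simp add: count_image_mset)
  also have "\<dots> = (\<Sum>x | x \<in> S \<and> f x = y. count N x)"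
    by (rule sum.mono_neutral_left) (use assms in \<open>auto simp: not_in_iff\<close>)
  finally show ?thesis .
qed

text \<open>The merged vertex has weight 0 only if \<open>e\<close> is not a loop and both ends have
  weight 0; its valence is then at least \<open>3 + 3 - 2\<close>.\<close>

lemma contract_edge_stable:
  assumes G: "finite_graph G" and e: "e \<in> edges G" and st: "stable G"
  shows "stable (contract_edge e G)"
proof -
  obtain x y where xy: "ends G e = {#x, y#}" "x \<in> verts G" "y \<in> verts G" "x \<le> y"
    using finite_graph_ends[OF G e] by (metis add_mset_commute linear)
  have A: "set_mset (ends G e) = {x, y}" and m: "Min {x, y} = x" using xy by (auto simp: min_def)
  have loop: "is_loop G e \<longleftrightarrow> x = y" using xy by (auto simp: is_loop_def add_eq_conv_ex)
  have M: "merge {x, y} v = (if v = y then x else v)" for v using m by (auto simp: merge_def)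
  have fin: "finite (verts G)" "finite (edges G)" using G by (auto simp: finite_graph_def)
  \<comment> \<open>Valences add over a fibre, less the contribution of \<open>e\<close>. The
    truncated subtraction is exact because \<open>e\<close> is among the edges counted.\<close>
  have val: "valence (contract_edge e G) v' = (\<Sum>v | v \<in> verts G \<and> merge {x, y} v = v'.
     valence G v - count {#x, y#} v)" for v'
  proof -
    have "valence (contract_edge e G) v' = (\<Sum>e'\<in>edges G - {e}. \<Sum>v | v \<in> verts G \<and> merge {x, y} v = v'. count (ends G e') v)"
      unfolding valence_def contract_edge_simps A
      by (rule sum.cong[OF refl], rule count_image_mset_sum) (use G in \<open>auto simp: finite_graph_def\<close>)
    also have "\<dots> = (\<Sum>v | v \<in> verts G \<and> merge {x, y} v = v'. \<Sum>e'\<in>edges G - {e}. count (ends G e') v)"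
      by (rule sum.swap)
    also have "\<dots> = (\<Sum>v | v \<in> verts G \<and> merge {x, y} v = v'. valence G v - count {#x, y#} v)"
      unfolding valence_def by (rule sum.cong[OF refl]) (use fin e xy in \<open>simp add: sum_diff1_nat\<close>)
    finally show ?thesis .
  qed
  show ?thesis
    unfolding stable_def
  proof (intro ballI impI)
    fix v' assume v': "v' \<in> verts (contract_edge e G)" "weight (contract_edge e G) v' = 0"
    show "3 \<le> valence (contract_edge e G) v'"
    proof (cases "v' = x")
      case True
      then have "x \<noteq> y" "weight G x = 0" "weight G y = 0"
        using v' by (auto simp: contract_edge_simps A m loop split: if_splits)
      then have "valence G x \<ge> 3" "valence G y \<ge> 3" using st xy by (auto simp: stable_def)
      moreover have "{v. v \<in> verts G \<and> merge {x, y} v = v'} = {x, y}" using True xy by (auto simp: M)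
      ultimately show ?thesis unfolding val using \<open>x \<noteq> y\<close> by simp
    next
      case False
      then have "v' \<in> verts G" "v' \<noteq> y" "weight G v' = 0"
        using v' xy by (auto simp: contract_edge_simps A m M split: if_splits)
      moreover have "{v. v \<in> verts G \<and> merge {x, y} v = v'} = {v'}" using False v' xy by (auto simp: contract_edge_simps A M)
      ultimately show ?thesis unfolding val using st False by (simp add: stable_def)
    qed
  qed
qed

lemma contract_edge_stable_wgraph:
  assumes "stable_wgraph g G" "e \<in> edges G"
  shows "stable_wgraph g (contract_edge e G)"
proof -
  have G: "finite_graph G" "connected_graph G" "stable G" "genus G = int g"
    using assms by (auto simp: stable_wgraph_def)
  note c = contract_edge_contraction[OF G(1) assms(2)]
  show ?thesis
    unfolding stable_wgraph_def
    using contraction_via_finite_graph[OF G(1) c] contraction_via_connected[OF G(1,2) c]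
      contraction_via_genus[OF G(1) c] contract_edge_stable[OF G(1) assms(2) G(3)] G(4) by simp
qed

text \<open>Prepares the addition of loops: a vertex of positive weight has an image of positive
  weight in every face, so a loop can be attached there too.\<close>

lemma contract_edge_weight_mono:
  assumes G: "finite_graph G" and e: "e \<in> edges G"
  shows "weight G v \<le> weight (contract_edge e G) (merge (set_mset (ends G e)) v)"
proof -
  obtain x y where xy: "ends G e = {#x, y#}" "x \<in> verts G" "y \<in> verts G" "x \<le> y"
    using finite_graph_ends[OF G e] by (metis add_mset_commute linear)
  have A: "set_mset (ends G e) = {x, y}" and m: "Min {x, y} = x" using xy by (auto simp: min_def)
  have loop: "is_loop G e \<longleftrightarrow> x = y" using xy by (auto simp: is_loop_def add_eq_conv_ex)
  show ?thesis by (auto simp: contract_edge_simps A m loop merge_def)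
qed

text \<open>Surviving edges keep their names, so the edge map is \<open>id\<close>
  throughout.\<close>

lemma fold_contract_edge:
  assumes "stable_wgraph g G" "distinct es" "set es \<subseteq> edges G"
  shows "stable_wgraph g (fold contract_edge es G) \<and> edges (fold contract_edge es G) = edges G - set es \<and>
    (\<exists>\<pi>. contraction_via G (fold contract_edge es G) \<pi> id \<and>
       (\<forall>v. weight G v \<le> weight (fold contract_edge es G) (\<pi> v)))"
  using assms
proof (induction es arbitrary: G)
  case Nil
  then have "contraction_via G G id id" by (simp add: contraction_via_id stable_wgraph_def)
  with Nil show ?case by (auto simp: id_def intro!: exI[of _ "\<lambda>x. x"])
next
  case (Cons e es)
  define G1 where "G1 = contract_edge e G"
  let ?m = "merge (set_mset (ends G e))"
  have fG: "finite_graph G" using Cons by (simp add: stable_wgraph_def)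
  have e: "e \<in> edges G" using Cons by simp
  have G1: "stable_wgraph g G1" using Cons contract_edge_stable_wgraph[of g G e] by (simp add: G1_def)
  have "set es \<subseteq> edges G1" using Cons.prems by (auto simp: G1_def contract_edge_simps)
  then obtain \<pi> where IH: "stable_wgraph g (fold contract_edge es G1)" "edges (fold contract_edge es G1) = edges G1 - set es"
     "contraction_via G1 (fold contract_edge es G1) \<pi> id"
     "\<And>v. weight G1 v \<le> weight (fold contract_edge es G1) (\<pi> v)"
    using Cons.IH[OF G1] Cons.prems by (metis distinct.simps(2))
  have "contraction_via G (fold contract_edge es G1) (\<pi> \<circ> ?m) (id \<circ> id)"
    using contraction_via_trans[OF fG _ contract_edge_contraction[OF fG e] IH(3)[unfolded G1_def]] G1
    by (simp add: stable_wgraph_def G1_def)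
  moreover have "weight G v \<le> weight (fold contract_edge es G1) ((\<pi> \<circ> ?m) v)" for v
    using contract_edge_weight_mono[OF fG e, of v] IH(4)[of "?m v"] by (simp add: G1_def)
  moreover have "edges (fold contract_edge es G1) = edges G - set (e # es)"
    using IH(2) by (auto simp: G1_def contract_edge_simps)
  ultimately show ?case using IH(1) unfolding G1_def fold_simps comp_id by blast
qed

lemma contract_edges:
  assumes "stable_wgraph g G" "F \<subseteq> edges G"
  obtains \<pi> where "stable_wgraph g (contract_edges F G)" "edges (contract_edges F G) = edges G - F"
    "contraction_via G (contract_edges F G) \<pi> id" "\<And>v. weight G v \<le> weight (contract_edges F G) (\<pi> v)"
proof -
  have "finite F" using assms by (auto simp: stable_wgraph_def finite_graph_def intro: finite_subset)
  then show ?thesis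
    using fold_contract_edge[OF assms(1), of "sorted_list_of_set F"] assms(2) that
    by (auto simp: contract_edges_def)
qed


section \<open>Faces of isomorphism classes\<close>

text \<open>The arrow form of a face: \<open>B\<close> represents the face of \<open>A\<close> along
  \<open>\<theta>\<close>. The vertex map stays visible because loops will be attached at a vertex
  and at its image.\<close>

definition contracts_to :: "(nat \<Rightarrow> nat) \<Rightarrow> (nat \<Rightarrow> nat) \<Rightarrow> lgraph \<Rightarrow> lgraph \<Rightarrow> bool" where
  "contracts_to \<pi> \<theta> A B \<longleftrightarrow>
     (\<exists>h. contraction_via (fst A) (fst B) \<pi> h \<and> (\<forall>e\<in>edges (fst B). snd A (h e) = \<theta> (snd B e)))"

definition labelled_class :: "nat \<Rightarrow> nat \<Rightarrow> lgraph \<Rightarrow> lgraph set" where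
  "labelled_class g p A = iso_rel g p `` {A}"

lemma labelled_graphsD:
  assumes "A \<in> labelled_graphs g p"
  shows "stable_wgraph g (fst A)" "card (edges (fst A)) = p + 1" "bij_betw (snd A) (edges (fst A)) {..p}"
    "finite_graph (fst A)" "connected_graph (fst A)" "stable (fst A)" "genus (fst A) = int g"
    "finite (edges (fst A))" "finite (verts (fst A))"
proof -
  show "stable_wgraph g (fst A)" and *: "card (edges (fst A)) = p + 1" "bij_betw (snd A) (edges (fst A)) {..p}"
    using assms by (auto simp: labelled_graphs_def)
  then show "finite_graph (fst A)" "connected_graph (fst A)" "stable (fst A)" "genus (fst A) = int g"
    by (auto simp: stable_wgraph_def)
  then show "finite (edges (fst A))" "finite (verts (fst A))" by (auto simp: finite_graph_def)
qed

lemma contracts_to_trans: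
  assumes "finite_graph (fst A)" "finite_graph (fst B)" "contracts_to \<pi> \<theta> A B" "contracts_to \<pi>' \<phi> B C"
  shows "contracts_to (\<pi>' \<circ> \<pi>) (\<theta> \<circ> \<phi>) A C"
proof -
  obtain h where h: "contraction_via (fst A) (fst B) \<pi> h" "\<forall>e\<in>edges (fst B). snd A (h e) = \<theta> (snd B e)"
    using assms(3) by (auto simp: contracts_to_def)
  obtain k where k: "contraction_via (fst B) (fst C) \<pi>' k" "\<forall>e\<in>edges (fst C). snd B (k e) = \<phi> (snd C e)"
    using assms(4) by (auto simp: contracts_to_def)
  have "k ` edges (fst C) \<subseteq> edges (fst B)" using contraction_viaD(3)[OF k(1)] .
  then show ?thesis
    using contraction_via_trans[OF assms(1,2) h(1) k(1)] h(2) k(2) unfolding contracts_to_def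
    by (auto intro!: exI[of _ "h \<circ> k"])
qed

text \<open>An isomorphism contracts no edge, so composition and uniqueness of contractions also
  govern isomorphisms. The edge map is inverted because contractions send surviving edges
  backwards.\<close>

lemma isomorphic_contracts_to:
  assumes "finite_graph (fst A)" "labelled_isomorphic A B"
  shows "\<exists>\<pi>. contracts_to \<pi> id A B"
proof -
  obtain G \<tau> H \<sigma> where AB: "A = (G, \<tau>)" "B = (H, \<sigma>)" by (metis prod.collapse)
  obtain f h where f: "bij_betw f (verts G) (verts H)" and h: "bij_betw h (edges G) (edges H)"
    and e: "\<And>e. e \<in> edges G \<Longrightarrow> ends H (h e) = image_mset f (ends G e)"
    and w: "\<And>v. v \<in> verts G \<Longrightarrow> weight H (f v) = weight G v"
    and t: "\<And>e. e \<in> edges G \<Longrightarrow> \<sigma> (h e) = \<tau> e"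
    using assms(2) unfolding AB labelled_isomorphic_def by auto
  define k where "k = inv_into (edges G) h"
  have k: "bij_betw k (edges H) (edges G)" unfolding k_def using h by (rule bij_betw_inv_into)
  have kim: "k ` edges H = edges G" using k by (simp add: bij_betw_def)
  have hk: "h (k e) = e" "k e \<in> edges G" if "e \<in> edges H" for e
    using that h k unfolding k_def by (auto simp: bij_betw_def f_inv_into_f)
  have inj: "f u = f v \<longleftrightarrow> u = v" if "u \<in> verts G" "v \<in> verts G" for u v
    using f that by (auto simp: bij_betw_def inj_on_def)
  have "contraction_via G H f k"
    unfolding contraction_via_def kim
  proof (intro conjI ballI)
    show "f ` verts G = verts H" "inj_on k (edges H)" "edges G \<subseteq> edges G" using f k by (auto simp: bij_betw_def)
    show "ends H e' = image_mset f (ends G (k e'))" if "e' \<in> edges H" for e'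
      using e[OF hk(2)[OF that]] hk(1)[OF that] by simp
    show "f u = f v \<longleftrightarrow> (u, v) \<in> (adjacency G (edges G - edges G))\<^sup>*" if "u \<in> verts G" "v \<in> verts G" for u v
      using inj[OF that] by (simp add: adjacency_def)
    show "int (weight H v') = (\<Sum>v | v \<in> verts G \<and> f v = v'. int (weight G v) - 1) +
       int (card {e \<in> edges G - edges G. image_mset f (ends G e) = {#v', v'#}}) + 1" if v': "v' \<in> verts H" for v'
    proof -
      have "v' \<in> f ` verts G" using f v' by (simp add: bij_betw_def)
      then obtain v where v: "v \<in> verts G" "f v = v'" by auto
      then have *: "{u. u \<in> verts G \<and> f u = v'} = {v}" using inj by auto
      show ?thesis unfolding * using w[OF v(1)] v(2) by simp
    qed
  qed
  moreover have "\<tau> (k e) = \<sigma> e" if "e \<in> edges H" for e using t[OF hk(2)[OF that]] hk(1)[OF that] by simp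
  ultimately show ?thesis by (auto simp: contracts_to_def AB)
qed

text \<open>Equal edge numbers leave nothing to contract, so every fibre is a single vertex and the
  weight formula reads \<open>(w - 1) + 0 + 1\<close>.\<close>

lemma labelled_isomorphic_weight:
  assumes "finite_graph (fst A)" "contracts_to \<pi> id A B" "A \<in> labelled_graphs g p" "B \<in> labelled_graphs g p" "v \<in> verts (fst A)"
  shows "weight (fst B) (\<pi> v) = weight (fst A) v"
proof -
  obtain h where h: "contraction_via (fst A) (fst B) \<pi> h"
    using assms(2) by (auto simp: contracts_to_def)
  note d = contraction_viaD[OF h]
  have E: "h ` edges (fst B) = edges (fst A)"
    using d(2,3) labelled_graphsD(2,8)[OF assms(3)] labelled_graphsD(2)[OF assms(4)]
    by (intro card_subset_eq) (auto simp: card_image)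
  have *: "{u. u \<in> verts (fst A) \<and> \<pi> u = \<pi> v} = {v}"
    using d(5)[OF _ assms(5)] assms(5) unfolding E by (auto simp: adjacency_def)
  have "\<pi> v \<in> verts (fst B)" using d(1) assms(5) by auto
  from d(6)[OF this] show ?thesis unfolding * E by simp
qed

text \<open>The labels and \<open>\<theta>\<close> determine which edges survive, these determine
  the fibres, and the fibres determine the weights.\<close>

lemma contracts_to_unique:
  assumes A: "A \<in> labelled_graphs g q" and B: "B \<in> labelled_graphs g p" and C: "C \<in> labelled_graphs g p"
    and AB: "contracts_to \<pi> \<theta> A B" and AC: "contracts_to \<rho> \<theta> A C"
  shows "labelled_isomorphic B C"
proof -
  obtain G \<tau> H \<sigma> K \<kappa> where eq: "A = (G, \<tau>)" "B = (H, \<sigma>)" "C = (K, \<kappa>)" by (metis prod.collapse)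
  note gA = labelled_graphsD[OF A, unfolded eq fst_conv snd_conv]
  note gB = labelled_graphsD[OF B, unfolded eq fst_conv snd_conv]
  note gC = labelled_graphsD[OF C, unfolded eq fst_conv snd_conv]
  obtain h where h: "contraction_via G H \<pi> h" "\<And>e. e \<in> edges H \<Longrightarrow> \<tau> (h e) = \<theta> (\<sigma> e)"
    using AB by (auto simp: contracts_to_def eq)
  obtain k where k: "contraction_via G K \<rho> k" "\<And>e. e \<in> edges K \<Longrightarrow> \<tau> (k e) = \<theta> (\<kappa> e)"
    using AC by (auto simp: contracts_to_def eq)
  note dh = contraction_viaD[OF h(1)] and dk = contraction_viaD[OF k(1)]
  \<comment> \<open>The preimage picked by \<open>inv_into\<close> is immaterial:
    \<open>\<pi>\<close> and \<open>\<rho>\<close> contract the same edges and so have the same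
    fibres.\<close>
  define f where "f v = \<rho> (inv_into (verts G) \<pi> v)" for v
  define m where "m e = inv_into (edges K) \<kappa> (\<sigma> e)" for e
  have m: "m e \<in> edges K" "\<kappa> (m e) = \<sigma> e" if "e \<in> edges H" for e
  proof -
    have "\<sigma> e \<in> \<kappa> ` edges K" using gB(3) gC(3) that by (auto simp: bij_betw_def)
    then show "m e \<in> edges K" "\<kappa> (m e) = \<sigma> e" unfolding m_def by (auto simp: inv_into_into f_inv_into_f)
  qed
  have km: "k (m e) = h e" if "e \<in> edges H" for e
  proof -
    have "\<tau> (k (m e)) = \<tau> (h e)" using k(2)[OF m(1)[OF that]] h(2)[OF that] m(2)[OF that] by simp
    moreover have "k (m e) \<in> edges G" "h e \<in> edges G" using dk(3) dh(3) m(1)[OF that] that by auto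
    ultimately show ?thesis using gA(3) by (auto simp: bij_betw_def inj_on_def)
  qed
  have bm: "bij_betw m (edges H) (edges K)"
  proof -
    have "inj_on m (edges H)" by (rule inj_onI) (metis m(2) gB(3) bij_betw_def inj_on_def)
    moreover have "m ` edges H = edges K"
      by (rule card_subset_eq) (use m(1) gB(2) gC(2,8) calculation in \<open>auto simp: card_image\<close>)
    ultimately show ?thesis by (simp add: bij_betw_def)
  qed
  have same: "h ` edges H = k ` edges K"
    using bm km by (metis (no_types, lifting) bij_betw_imp_surj_on image_cong image_image)
  have f\<pi>: "f (\<pi> v) = \<rho> v" if "v \<in> verts G" for v
  proof -
    have "\<pi> v \<in> \<pi> ` verts G" using that by auto
    then have "inv_into (verts G) \<pi> (\<pi> v) \<in> verts G" "\<pi> (inv_into (verts G) \<pi> (\<pi> v)) = \<pi> v"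
      by (auto simp: inv_into_into f_inv_into_f)
    then show ?thesis
      unfolding f_def using dh(5) dk(5) that same by metis
  qed
  have bf: "bij_betw f (verts H) (verts K)"
  proof (rule bij_betw_imageI)
    show "inj_on f (verts H)"
    proof (rule inj_onI)
      fix x y assume "x \<in> verts H" "y \<in> verts H" "f x = f y"
      moreover then obtain u v where "x = \<pi> u" "y = \<pi> v" "u \<in> verts G" "v \<in> verts G" using dh(1) by blast
      ultimately show "x = y" using dh(5) dk(5) f\<pi> same by metis
    qed
    show "f ` verts H = verts K"
      unfolding dh(1)[symmetric] dk(1)[symmetric] image_image using f\<pi> by (auto simp: image_iff)
  qed
  have ends: "ends K (m e) = image_mset f (ends H e)" if e: "e \<in> edges H" for e
  proof -
    have "h e \<in> edges G" using dh(3) e by auto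
    then have "set_mset (ends G (h e)) \<subseteq> verts G" using gA(4) unfolding finite_graph_def by blast
    then have "image_mset \<rho> (ends G (h e)) = image_mset (f \<circ> \<pi>) (ends G (h e))"
      using f\<pi> by (intro image_mset_cong) auto
    then show ?thesis using dk(4)[OF m(1)[OF e]] dh(4)[OF e] km[OF e] by (simp add: multiset.map_comp)
  qed
  have wt: "weight K (f v') = weight H v'" if v': "v' \<in> verts H" for v'
  proof -
    obtain w where w: "w \<in> verts G" "v' = \<pi> w" using dh(1) v' by blast
    have fv': "f v' \<in> verts K" using bf v' by (auto simp: bij_betw_def)
    have inj: "f (\<pi> v) = f v' \<longleftrightarrow> \<pi> v = v'" if "v \<in> verts G" for v
      using bf v' that dh(1) unfolding bij_betw_def inj_on_def by blast
    have 1: "{v. v \<in> verts G \<and> \<rho> v = f v'} = {v. v \<in> verts G \<and> \<pi> v = v'}"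
      using f\<pi> inj by auto
    have 2: "{e \<in> edges G - k ` edges K. image_mset \<rho> (ends G e) = {#f v', f v'#}}
       = {e \<in> edges G - h ` edges H. image_mset \<pi> (ends G e) = {#v', v'#}}"
    proof -
      have "image_mset \<rho> (ends G e) = {#f v', f v'#} \<longleftrightarrow> image_mset \<pi> (ends G e) = {#v', v'#}" if e: "e \<in> edges G" for e
      proof -
        obtain x y where xy: "ends G e = {#x, y#}" "x \<in> verts G" "y \<in> verts G"
          using finite_graph_ends[OF gA(4) e] by metis
        show ?thesis
          using xy f\<pi>[OF xy(2)] f\<pi>[OF xy(3)] inj[OF xy(2)] inj[OF xy(3)] by (auto simp: add_eq_conv_ex)
      qed
      then show ?thesis using same by blast
    qed
    have "int (weight K (f v')) = int (weight H v')"
      using dh(6)[OF v'] dk(6)[OF fv'] unfolding 1 2 by simp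
    then show ?thesis by simp
  qed
  show ?thesis
    unfolding eq labelled_isomorphic_def prod.case using bf bm ends wt m(2) by blast
qed

section \<open>Isomorphism classes and functoriality of their faces\<close>

lemma labelled_isomorphic_refl: "labelled_isomorphic A A"
  unfolding labelled_isomorphic_def by (auto intro!: exI[of _ "\<lambda>x. x"] simp: bij_betw_def)

lemma contracts_to_id: "finite_graph (fst A) \<Longrightarrow> contracts_to id id A A"
  unfolding contracts_to_def by (intro exI[of _ id] conjI contraction_via_id) auto

text \<open>By uniqueness, since \<open>A\<close> contracts along \<open>id\<close> both to
  \<open>B\<close> and to itself. Transitivity arises in the same way from two arrows out of the
  middle graph.\<close>

lemma labelled_isomorphic_sym:
  assumes "A \<in> labelled_graphs g p" "B \<in> labelled_graphs g p" "labelled_isomorphic A B"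
  shows "labelled_isomorphic B A"
proof -
  obtain \<pi> where "contracts_to \<pi> id A B" using isomorphic_contracts_to assms labelled_graphsD(4) by blast
  then show ?thesis using contracts_to_unique[OF assms(1,2,1)] contracts_to_id labelled_graphsD(4)[OF assms(1)] by blast
qed

lemma labelled_isomorphic_trans:
  assumes "A \<in> labelled_graphs g p" "B \<in> labelled_graphs g p" "C \<in> labelled_graphs g p" "labelled_isomorphic A B" "labelled_isomorphic B C"
  shows "labelled_isomorphic A C"
proof -
  have "labelled_isomorphic B A" using labelled_isomorphic_sym assms by blast
  then obtain \<pi> \<rho> where "contracts_to \<pi> id B A" "contracts_to \<rho> id B C"
    using isomorphic_contracts_to assms labelled_graphsD(4) by meson
  then show ?thesis using contracts_to_unique assms by blast
qed

lemma equiv_iso_rel: "equiv (labelled_graphs g p) (iso_rel g p)"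
proof (rule equivI)
  show "refl_on (labelled_graphs g p) (iso_rel g p)"
    by (auto simp: refl_on_def iso_rel_def labelled_isomorphic_refl)
  show "sym (iso_rel g p)" by (auto simp: sym_def iso_rel_def intro: labelled_isomorphic_sym)
  show "trans (iso_rel g p)" unfolding trans_def iso_rel_def using labelled_isomorphic_trans by blast
qed (auto simp: iso_rel_def)

lemma labelled_class_eq_iff:
  assumes "A \<in> labelled_graphs g p" "B \<in> labelled_graphs g p"
  shows "labelled_class g p A = labelled_class g p B \<longleftrightarrow> labelled_isomorphic A B"
  unfolding labelled_class_def using eq_equiv_class_iff[OF equiv_iso_rel assms] assms by (simp add: iso_rel_def)

lemma labelled_class_self: "A \<in> labelled_graphs g p \<Longrightarrow> A \<in> labelled_class g p A"
  by (simp add: labelled_class_def iso_rel_def labelled_isomorphic_refl)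

lemma labelled_class_in: "A \<in> labelled_graphs g p \<Longrightarrow> labelled_class g p A \<in> labelled_classes g p"
  by (simp add: labelled_class_def labelled_classes_def quotientI)

lemma labelled_classesE:
  assumes "x \<in> labelled_classes g p"
  obtains A where "A \<in> labelled_graphs g p" "x = labelled_class g p A"
  using assms unfolding labelled_classes_def labelled_class_def by (auto elim: quotientE)

text \<open>Realises a face by the representative that \<open>face_map\<close> uses. Weight growth
  and the inclusion of edges are recorded so that a loop added to \<open>A\<close> can be added to
  \<open>B\<close> under the same name.\<close>

lemma face_exists:
  assumes A: "A \<in> labelled_graphs g q" and inj: "inj_on \<theta> {..p}" and sub: "\<theta> ` {..p} \<subseteq> {..q}"
  defines "B \<equiv> (contract_edges {e \<in> edges (fst A). snd A e \<notin> \<theta> ` {..p}} (fst A), inv_into {..p} \<theta> \<circ> snd A)"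
  obtains \<pi> where "B \<in> labelled_graphs g p" "contracts_to \<pi> \<theta> A B"
    "\<And>v. weight (fst A) v \<le> weight (fst B) (\<pi> v)" "edges (fst B) \<subseteq> edges (fst A)"
proof -
  obtain G \<tau> where eq: "A = (G, \<tau>)" by (metis prod.collapse)
  note gA = labelled_graphsD[OF A, unfolded eq fst_conv snd_conv]
  define F where "F = {e \<in> edges G. \<tau> e \<notin> \<theta> ` {..p}}"
  obtain \<pi> where \<pi>: "stable_wgraph g (contract_edges F G)" "edges (contract_edges F G) = edges G - F"
    "contraction_via G (contract_edges F G) \<pi> id" "\<And>v. weight G v \<le> weight (contract_edges F G) (\<pi> v)"
    using contract_edges[OF gA(1), of F] by (auto simp: F_def)
  have B: "B = (contract_edges F G, inv_into {..p} \<theta> \<circ> \<tau>)" by (simp add: B_def F_def eq)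
  have EF: "edges G - F = {e \<in> edges G. \<tau> e \<in> \<theta> ` {..p}}" by (auto simp: F_def)
  have b1: "bij_betw \<tau> (edges G - F) (\<theta> ` {..p})"
  proof (rule bij_betw_imageI)
    show "inj_on \<tau> (edges G - F)" using gA(3) by (auto simp: bij_betw_def intro: inj_on_subset)
    have "\<tau> ` edges G = {..q}" using gA(3) by (simp add: bij_betw_def)
    moreover have "\<tau> ` {e \<in> edges G. \<tau> e \<in> T} = \<tau> ` edges G \<inter> T" for T by auto
    ultimately show "\<tau> ` (edges G - F) = \<theta> ` {..p}" unfolding EF using sub by auto
  qed
  then have "bij_betw (inv_into {..p} \<theta> \<circ> \<tau>) (edges G - F) {..p}"
    using inj by (intro bij_betw_trans[OF b1] bij_betw_inv_into) (simp add: bij_betw_def)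
  then have LB: "B \<in> labelled_graphs g p"
    unfolding labelled_graphs_def B using \<pi>(1,2) bij_betw_same_card[of _ "edges G - F" "{..p}"] by auto
  have "contracts_to \<pi> \<theta> A B"
    unfolding contracts_to_def B eq
    by (rule exI[of _ id]) (use \<pi>(2,3) EF in \<open>auto simp: f_inv_into_f\<close>)
  then show ?thesis using that LB \<pi>(2,4) by (simp add: B eq)
qed

text \<open>All members of the union contribute the same class, by uniqueness. So a face can be
  computed from any convenient contraction.\<close>

lemma face_map_class:
  assumes A: "A \<in> labelled_graphs g q" and B: "B \<in> labelled_graphs g p"
    and inj: "inj_on \<theta> {..p}" and sub: "\<theta> ` {..p} \<subseteq> {..q}" and AB: "contracts_to \<pi> \<theta> A B"
  shows "face_map g p \<theta> (labelled_class g q A) = labelled_class g p B"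
proof -
  have "iso_rel g p `` {(contract_edges {e \<in> edges (fst C). snd C e \<notin> \<theta> ` {..p}} (fst C), inv_into {..p} \<theta> \<circ> snd C)}
     = labelled_class g p B" if C: "C \<in> labelled_class g q A" for C
  proof -
    have C': "C \<in> labelled_graphs g q" "labelled_isomorphic A C" using C by (auto simp: labelled_class_def iso_rel_def)
    obtain \<rho> where \<rho>: "contracts_to \<rho> id A C" using isomorphic_contracts_to C' labelled_graphsD(4)[OF A] by blast
    let ?D = "(contract_edges {e \<in> edges (fst C). snd C e \<notin> \<theta> ` {..p}} (fst C), inv_into {..p} \<theta> \<circ> snd C)"
    obtain \<sigma> where D: "?D \<in> labelled_graphs g p" "contracts_to \<sigma> \<theta> C ?D"
      by (rule face_exists[OF C'(1) inj sub])
    have "contracts_to (\<sigma> \<circ> \<rho>) (id \<circ> \<theta>) A ?D"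
      by (rule contracts_to_trans[OF labelled_graphsD(4)[OF A] labelled_graphsD(4)[OF C'(1)] \<rho> D(2)])
    then have "labelled_isomorphic ?D B" using contracts_to_unique[OF A D(1) B] AB by simp
    then show ?thesis using labelled_class_eq_iff[OF D(1) B] by (simp add: labelled_class_def)
  qed
  moreover have "labelled_class g q A \<noteq> {}" using labelled_class_self[OF A] by auto
  ultimately show ?thesis unfolding face_map_def by (auto simp: case_prod_beta)
qed

lemma face_map_in_classes:
  assumes "x \<in> labelled_classes g q" "inj_on \<theta> {..p}" "\<theta> ` {..p} \<subseteq> {..q}"
  shows "face_map g p \<theta> x \<in> labelled_classes g p"
proof -
  obtain A where A: "A \<in> labelled_graphs g q" "x = labelled_class g q A" using assms(1) labelled_classesE by blast
  show ?thesis
    by (rule face_exists[OF A(1) assms(2,3)]) (use A assms in \<open>simp add: face_map_class labelled_class_in\<close>)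
qed

lemma face_map_face_map:
  assumes x: "x \<in> labelled_classes g r" and \<theta>: "inj_on \<theta> {..q}" "\<theta> ` {..q} \<subseteq> {..r}"
    and \<phi>: "inj_on \<phi> {..p}" "\<phi> ` {..p} \<subseteq> {..q}"
  shows "face_map g p \<phi> (face_map g q \<theta> x) = face_map g p (\<theta> \<circ> \<phi>) x"
proof -
  obtain A where A: "A \<in> labelled_graphs g r" "x = labelled_class g r A" using x labelled_classesE by blast
  obtain B \<pi> where B: "B \<in> labelled_graphs g q" "contracts_to \<pi> \<theta> A B" by (rule face_exists[OF A(1) \<theta>])
  obtain C \<rho> where C: "C \<in> labelled_graphs g p" "contracts_to \<rho> \<phi> B C" by (rule face_exists[OF B(1) \<phi>])
  have "contracts_to (\<rho> \<circ> \<pi>) (\<theta> \<circ> \<phi>) A C"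
    by (rule contracts_to_trans[OF labelled_graphsD(4)[OF A(1)] labelled_graphsD(4)[OF B(1)] B(2) C(2)])
  moreover have "inj_on (\<theta> \<circ> \<phi>) {..p}" "(\<theta> \<circ> \<phi>) ` {..p} \<subseteq> {..r}"
    using \<theta> \<phi> by (auto intro: comp_inj_on inj_on_subset)
  ultimately show ?thesis
    using face_map_class[OF A(1) B(1) \<theta> B(2)] face_map_class[OF B(1) C(1) \<phi> C(2)] face_map_class[OF A(1) C(1)] A(2) by simp
qed


section \<open>Adding loops\<close>

text \<open>The subtraction is truncated, so the genus is kept only where \<open>u\<close> has
  positive weight; there, contracting \<open>l\<close> undoes the construction.\<close>

definition add_loop :: "'v \<Rightarrow> 'e \<Rightarrow> ('v, 'e) wgraph \<Rightarrow> ('v, 'e) wgraph" where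
  "add_loop u l G = \<lparr>verts = verts G, edges = insert l (edges G),
     ends = (ends G)(l := {#u, u#}), weight = (weight G)(u := weight G u - 1)\<rparr>"

lemma add_loop_simps [simp]:
  "verts (add_loop u l G) = verts G"
  "edges (add_loop u l G) = insert l (edges G)"
  "ends (add_loop u l G) = (ends G)(l := {#u, u#})"
  "weight (add_loop u l G) = (weight G)(u := weight G u - 1)"
  by (simp_all add: add_loop_def)

text \<open>Label 0 goes to the new loop and the other labels move up, so that \<open>Suc\<close> is
  the face in which the loop is contracted.\<close>

definition loop_ext :: "nat \<Rightarrow> nat \<Rightarrow> lgraph \<Rightarrow> lgraph" where
  "loop_ext u l A = (add_loop u l (fst A), \<lambda>e. if e = l then 0 else Suc (snd A e))"

lemma adjacency_rtrancl_loop: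
  assumes "ends G l = {#u, u#}"
  shows "(adjacency G (insert l F))\<^sup>* = (adjacency G F)\<^sup>*"
proof -
  have "adjacency G (insert l F) - Id = adjacency G F - Id"
    using assms by (auto simp: adjacency_def add_eq_conv_ex)
  then show ?thesis by (metis rtrancl_r_diff_Id)
qed

lemma adjacency_cong: "(\<And>e. e \<in> F \<Longrightarrow> ends G e = ends H e) \<Longrightarrow> adjacency G F = adjacency H F"
  by (auto simp: adjacency_def)

text \<open>At \<open>u\<close> the weight formula reads \<open>((w - 1) - 1) + 1 + 1\<close>, which
  returns the unit spent on the loop.\<close>

lemma contraction_remove_loop:
  assumes G: "finite_graph G" and u: "u \<in> verts G" "weight G u > 0" and l: "l \<notin> edges G"
  shows "contraction_via (add_loop u l G) G id id"
proof -
  have E: "insert l (edges G) - id ` edges G = {l}" using l by auto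
  have "adjacency (add_loop u l G) {} = {}" by (simp add: adjacency_def)
  then have rt: "(adjacency (add_loop u l G) {l})\<^sup>* = Id"
    using adjacency_rtrancl_loop[of "add_loop u l G" l u "{}"] by simp
  have fib: "{v \<in> verts G. id v = v'} = {v'}" if "v' \<in> verts G" for v' using that by auto
  have card: "card {e \<in> {l}. image_mset id (ends (add_loop u l G) e) = {#v', v'#}} = (if v' = u then 1 else 0)" for v'
  proof -
    have "{e \<in> {l}. image_mset id (ends (add_loop u l G) e) = {#v', v'#}} = (if v' = u then {l} else {})"
      by (auto simp: add_eq_conv_ex)
    then show ?thesis by simp
  qed
  show ?thesis
    unfolding contraction_via_def add_loop_simps(1,2) E rt card
    using l u by (auto simp: fib[simplified])
qed

text \<open>The unit of weight removed at \<open>u\<close> accounts for the one removed at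
  \<open>\<pi> u\<close>, whose fibre contains \<open>u\<close>, and the loop is not among the
  contracted edges. So adding a loop commutes with contraction.\<close>

lemma contraction_add_loop:
  assumes G: "finite_graph G" and c: "contraction_via G G' \<pi> h"
    and u: "u \<in> verts G" "weight G u > 0" "weight G' (\<pi> u) > 0" and l: "l \<notin> edges G" "l' \<notin> edges G'"
  shows "contraction_via (add_loop u l G) (add_loop (\<pi> u) l' G') \<pi> (h(l' := l))"
proof -
  note d = contraction_viaD[OF c]
  have him: "(h(l' := l)) ` insert l' (edges G') = insert l (h ` edges G')"
    using l by auto
  have E: "insert l (edges G) - insert l (h ` edges G') = edges G - h ` edges G'" using l by auto
  have inj: "inj_on (h(l' := l)) (insert l' (edges G'))"
    using d(2,3) l by (auto simp: inj_on_def)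
  have adj: "adjacency (add_loop u l G) (edges G - h ` edges G') = adjacency G (edges G - h ` edges G')"
    by (rule adjacency_cong) (use l in auto)
  have ends: "ends (add_loop (\<pi> u) l' G') e = image_mset \<pi> (ends (add_loop u l G) ((h(l' := l)) e))"
    if "e \<in> insert l' (edges G')" for e
    using that d(3) d(4)[of e] l by auto
  have wt: "int (weight (add_loop (\<pi> u) l' G') v') =
      (\<Sum>v | v \<in> verts G \<and> \<pi> v = v'. int (weight (add_loop u l G) v) - 1) +
      int (card {e \<in> edges G - h ` edges G'. image_mset \<pi> (ends (add_loop u l G) e) = {#v', v'#}}) + 1"
    if v': "v' \<in> verts G'" for v'
  proof -
    have 1: "{e \<in> edges G - h ` edges G'. image_mset \<pi> (ends (add_loop u l G) e) = {#v', v'#}} =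
      {e \<in> edges G - h ` edges G'. image_mset \<pi> (ends G e) = {#v', v'#}}"
      using l by auto
    have fin: "finite {v \<in> verts G. \<pi> v = v'}" using G by (simp add: finite_graph_def)
    have "(\<Sum>v | v \<in> verts G \<and> \<pi> v = v'. int (weight (add_loop u l G) v) - 1) =
      (\<Sum>v | v \<in> verts G \<and> \<pi> v = v'. (int (weight G v) - 1) + (if u = v then - 1 else 0))"
      by (rule sum.cong) (use u in \<open>auto simp: of_nat_diff\<close>)
    also have "\<dots> = (\<Sum>v | v \<in> verts G \<and> \<pi> v = v'. int (weight G v) - 1) +
         (\<Sum>v | v \<in> verts G \<and> \<pi> v = v'. if u = v then - 1 else 0)"
      by (rule sum.distrib)
    also have "(\<Sum>v | v \<in> verts G \<and> \<pi> v = v'. if u = v then - 1 else 0) = (if \<pi> u = v' then - 1 else (0::int))"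
      using fin u by (subst sum.delta') auto
    finally show ?thesis unfolding 1 using d(6)[OF v'] u by (auto simp: of_nat_diff)
  qed
  show ?thesis
    unfolding contraction_via_def him E add_loop_simps(1,2) adj
    using d(1,5) inj ends wt by (auto simp: subset_insertI2 d(3))
qed

text \<open>A vertex without edges would be the only vertex of a connected graph, and then there
  would be no edge at all.\<close>

lemma valence_pos:
  assumes G: "finite_graph G" and con: "connected_graph G" and E: "edges G \<noteq> {}" and u: "u \<in> verts G"
  shows "valence G u > 0"
proof -
  have "\<exists>e\<in>edges G. u \<in># ends G e"
  proof (rule ccontr)
    assume *: "\<not> (\<exists>e\<in>edges G. u \<in># ends G e)"
    obtain e where e: "e \<in> edges G" using E by auto
    obtain x y where xy: "ends G e = {#x, y#}" "x \<in> verts G" using finite_graph_ends[OF G e] by metis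
    then have "u \<noteq> x" "(u, x) \<in> (adjacency G (edges G))\<^sup>*"
      using * e con u by (auto simp: connected_graph_alt)
    then obtain z where "(u, z) \<in> adjacency G (edges G)" by (metis converse_rtranclE)
    then show False using * by (auto simp: adjacency_def)
  qed
  then obtain e where "e \<in> edges G" "u \<in># ends G e" by blast
  then have "count (ends G e) u > 0" "count (ends G e) u \<le> valence G u"
    unfolding valence_def using G by (auto intro: member_le_sum simp: finite_graph_def)
  then show ?thesis by linarith
qed

text \<open>Only \<open>u\<close> could become unstable. If its weight drops to 0, the loop gives
  valence 2 and connectedness gives at least one more.\<close>

lemma add_loop_stable_wgraph:
  assumes G: "stable_wgraph g G" and E: "edges G \<noteq> {}" and u: "u \<in> verts G" "weight G u > 0" and l: "l \<notin> edges G"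
  shows "stable_wgraph g (add_loop u l G)"
proof -
  have fG: "finite_graph G" and cG: "connected_graph G" and sG: "stable G" and gG: "genus G = int g"
    using G by (auto simp: stable_wgraph_def)
  have fin: "finite (verts G)" "finite (edges G)" using fG by (auto simp: finite_graph_def)
  have fL: "finite_graph (add_loop u l G)" using fG u l by (auto simp: finite_graph_def)
  have "adjacency (add_loop u l G) (edges G) = adjacency G (edges G)"
    by (rule adjacency_cong) (use l in auto)
  then have cL: "connected_graph (add_loop u l G)"
    using cG adjacency_rtrancl_loop[of "add_loop u l G" l u "edges G"] by (simp add: connected_graph_alt)
  \<comment> \<open>Contracting the loop returns \<open>G\<close>, and contractions preserve the
    genus.\<close>
  have gL: "genus (add_loop u l G) = int g"
    using contraction_via_genus[OF fL contraction_remove_loop[OF fG u l]] gG by simp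
  have val: "valence (add_loop u l G) v = valence G v + (if v = u then 2 else 0)" for v
  proof -
    have "(\<Sum>e\<in>edges G. count (((ends G)(l := {#u, u#})) e) v) = valence G v"
      unfolding valence_def by (rule sum.cong) (use l in auto)
    then show ?thesis using fin l by (simp add: valence_def)
  qed
  have "stable (add_loop u l G)"
    using sG valence_pos[OF fG cG E u(1)] unfolding stable_def val by auto
  then show ?thesis using fL cL gL by (simp add: stable_wgraph_def)
qed

lemma loop_ext_in:
  assumes A: "A \<in> labelled_graphs g p" and u: "u \<in> verts (fst A)" "weight (fst A) u > 0" and l: "l \<notin> edges (fst A)"
  shows "loop_ext u l A \<in> labelled_graphs g (Suc p)"
proof -
  note a = labelled_graphsD[OF A]
  have "edges (fst A) \<noteq> {}" using a(2) by auto
  then have "stable_wgraph g (add_loop u l (fst A))" using add_loop_stable_wgraph[OF a(1)] u l by blast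
  moreover have "card (edges (add_loop u l (fst A))) = Suc p + 1" using a(2,8) l by simp
  moreover have "bij_betw (\<lambda>e. if e = l then 0 else Suc (snd A e)) (insert l (edges (fst A))) {..Suc p}"
  proof (rule bij_betw_imageI)
    show "inj_on (\<lambda>e. if e = l then 0 else Suc (snd A e)) (insert l (edges (fst A)))"
      using a(3) by (auto simp: bij_betw_def inj_on_def)
    have "(\<lambda>e. if e = l then 0 else Suc (snd A e)) ` insert l (edges (fst A)) = insert 0 (Suc ` (snd A ` edges (fst A)))"
      using l by (auto simp: image_iff)
    also have "\<dots> = {..Suc p}" using a(3) by (simp add: bij_betw_def atMost_Suc_eq_insert_0)
    finally show "(\<lambda>e. if e = l then 0 else Suc (snd A e)) ` insert l (edges (fst A)) = {..Suc p}" .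
  qed
  ultimately show ?thesis by (simp add: labelled_graphs_def loop_ext_def)
qed

lemma loop_ext_contracts_to:
  assumes A: "A \<in> labelled_graphs g p" and u: "u \<in> verts (fst A)" "weight (fst A) u > 0" and l: "l \<notin> edges (fst A)"
  shows "contracts_to id Suc (loop_ext u l A) A"
  unfolding contracts_to_def loop_ext_def fst_conv snd_conv
  by (intro exI[of _ id] conjI contraction_remove_loop labelled_graphsD(4)[OF A] u l) (use l in auto)

text \<open>The injection \<open>case_nat 0 (Suc \<circ> \<theta>)\<close> keeps the loop label and
  shifts \<open>\<theta>\<close>: a face of an extended graph that retains the loop is the extension
  of a face.\<close>

lemma loop_ext_lift:
  assumes A: "A \<in> labelled_graphs g q" and AB: "contracts_to \<pi> \<theta> A B"
    and u: "u \<in> verts (fst A)" "weight (fst A) u > 0" "weight (fst B) (\<pi> u) > 0"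
    and l: "l \<notin> edges (fst A)" "l' \<notin> edges (fst B)"
  shows "contracts_to \<pi> (case_nat 0 (Suc \<circ> \<theta>)) (loop_ext u l A) (loop_ext (\<pi> u) l' B)"
proof -
  obtain h where h: "contraction_via (fst A) (fst B) \<pi> h" "\<forall>e\<in>edges (fst B). snd A (h e) = \<theta> (snd B e)"
    using AB by (auto simp: contracts_to_def)
  have "h e \<noteq> l" if "e \<in> edges (fst B)" for e using contraction_viaD(3)[OF h(1)] that l by auto
  then show ?thesis
    unfolding contracts_to_def loop_ext_def fst_conv snd_conv
    by (intro exI[of _ "h(l' := l)"] conjI contraction_add_loop[OF labelled_graphsD(4)[OF A] h(1)] u l) (use h(2) in auto)
qed

section \<open>Graphs with one vertex or few edges\<close>

lemma single_vertex:
  assumes con: "connected_graph G" and loops: "\<And>e. e \<in> edges G \<Longrightarrow> is_loop G e"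
  shows "\<exists>v. verts G = {v}"
proof -
  have sub: "adjacency G (edges G) \<subseteq> Id"
    using loops by (force simp: adjacency_def is_loop_def add_eq_conv_ex)
  have "u = v" if "(u, v) \<in> (adjacency G (edges G))\<^sup>*" for u v
    using that by induction (use sub in auto)
  then show ?thesis using con unfolding connected_graph_alt by (metis is_singletonI' is_singleton_def)
qed

text \<open>All edges are loops, and genus and edge number fix the weight, so the bijection of edges
  given by the labels is an isomorphism. In particular, permuting labels does not change the
  class.\<close>

lemma single_vertex_isomorphic:
  assumes A: "A \<in> labelled_graphs g p" and B: "B \<in> labelled_graphs g p"
    and v: "verts (fst A) = {v}" "verts (fst B) = {w}"
  shows "labelled_isomorphic A B"
proof -
  obtain G \<tau> H \<sigma> where eq: "A = (G, \<tau>)" "B = (H, \<sigma>)" by (metis prod.collapse)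
  note a = labelled_graphsD[OF A, unfolded eq fst_conv snd_conv] and b = labelled_graphsD[OF B, unfolded eq fst_conv snd_conv]
  have ev: "ends G e = {#v, v#}" if e: "e \<in> edges G" for e
    using finite_graph_ends[OF a(4) e] v by (metis eq(1) fst_conv singletonD)
  have ew: "ends H e = {#w, w#}" if e: "e \<in> edges H" for e
    using finite_graph_ends[OF b(4) e] v by (metis eq(2) fst_conv singletonD)
  define h where "h e = inv_into (edges H) \<sigma> (\<tau> e)" for e
  have h: "bij_betw h (edges G) (edges H)"
    unfolding h_def using bij_betw_trans[OF a(3) bij_betw_inv_into[OF b(3)]] by (simp add: comp_def)
  have hs: "\<sigma> (h e) = \<tau> e" if "e \<in> edges G" for e
  proof -
    have "\<tau> e \<in> \<sigma> ` edges H" using a(3) b(3) that by (auto simp: bij_betw_def)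
    then show ?thesis unfolding h_def by (rule f_inv_into_f)
  qed
  have eh: "ends H (h e) = {#w, w#}" if "e \<in> edges G" for e
    using ew h that by (auto simp: bij_betw_def)
  have wt: "weight H w = weight G v"
    using a(2,7) b(2,7) v by (simp add: genus_def first_betti_def eq)
  show ?thesis
    unfolding eq labelled_isomorphic_def prod.case
    by (rule exI[of _ "\<lambda>_. w"], rule exI[of _ h]) (use h hs v ev eh wt in \<open>auto simp: eq bij_betw_def\<close>)
qed

lemma valence_sum:
  assumes "finite_graph G"
  shows "(\<Sum>v\<in>verts G. valence G v) = 2 * card (edges G)"
proof -
  have "(\<Sum>v\<in>verts G. valence G v) = (\<Sum>e\<in>edges G. \<Sum>v\<in>verts G. count (ends G e) v)"
    unfolding valence_def by (rule sum.swap)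
  also have "\<dots> = (\<Sum>e\<in>edges G. 2)"
  proof (rule sum.cong[OF refl])
    fix e assume "e \<in> edges G"
    then have e: "size (ends G e) = 2" "set_mset (ends G e) \<subseteq> verts G" using assms unfolding finite_graph_def by blast+
    have "(\<Sum>v\<in>verts G. count (ends G e) v) = (\<Sum>v\<in>set_mset (ends G e). count (ends G e) v)"
      by (rule sum.mono_neutral_right) (use e assms in \<open>auto simp: finite_graph_def not_in_iff\<close>)
    then show "(\<Sum>v\<in>verts G. count (ends G e) v) = 2" using e by (simp add: size_multiset_overloaded_eq)
  qed
  finally show ?thesis by simp
qed

text \<open>The total valence is 2, too little for a vertex of weight 0.\<close>

lemma one_edge_weight_pos:
  assumes A: "A \<in> labelled_graphs g 0" and u: "u \<in> verts (fst A)"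
  shows "weight (fst A) u > 0"
proof (rule ccontr)
  note a = labelled_graphsD[OF A]
  assume "\<not> weight (fst A) u > 0"
  then have "valence (fst A) u \<ge> 3" using a(6) u by (simp add: stable_def)
  moreover have "valence (fst A) u \<le> (\<Sum>v\<in>verts (fst A). valence (fst A) v)"
    by (rule member_le_sum) (use u a(9) in auto)
  ultimately show False using valence_sum[OF a(4)] a(2) by simp
qed

text \<open>If all weights vanished, every vertex would need valence 3 out of a total of 4, which
  leaves room for one vertex.\<close>

lemma two_edges_cases:
  assumes A: "A \<in> labelled_graphs g 1"
  shows "(\<exists>v. verts (fst A) = {v}) \<or> (\<exists>u\<in>verts (fst A). weight (fst A) u > 0)"
proof (rule ccontr)
  note a = labelled_graphsD[OF A]
  assume *: "\<not> ?thesis"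
  then have "3 \<le> valence (fst A) v" if "v \<in> verts (fst A)" for v using a(6) that by (auto simp: stable_def)
  then have "(\<Sum>v\<in>verts (fst A). 3) \<le> (\<Sum>v\<in>verts (fst A). valence (fst A) v)" by (rule sum_mono)
  then have "card (verts (fst A)) \<le> 1" using valence_sum[OF a(4)] a(2) by simp
  moreover have "verts (fst A) \<noteq> {}" using a(5) by (simp add: connected_graph_def)
  ultimately have "card (verts (fst A)) = 1" using a(9) by (simp add: le_Suc_eq)
  then show False using * by (auto simp: card_1_singleton_iff)
qed

text \<open>The graph of the base point. Its vertex has valence 2, so stability requires
  \<open>g - 1 > 0\<close>.\<close>

lemma rose_in:
  assumes "g \<ge> 2"
  shows "(\<lparr>verts = {0}, edges = {0}, ends = \<lambda>_. {#0, 0#}, weight = \<lambda>_. g - 1\<rparr>, \<lambda>_. 0) \<in> labelled_graphs g 0"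
  using assms by (auto simp: labelled_graphs_def stable_wgraph_def finite_graph_def connected_graph_def stable_def genus_def
     first_betti_def bij_betw_def)


section \<open>Path homotopies in abstract topological spaces\<close>

definition join_path :: "(real \<Rightarrow> 'a) \<Rightarrow> (real \<Rightarrow> 'a) \<Rightarrow> real \<Rightarrow> 'a"  (infixr "\<frown>" 75) where
  "(p \<frown> q) t = (if t \<le> 1 / 2 then p (2 * t) else q (2 * t - 1))"

definition reverse_path :: "(real \<Rightarrow> 'a) \<Rightarrow> real \<Rightarrow> 'a" where
  "reverse_path p t = p (1 - t)"

definition sub_path :: "real \<Rightarrow> real \<Rightarrow> (real \<Rightarrow> 'a) \<Rightarrow> real \<Rightarrow> 'a" where
  "sub_path u v p t = p ((v - u) * t + u)"

abbreviation unit_interval :: "real topology" where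
  "unit_interval \<equiv> top_of_set {0..1}"

definition path_homotopic :: "'a topology \<Rightarrow> (real \<Rightarrow> 'a) \<Rightarrow> (real \<Rightarrow> 'a) \<Rightarrow> bool" where
  "path_homotopic X p q \<longleftrightarrow> homotopic_with (\<lambda>d. d 0 = p 0 \<and> d 1 = p 1) unit_interval X p q"

lemma path_homotopicD:
  assumes "path_homotopic X p q"
  shows "pathin X p" "pathin X q" "q 0 = p 0" "q 1 = p 1"
  using homotopic_with_imp_continuous_maps[OF assms[unfolded path_homotopic_def]]
    homotopic_with_imp_property[OF assms[unfolded path_homotopic_def]]
  by (auto simp: pathin_def)

lemma path_homotopic_refl: "pathin X p \<Longrightarrow> path_homotopic X p p"
  by (simp add: path_homotopic_def pathin_def)

lemma path_homotopic_sym: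
  assumes "path_homotopic X p q"
  shows "path_homotopic X q p"
proof -
  have "q 0 = p 0" "q 1 = p 1" using path_homotopicD[OF assms] by auto
  then show ?thesis
    using homotopic_with_symD[OF assms[unfolded path_homotopic_def]] by (simp add: path_homotopic_def)
qed

lemma path_homotopic_trans [trans]:
  assumes "path_homotopic X p q" "path_homotopic X q r"
  shows "path_homotopic X p r"
proof -
  have "q 0 = p 0" "q 1 = p 1" using path_homotopicD[OF assms(1)] by auto
  then show ?thesis
    using homotopic_with_trans[OF assms(1)[unfolded path_homotopic_def]] assms(2) by (simp add: path_homotopic_def)
qed

text \<open>Paths are functions on all reals of which only the values on \<open>[0,1]\<close> count;
  gluing identifies segments only there.\<close>

lemma path_homotopic_eq:
  assumes "pathin X p" "\<And>t. t \<in> {0..1} \<Longrightarrow> q t = p t"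
  shows "path_homotopic X p q"
  unfolding path_homotopic_def by (rule homotopic_with_equal) (use assms in \<open>auto simp: pathin_def\<close>)

text \<open>The source of the concrete homotopies below: reparametrizations, squares and triangles
  are images of straight-line homotopies in a convex set.\<close>

lemma path_homotopic_convex_image:
  fixes S :: "'b::real_normed_vector set"
  assumes S: "convex S" and f: "continuous_map (top_of_set S) X f"
    and p: "pathin (top_of_set S) p" and q: "pathin (top_of_set S) q"
    and ends: "p 0 = q 0" "p 1 = q 1"
  shows "path_homotopic X (f \<circ> p) (f \<circ> q)"
proof -
  have "homotopic_paths S p q"
  proof (rule homotopic_paths_linear)
    show "closed_segment (p t) (q t) \<subseteq> S" if "t \<in> {0..1}" for t
      using S p q that by (intro closed_segment_subset) (auto simp: pathin_def continuous_map_in_subtopology)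
  qed (use p q ends in \<open>auto simp: pathstart_def pathfinish_def pathin_def path_def\<close>)
  then show ?thesis
    unfolding homotopic_paths_def path_homotopic_def
    by (rule homotopic_with_compose_continuous_map_left[OF _ f]) (auto simp: pathstart_def pathfinish_def)
qed

text \<open>The parameters \<open>\<phi>\<close> and \<open>\<psi>\<close> are joined by a straight
  line in \<open>[0,1]\<close>. Associativity, units and inverses of paths are instances.\<close>

lemma path_homotopic_reparametrize:
  assumes p: "pathin X p"
    and \<phi>: "continuous_on {0..1} \<phi>" "\<And>t. t \<in> {0..1} \<Longrightarrow> \<phi> t \<in> {0..1}"
    and \<psi>: "continuous_on {0..1} \<psi>" "\<And>t. t \<in> {0..1} \<Longrightarrow> \<psi> t \<in> {0..1}"
    and ends: "\<phi> 0 = \<psi> 0" "\<phi> 1 = \<psi> 1"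
    and q: "\<And>t. t \<in> {0..1} \<Longrightarrow> q t = p (\<phi> t)" and r: "\<And>t. t \<in> {0..1} \<Longrightarrow> r t = p (\<psi> t)"
  shows "path_homotopic X q r"
proof -
  have 1: "path_homotopic X (p \<circ> \<phi>) (p \<circ> \<psi>)"
    by (rule path_homotopic_convex_image[of "{0..1}"])
       (use assms in \<open>auto simp: pathin_def\<close>)
  have "path_homotopic X (p \<circ> \<phi>) q" "path_homotopic X (p \<circ> \<psi>) r"
    by (rule path_homotopic_eq; use path_homotopicD(1,2)[OF 1] q r in simp)+
  then show ?thesis using 1 path_homotopic_trans path_homotopic_sym by metis
qed

section \<open>Concatenation and cancellation of paths\<close>

lemma pathin_join:
  assumes p: "pathin X p" and q: "pathin X q" and pq: "p 1 = q 0"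
  shows "pathin X (p \<frown> q)"
  unfolding pathin_def join_path_def[abs_def]
proof (rule continuous_map_cases_le)
  have *: "continuous_map (subtopology unit_interval {x \<in> topspace unit_interval. x \<le> 1 / 2}) unit_interval (\<lambda>x. 2 * x)"
    by (auto simp: continuous_map_in_subtopology subtopology_subtopology intro!: continuous_intros)
  show "continuous_map (subtopology unit_interval {x \<in> topspace unit_interval. x \<le> 1 / 2}) X (\<lambda>x. p (2 * x))"
    using continuous_map_compose[OF *] p by (auto simp: pathin_def o_def)
  have *: "continuous_map (subtopology unit_interval {x \<in> topspace unit_interval. 1 / 2 \<le> x}) unit_interval (\<lambda>x. 2 * x - 1)"
    by (auto simp: continuous_map_in_subtopology subtopology_subtopology intro!: continuous_intros)
  show "continuous_map (subtopology unit_interval {x \<in> topspace unit_interval. 1 / 2 \<le> x}) X (\<lambda>x. q (2 * x - 1))"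
    using continuous_map_compose[OF *] q by (auto simp: pathin_def o_def)
  show "p (2 * t) = q (2 * t - 1)" if "t = 1 / 2" for t using pq unfolding that by simp
qed auto

lemma join_path_ends [simp]: "(p \<frown> q) 0 = p 0" "(p \<frown> q) 1 = q 1"
  by (simp_all add: join_path_def)

lemma path_homotopic_join:
  assumes p: "path_homotopic X p p'" and q: "path_homotopic X q q'" and pq: "p 1 = q 0"
  shows "path_homotopic X (p \<frown> q) (p' \<frown> q')"
proof -
  obtain h where h: "continuous_map (prod_topology unit_interval unit_interval) X h"
    "\<And>x. h (0, x) = p x" "\<And>x. h (1, x) = p' x" "\<And>t. t \<in> {0..1} \<Longrightarrow> h (t, 0) = p 0 \<and> h (t, 1) = p 1"
    using p unfolding path_homotopic_def homotopic_with_def by auto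
  obtain k where k: "continuous_map (prod_topology unit_interval unit_interval) X k"
    "\<And>x. k (0, x) = q x" "\<And>x. k (1, x) = q' x" "\<And>t. t \<in> {0..1} \<Longrightarrow> k (t, 0) = q 0 \<and> k (t, 1) = q 1"
    using q unfolding path_homotopic_def homotopic_with_def by auto
  define m where "m = (\<lambda>z. if snd z \<le> 1/2 then h (fst z, 2 * snd z) else k (fst z, 2 * snd z - 1))"
  let ?I2 = "prod_topology unit_interval unit_interval"
  have "continuous_map ?I2 X m"
    unfolding m_def
  proof (rule continuous_map_cases_le)
    show "continuous_map ?I2 euclideanreal snd"
      using continuous_map_snd continuous_map_into_fulltopology by blast
    have *: "continuous_map (subtopology ?I2 {x \<in> topspace ?I2. snd x \<le> 1 / 2}) ?I2 (\<lambda>z. (fst z, 2 * snd z))"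
      unfolding prod_topology_subtopology_eu subtopology_subtopology
      by (auto simp: continuous_map_in_subtopology intro!: continuous_intros)
    show "continuous_map (subtopology ?I2 {x \<in> topspace ?I2. snd x \<le> 1 / 2}) X (\<lambda>z. h (fst z, 2 * snd z))"
      using continuous_map_compose[OF * h(1)] by (simp add: o_def)
    have *: "continuous_map (subtopology ?I2 {x \<in> topspace ?I2. 1 / 2 \<le> snd x}) ?I2 (\<lambda>z. (fst z, 2 * snd z - 1))"
      unfolding prod_topology_subtopology_eu subtopology_subtopology
      by (auto simp: continuous_map_in_subtopology intro!: continuous_intros)
    show "continuous_map (subtopology ?I2 {x \<in> topspace ?I2. 1 / 2 \<le> snd x}) X (\<lambda>z. k (fst z, 2 * snd z - 1))"
      using continuous_map_compose[OF * k(1)] by (simp add: o_def)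
    show "h (fst z, 2 * snd z) = k (fst z, 2 * snd z - 1)" if "z \<in> topspace ?I2" "snd z = 1 / 2" for z
      using that(1) h(4)[of "fst z"] k(4)[of "fst z"] pq unfolding that(2) by auto
  qed auto
  then show ?thesis
    unfolding path_homotopic_def homotopic_with_def
    by (intro exI[of _ m] conjI) (use h k in \<open>auto simp: m_def join_path_def\<close>)
qed

lemma path_homotopic_assoc:
  assumes "pathin X p" "pathin X q" "pathin X r" "p 1 = q 0" "q 1 = r 0"
  shows "path_homotopic X ((p \<frown> q) \<frown> r) (p \<frown> (q \<frown> r))"
\<comment> \<open>The breakpoints 1/2 and 3/4 are moved to 1/4 and 1/2. The slopes 1/2, 1, 2
  increase, so this piecewise linear map is a maximum.\<close>
proof (rule path_homotopic_reparametrize[where p="(p \<frown> q) \<frown> r" and \<phi>="\<lambda>t. t"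
      and \<psi>="\<lambda>t. max (t / 2) (max (t - 1/4) (2 * t - 1))"])
  show "continuous_on {0..1} (\<lambda>t::real. max (t / 2) (max (t - 1/4) (2 * t - 1)))" by (intro continuous_intros) auto
  show "max (t / 2) (max (t - 1/4) (2 * t - 1)) \<in> {0..1}" if "t \<in> {0..1}" for t :: real
    using that by (auto simp: le_max_iff_disj)
  show "pathin X ((p \<frown> q) \<frown> r)" using assms by (simp add: pathin_join)
  show "(p \<frown> q \<frown> r) t = ((p \<frown> q) \<frown> r) (max (t / 2) (max (t - 1 / 4) (2 * t - 1)))" if "t \<in> {0..1}" for t
  proof -
    consider "t \<le> 1/2" | "1/2 < t" "t \<le> 3/4" | "t > 3/4" by linarith
    then show ?thesis
    proof cases
      case 1
      then have "max (t / 2) (max (t - 1 / 4) (2 * t - 1)) = t / 2" by auto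
      then show ?thesis using 1 by (simp add: join_path_def)
    next
      case 2
      then have "max (t / 2) (max (t - 1 / 4) (2 * t - 1)) = t - 1 / 4" by auto
      then show ?thesis using 2 by (simp add: join_path_def algebra_simps)
    next
      case 3
      then have "max (t / 2) (max (t - 1 / 4) (2 * t - 1)) = 2 * t - 1" by auto
      then show ?thesis using 3 by (simp add: join_path_def)
    qed
  qed
qed simp_all

lemma path_homotopic_join_const:
  assumes "pathin X p" "p 1 = x"
  shows "path_homotopic X (p \<frown> (\<lambda>_. x)) p"
proof (rule path_homotopic_reparametrize[where p=p and \<phi>="\<lambda>t. min (2 * t) 1" and \<psi>="\<lambda>t. t"])
  show "continuous_on {0..1} (\<lambda>t::real. min (2 * t) 1)" by (intro continuous_intros)
  show "min (2 * t) 1 \<in> {0..1}" if "t \<in> {0..1}" for t :: real using that by (auto simp: min_def)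
  show "(p \<frown> (\<lambda>_. x)) t = p (min (2 * t) 1)" for t using assms by (simp add: join_path_def min_def)
qed (use assms in \<open>simp_all\<close>)

lemma path_homotopic_const_join:
  assumes "pathin X p" "p 0 = x"
  shows "path_homotopic X ((\<lambda>_. x) \<frown> p) p"
proof (rule path_homotopic_reparametrize[where p=p and \<phi>="\<lambda>t. max (2 * t - 1) 0" and \<psi>="\<lambda>t. t"])
  show "continuous_on {0..1} (\<lambda>t::real. max (2 * t - 1) 0)" by (intro continuous_intros)
  show "max (2 * t - 1) 0 \<in> {0..1}" if "t \<in> {0..1}" for t :: real using that by (auto simp: max_def)
  show "((\<lambda>_. x) \<frown> p) t = p (max (2 * t - 1) 0)" for t using assms by (simp add: join_path_def max_def)
qed (use assms in \<open>simp_all\<close>)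

lemma path_homotopic_reverse_join:
  assumes "pathin X p"
  shows "path_homotopic X (reverse_path p \<frown> p) (\<lambda>_. p 1)"
\<comment> \<open>The parameter runs from 1 down to 0 and back to 1, so it can be shrunk to the
  constant 1.\<close>
proof (rule path_homotopic_reparametrize[where p=p and \<phi>="\<lambda>t. \<bar>2 * t - 1\<bar>" and \<psi>="\<lambda>t. 1"])
  show "continuous_on {0..1} (\<lambda>t::real. \<bar>2 * t - 1\<bar>)" by (intro continuous_intros)
  show "\<bar>2 * t - 1\<bar> \<in> {0..1}" if "t \<in> {0..1}" for t :: real using that by (auto simp: abs_if)
  show "(reverse_path p \<frown> p) t = p \<bar>2 * t - 1\<bar>" for t by (simp add: join_path_def reverse_path_def)
qed (use assms in \<open>simp_all\<close>)

lemma path_homotopic_join_reverse: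
  assumes "pathin X p"
  shows "path_homotopic X (p \<frown> reverse_path p) (\<lambda>_. p 0)"
proof (rule path_homotopic_reparametrize[where p=p and \<phi>="\<lambda>t. 1 - \<bar>2 * t - 1\<bar>" and \<psi>="\<lambda>t. 0"])
  show "continuous_on {0..1} (\<lambda>t::real. 1 - \<bar>2 * t - 1\<bar>)" by (intro continuous_intros)
  show "1 - \<bar>2 * t - 1\<bar> \<in> {0..1}" if "t \<in> {0..1}" for t :: real using that by (auto simp: abs_if)
  show "(p \<frown> reverse_path p) t = p (1 - \<bar>2 * t - 1\<bar>)" for t by (simp add: join_path_def reverse_path_def)
qed (use assms in \<open>simp_all\<close>)

lemma pathin_reverse_path:
  assumes "pathin X p"
  shows "pathin X (reverse_path p)"
proof -
  have "continuous_map unit_interval unit_interval (\<lambda>t. 1 - t)"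
    by (auto simp: continuous_map_in_subtopology intro: continuous_intros)
  from continuous_map_compose[OF this assms[unfolded pathin_def]] show ?thesis
    by (simp add: pathin_def reverse_path_def[abs_def] o_def)
qed

lemma reverse_path_ends [simp]: "reverse_path p 0 = p 1" "reverse_path p 1 = p 0"
  by (simp_all add: reverse_path_def)

lemma path_homotopic_cancel_right:
  assumes "path_homotopic X (p \<frown> r) (q \<frown> r)" "pathin X p" "pathin X q" "pathin X r" "p 1 = r 0" "q 1 = r 0"
  shows "path_homotopic X p q"
proof -
  have *: "path_homotopic X ((s \<frown> r) \<frown> reverse_path r) s" if s: "pathin X s" "s 1 = r 0" for s
  proof -
    have "path_homotopic X ((s \<frown> r) \<frown> reverse_path r) (s \<frown> (r \<frown> reverse_path r))"
      using s assms(4) by (intro path_homotopic_assoc) (auto simp: pathin_reverse_path)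
    also have "path_homotopic X (s \<frown> (r \<frown> reverse_path r)) (s \<frown> (\<lambda>_. r 0))"
      using s assms(4) by (intro path_homotopic_join path_homotopic_refl path_homotopic_join_reverse) auto
    also have "path_homotopic X (s \<frown> (\<lambda>_. r 0)) s"
      using s by (intro path_homotopic_join_const)
    finally show ?thesis .
  qed
  have "path_homotopic X p ((p \<frown> r) \<frown> reverse_path r)" using *[of p] assms path_homotopic_sym by blast
  also have "path_homotopic X \<dots> ((q \<frown> r) \<frown> reverse_path r)"
    by (rule path_homotopic_join[OF assms(1) path_homotopic_refl]) (use assms in \<open>auto intro: pathin_reverse_path\<close>)
  also have "path_homotopic X \<dots> q" using *[of q] assms by blast
  finally show ?thesis .
qed

lemma path_homotopic_cancel_left:
  assumes "path_homotopic X (r \<frown> p) (r \<frown> q)" "pathin X p" "pathin X q" "pathin X r" "r 1 = p 0" "r 1 = q 0"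
  shows "path_homotopic X p q"
proof -
  have *: "path_homotopic X (reverse_path r \<frown> (r \<frown> s)) s" if s: "pathin X s" "r 1 = s 0" for s
  proof -
    have "path_homotopic X (reverse_path r \<frown> (r \<frown> s)) ((reverse_path r \<frown> r) \<frown> s)"
      using s assms(4) by (intro path_homotopic_sym[OF path_homotopic_assoc]) (auto simp: pathin_reverse_path)
    also have "path_homotopic X \<dots> ((\<lambda>_. r 1) \<frown> s)"
      using s assms(4) by (intro path_homotopic_join path_homotopic_refl path_homotopic_reverse_join) auto
    also have "path_homotopic X \<dots> s"
      using s by (intro path_homotopic_const_join) auto
    finally show ?thesis .
  qed
  have "path_homotopic X p (reverse_path r \<frown> (r \<frown> p))" using *[of p] assms path_homotopic_sym by blast
  also have "path_homotopic X \<dots> (reverse_path r \<frown> (r \<frown> q))"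
    by (rule path_homotopic_join[OF path_homotopic_refl assms(1)]) (use assms in \<open>auto intro: pathin_reverse_path\<close>)
  also have "path_homotopic X \<dots> q" using *[of q] assms by blast
  finally show ?thesis .
qed

text \<open>Both boundary paths of the convex unit square run from \<open>(0, 0)\<close> to
  \<open>(1, 1)\<close>.\<close>

lemma path_homotopic_square:
  assumes K: "continuous_map (prod_topology unit_interval unit_interval) X K"
  shows "path_homotopic X ((\<lambda>t. K (0, t)) \<frown> (\<lambda>s. K (s, 1))) ((\<lambda>s. K (s, 0)) \<frown> (\<lambda>t. K (1, t)))"
proof -
  let ?S = "{0..1} \<times> {0..1} :: (real \<times> real) set"
  let ?a = "(\<lambda>t. (0, t)) \<frown> (\<lambda>s. (s, 1)) :: real \<Rightarrow> real \<times> real"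
  let ?b = "(\<lambda>s. (s, 0)) \<frown> (\<lambda>t. (1, t)) :: real \<Rightarrow> real \<times> real"
  have "path_homotopic X (K \<circ> ?a) (K \<circ> ?b)"
  proof (rule path_homotopic_convex_image[of ?S])
    show "convex ?S" by (intro convex_Times) auto
    show "continuous_map (top_of_set ?S) X K" using K by (simp add: prod_topology_subtopology_eu)
    show "pathin (top_of_set ?S) ?a" "pathin (top_of_set ?S) ?b"
      by (intro pathin_join; auto simp: pathin_def intro!: continuous_intros)+
  qed (auto simp: join_path_def)
  moreover have "K \<circ> (p \<frown> q) = (\<lambda>t. K (p t)) \<frown> (\<lambda>t. K (q t))" for p q
    by (auto simp: join_path_def)
  ultimately show ?thesis by simp
qed

text \<open>
  A family of paths \<open>Q z\<close> from a base point to \<open>z\<close> that is compatible with all short paths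
  is compatible with all paths, so that loops are null-homotopic.
\<close>

definition transports :: "'a topology \<Rightarrow> ('a \<Rightarrow> real \<Rightarrow> 'a) \<Rightarrow> (real \<Rightarrow> 'a) \<Rightarrow> bool" where
  "transports X Q d \<longleftrightarrow> pathin X d \<and> path_homotopic X (Q (d 0) \<frown> d) (Q (d 1))"

definition path_family :: "'a topology \<Rightarrow> 'a \<Rightarrow> ('a \<Rightarrow> real \<Rightarrow> 'a) \<Rightarrow> bool" where
  "path_family X b Q \<longleftrightarrow> (\<forall>z\<in>topspace X. pathin X (Q z) \<and> Q z 0 = b \<and> Q z 1 = z)"

lemma pathin_topspace: "pathin X p \<Longrightarrow> t \<in> {0..1} \<Longrightarrow> p t \<in> topspace X"
  by (rule PiE[OF path_image_subset_topspace, of X p t]) auto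

lemma path_familyD:
  assumes "path_family X b Q" "z \<in> topspace X"
  shows "pathin X (Q z)" "Q z 0 = b" "Q z 1 = z"
  using assms by (auto simp: path_family_def)

lemma transports_homotopic:
  assumes Q: "path_family X b Q" and "path_homotopic X d d'" "transports X Q d'"
  shows "transports X Q d"
proof -
  note D = path_homotopicD[OF assms(2)]
  have d0: "d 0 \<in> topspace X" using D(1) by (simp add: path_start_in_topspace)
  have "path_homotopic X (Q (d 0) \<frown> d) (Q (d 0) \<frown> d')"
    using assms(2) path_familyD[OF Q d0] by (intro path_homotopic_join path_homotopic_refl) auto
  also have "path_homotopic X \<dots> (Q (d 1))" using assms(3) D(3,4) by (simp add: transports_def)
  finally show ?thesis using D(1) by (simp add: transports_def)
qed

lemma transports_join:
  assumes Q: "path_family X b Q" and p: "transports X Q p" and q: "transports X Q q" and pq: "p 1 = q 0"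
  shows "transports X Q (p \<frown> q)"
proof -
  have pp: "pathin X p" "pathin X q" using p q by (auto simp: transports_def)
  have d0: "p 0 \<in> topspace X" "p 1 \<in> topspace X" using pp by (simp_all add: path_start_in_topspace path_finish_in_topspace)
  have "path_homotopic X (Q (p 0) \<frown> (p \<frown> q)) ((Q (p 0) \<frown> p) \<frown> q)"
    using pp pq path_familyD[OF Q d0(1)] by (intro path_homotopic_sym[OF path_homotopic_assoc]) auto
  also have "path_homotopic X \<dots> (Q (p 1) \<frown> q)"
    using p q pq pp by (intro path_homotopic_join path_homotopic_refl) (auto simp: transports_def)
  also have "path_homotopic X \<dots> (Q (q 1))" using q pq by (simp add: transports_def)
  finally show ?thesis using pp pq by (simp add: transports_def pathin_join)
qed

text \<open>The square \<open>K\<close> is bounded by \<open>d\<close>, the tracks \<open>?a\<close>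
  and \<open>?b\<close> of its ends, and a constant side, so \<open>d\<close> followed by
  \<open>?b\<close> is homotopic to \<open>?a\<close>. Both tracks are compatible with
  \<open>Q\<close>; cancelling \<open>?b\<close> gives the same for \<open>d\<close>.\<close>

lemma transports_contraction:
  assumes Q: "path_family X b Q" and d: "pathin X d"
    and K: "continuous_map (prod_topology unit_interval unit_interval) X K"
    and K0: "\<And>s. s \<in> {0..1} \<Longrightarrow> K (s, 0) = d s" and K1: "\<And>s. s \<in> {0..1} \<Longrightarrow> K (s, 1) = K (0, 1)"
    and tr: "transports X Q (\<lambda>t. K (0, t))" "transports X Q (\<lambda>t. K (1, t))"
  shows "transports X Q d"
proof -
  let ?a = "\<lambda>t. K (0, t)" and ?b = "\<lambda>t. K (1, t)" and ?c = "K (0, 1)"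
  have ab: "pathin X ?a" "pathin X ?b" using tr by (auto simp: transports_def)
  have ends: "K (0, 0) = d 0" "K (1, 0) = d 1" "K (1, 1) = ?c" using K0[of 0] K0[of 1] K1[of 1] by auto
  have c: "?c \<in> topspace X" using pathin_topspace[OF ab(1), of 1] by simp
  have Q0: "pathin X (Q (d 0))" "Q (d 0) 0 = b" "Q (d 0) 1 = d 0"
    and Q1: "pathin X (Q (d 1))" "Q (d 1) 0 = b" "Q (d 1) 1 = d 1"
    using path_familyD[OF Q] pathin_topspace[OF d] by auto
  have c2: "path_homotopic X (\<lambda>s. K (s, 1)) (\<lambda>_. ?c)"
    by (rule path_homotopic_sym[OF path_homotopic_eq]) (simp add: c, rule K1)
  have d2: "path_homotopic X d (\<lambda>s. K (s, 0))" by (rule path_homotopic_eq) (use K0 d in auto)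
  have "path_homotopic X ((Q (d 0) \<frown> d) \<frown> ?b) (Q (d 0) \<frown> (d \<frown> ?b))"
    using Q0 d ab ends by (intro path_homotopic_assoc) auto
  also have "path_homotopic X \<dots> (Q (d 0) \<frown> ((\<lambda>s. K (s, 0)) \<frown> ?b))"
    using Q0 d ab ends d2 by (intro path_homotopic_join path_homotopic_refl) auto
  also have "path_homotopic X \<dots> (Q (d 0) \<frown> (?a \<frown> (\<lambda>s. K (s, 1))))"
    by (rule path_homotopic_join[OF path_homotopic_refl path_homotopic_sym[OF path_homotopic_square[OF K]]])
       (use Q0 ends in auto)
  also have "path_homotopic X \<dots> (Q (d 0) \<frown> (?a \<frown> (\<lambda>_. ?c)))"
    using Q0 ends ab c2 by (intro path_homotopic_join path_homotopic_refl) auto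
  also have "path_homotopic X \<dots> (Q (d 0) \<frown> ?a)"
    using Q0 ends ab by (intro path_homotopic_join path_homotopic_refl path_homotopic_join_const) auto
  also have "path_homotopic X \<dots> (Q ?c)" using tr(1) ends by (simp add: transports_def)
  also have "path_homotopic X \<dots> (Q (d 1) \<frown> ?b)"
    by (rule path_homotopic_sym) (use tr(2) ends in \<open>simp add: transports_def\<close>)
  finally have "path_homotopic X (Q (d 0) \<frown> d) (Q (d 1))"
    by (rule path_homotopic_cancel_right) (use Q0 Q1 d ab ends in \<open>auto intro: pathin_join\<close>)
  then show ?thesis using d by (simp add: transports_def)
qed

section \<open>Subdivision of paths and a criterion for simple connectedness\<close>

lemma sub_path_ends: "sub_path u v p 0 = p u" "sub_path u v p 1 = p v"
  by (simp_all add: sub_path_def)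

lemma pathin_sub_path:
  assumes "pathin X p" "0 \<le> u" "u \<le> v" "v \<le> 1"
  shows "pathin X (sub_path u v p)"
proof -
  have "(v - u) * t + u \<in> {0..1}" if "t \<in> {0..1}" for t
  proof -
    have "0 \<le> (v - u) * t" "(v - u) * t \<le> (v - u) * 1" using that assms mult_left_mono[of t 1 "v - u"] by auto
    then show ?thesis using assms by auto
  qed
  then have "continuous_map unit_interval unit_interval (\<lambda>t. (v - u) * t + u)"
    by (auto simp: continuous_map_in_subtopology intro!: continuous_intros)
  from continuous_map_compose[OF this assms(1)[unfolded pathin_def]] show ?thesis
    by (simp add: pathin_def sub_path_def[abs_def] o_def)
qed

lemma path_homotopic_sub_path_join:
  assumes p: "pathin X p" and uvw: "0 \<le> u" "u \<le> v" "v \<le> w" "w \<le> 1"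
  shows "path_homotopic X (sub_path u w p) (sub_path u v p \<frown> sub_path v w p)"
proof (rule path_homotopic_reparametrize[OF p])
  \<comment> \<open>In \<open>?b\<close> the first summand moves only up to \<open>t = 1/2\<close>
    and the second only afterwards, so the concatenation is a single reparametrization of
    \<open>p\<close>.\<close>
  let ?a = "\<lambda>t. (w - u) * t + u" and ?b = "\<lambda>t. (v - u) * min 1 (2 * t) + (w - v) * max 0 (2 * t - 1) + u"
  show "continuous_on {0..1} ?a" "continuous_on {0..1} ?b" by (auto intro!: continuous_intros)
  have m: "0 \<le> x * t" "x * t \<le> x" if "0 \<le> x" "0 \<le> t" "t \<le> 1" for x t :: real
    using that mult_left_mono[of t 1 x] by auto
  show "?a t \<in> {0..1}" if "t \<in> {0..1}" for t using m[of "w - u" t] that uvw by auto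
  show "?b t \<in> {0..1}" if "t \<in> {0..1}" for t
    using m[of "v - u" "min 1 (2 * t)"] m[of "w - v" "max 0 (2 * t - 1)"] that uvw by auto
  show "?a 0 = ?b 0" "?a 1 = ?b 1" by auto
  show "sub_path u w p t = p (?a t)" for t by (simp add: sub_path_def)
  show "(sub_path u v p \<frown> sub_path v w p) t = p (?b t)" if "t \<in> {0..1}" for t
  proof (cases "t \<le> 1 / 2")
    case True
    then have "min 1 (2 * t) = 2 * t" "max 0 (2 * t - 1) = 0" by auto
    then show ?thesis using True by (simp add: join_path_def sub_path_def)
  next
    case False
    then have "min 1 (2 * t) = 1" "max 0 (2 * t - 1) = 2 * t - 1" by auto
    then show ?thesis using False by (simp add: join_path_def sub_path_def algebra_simps)
  qed
qed

text \<open>Compatibility passes to concatenations and holds for short subpaths, hence for all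
  paths. For a loop \<open>c\<close> it says that \<open>Q (c 0)\<close> followed by
  \<open>c\<close> is homotopic to \<open>Q (c 0)\<close>, which cancels.\<close>

lemma simply_connected_space_transports:
  assumes b: "b \<in> topspace X" and Q: "path_family X b Q"
    and loc: "\<And>z. z \<in> topspace X \<Longrightarrow>
       \<exists>U. openin X U \<and> z \<in> U \<and> (\<forall>d. pathin X d \<and> d ` {0..1} \<subseteq> U \<longrightarrow> transports X Q d)"
  shows "simply_connected_space X"
proof -
  have all: "transports X Q c" if c: "pathin X c" for c
  proof -
    have "0 \<le> (0::real) \<and> (1::real) \<le> 1 \<longrightarrow> transports X Q (sub_path 0 1 c)"
    \<comment> \<open>\<open>Bolzano\<close> passes from short intervals to \<open>[0,1]\<close>. It
      ranges over arbitrary real intervals, so the predicate is guarded by the bounds.\<close>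
    proof (rule Bolzano[where P="\<lambda>s t. 0 \<le> s \<and> t \<le> 1 \<longrightarrow> transports X Q (sub_path s t c)"])
      fix u v w :: real
      assume uvw: "0 \<le> u \<and> v \<le> 1 \<longrightarrow> transports X Q (sub_path u v c)" "0 \<le> v \<and> w \<le> 1 \<longrightarrow> transports X Q (sub_path v w c)"
        "u \<le> v" "v \<le> w"
      show "0 \<le> u \<and> w \<le> 1 \<longrightarrow> transports X Q (sub_path u w c)"
      proof
        assume uw: "0 \<le> u \<and> w \<le> 1"
        have tr: "transports X Q (sub_path u v c \<frown> sub_path v w c)"
          using uvw uw by (intro transports_join[OF Q]) (auto simp: sub_path_ends)
        have "path_homotopic X (sub_path u w c) (sub_path u v c \<frown> sub_path v w c)"
          using uvw uw by (intro path_homotopic_sub_path_join[OF c]) auto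
        then show "transports X Q (sub_path u w c)" using transports_homotopic[OF Q _ tr] by blast
      qed
    next
      fix x :: real assume x: "0 \<le> x" "x \<le> 1"
      obtain U where U: "openin X U" "c x \<in> U" "\<And>d. pathin X d \<Longrightarrow> d ` {0..1} \<subseteq> U \<Longrightarrow> transports X Q d"
        using loc[of "c x"] pathin_topspace[OF c, of x] x by auto
      have "openin unit_interval {t \<in> {0..1}. c t \<in> U}"
        using openin_continuous_map_preimage[OF c[unfolded pathin_def] U(1)] by simp
      then obtain T where T: "open T" "{t \<in> {0..1}. c t \<in> U} = {0..1} \<inter> T" by (auto simp: openin_open)
      then obtain e where e: "e > 0" "ball x e \<subseteq> T" using U(2) x by (metis (mono_tags, lifting) IntE atLeastAtMost_iff mem_Collect_eq openE)
      show "\<exists>e>0. \<forall>u v. u \<le> x \<and> x \<le> v \<and> v - u < e \<longrightarrow> 0 \<le> u \<and> v \<le> 1 \<longrightarrow> transports X Q (sub_path u v c)"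
      proof (intro exI[of _ e] conjI allI impI e(1), rule U(3))
        fix u v assume uv: "u \<le> x \<and> x \<le> v \<and> v - u < e" "0 \<le> u \<and> v \<le> 1"
        then show "pathin X (sub_path u v c)" using c by (intro pathin_sub_path) auto
        show "sub_path u v c ` {0..1} \<subseteq> U"
        proof
          fix y assume "y \<in> sub_path u v c ` {0..1}"
          then obtain t where t: "t \<in> {0..1}" "y = c ((v - u) * t + u)" by (auto simp: sub_path_def)
          have "0 \<le> (v - u) * t" "(v - u) * t \<le> (v - u) * 1" using t uv mult_left_mono[of t 1 "v - u"] by auto
          then have "(v - u) * t + u \<in> {u..v}" by auto
          then have "(v - u) * t + u \<in> ball x e" "(v - u) * t + u \<in> {0..1}" using uv by (auto simp: dist_real_def)
          then show "y \<in> U" using e T t by blast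
        qed
      qed
    qed simp
    moreover have "sub_path 0 1 c = c" by (simp add: sub_path_def[abs_def])
    ultimately show ?thesis by simp
  qed
  have null: "path_homotopic X c (\<lambda>_. c 0)" if c: "pathin X c" "c 1 = c 0" for c
  proof -
    have c0: "c 0 \<in> topspace X" using c by (simp add: path_start_in_topspace)
    note q = path_familyD[OF Q c0]
    have "path_homotopic X (Q (c 0) \<frown> c) (Q (c 0))" using all[OF c(1)] c(2) by (simp add: transports_def)
    also have "path_homotopic X \<dots> (Q (c 0) \<frown> (\<lambda>_. c 0))"
      using path_homotopic_join_const q path_homotopic_sym by metis
    finally show ?thesis by (rule path_homotopic_cancel_left) (use c q c0 in auto)
  qed
  show ?thesis
    unfolding simply_connected_space_def
  proof (intro conjI allI impI)
    show "topspace X \<noteq> {}" using b by auto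
    show "path_connected_space X"
      unfolding path_connected_space_def
    proof (intro ballI)
      fix x y assume xy: "x \<in> topspace X" "y \<in> topspace X"
      note qx = path_familyD[OF Q xy(1)] and qy = path_familyD[OF Q xy(2)]
      show "\<exists>p. pathin X p \<and> p 0 = x \<and> p 1 = y"
        by (rule exI[of _ "reverse_path (Q x) \<frown> Q y"]) (use qx qy in \<open>auto intro: pathin_join pathin_reverse_path\<close>)
    qed
    show "homotopic_with (\<lambda>d. d 0 = x \<and> d 1 = x) unit_interval X c (\<lambda>_. x)" if "pathin X c \<and> c 0 = x \<and> c 1 = x" for x c
      using null[of c] that by (simp add: path_homotopic_def)
  qed
qed


section \<open>Local contractibility of \<open>\<Delta>\<^sub>g\<close>\<close>

abbreviation simplex_space :: "nat \<Rightarrow> (nat \<Rightarrow> real) topology" where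
  "simplex_space p \<equiv> subtopology (powertop_real UNIV) (standard_simplex p)"

definition delta_point :: "nat \<Rightarrow> nat \<Rightarrow> lgraph set \<Rightarrow> (nat \<Rightarrow> real) \<Rightarrow> (nat \<times> lgraph set \<times> (nat \<Rightarrow> real)) set" where
  "delta_point g p x a = glue_rel g `` {(p, x, a)}"

lemma topspace_simplex_coproduct:
  "topspace (simplex_coproduct g) = {(p, x, a). x \<in> labelled_classes g p \<and> a \<in> standard_simplex p}"
  by (auto simp: simplex_coproduct_def)

lemma simplex_push_image:
  assumes "inj_on \<theta> {..p}" "i \<le> p"
  shows "simplex_push p \<theta> a (\<theta> i) = a i"
proof -
  have "{i'. i' \<le> p \<and> \<theta> i' = \<theta> i} = {i}" using assms by (auto simp: inj_on_def)
  then show ?thesis by (simp add: simplex_push_def)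
qed

lemma simplex_push_outside: "j \<notin> \<theta> ` {..p} \<Longrightarrow> simplex_push p \<theta> a j = 0"
  by (auto simp: simplex_push_def intro!: sum.neutral)

lemma simplex_push_in:
  assumes "inj_on \<theta> {..p}" "\<theta> ` {..p} \<subseteq> {..q}" "a \<in> standard_simplex p"
  shows "simplex_push p \<theta> a \<in> standard_simplex q"
proof -
  have a: "\<And>i. 0 \<le> a i" "\<And>i. a i \<le> 1" "sum a {..p} = 1" using assms(3) by (auto simp: standard_simplex_def)
  have "sum (simplex_push p \<theta> a) {..q} = sum a {..p}"
    unfolding simplex_push_def using sum.group[of "{..p}" "{..q}" \<theta> a] assms(2) by simp
  moreover have "0 \<le> simplex_push p \<theta> a j \<and> simplex_push p \<theta> a j \<le> 1" for j
    using simplex_push_image[OF assms(1)] simplex_push_outside[of j \<theta> p] a by (cases "j \<in> \<theta> ` {..p}") auto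
  moreover have "simplex_push p \<theta> a j = 0" if "j > q" for j
    using assms(2) that by (intro simplex_push_outside) auto
  ultimately show ?thesis using a(3) by (simp add: standard_simplex_def)
qed

lemma glue_topspace:
  assumes "glue g s t"
  shows "s \<in> topspace (simplex_coproduct g)" "t \<in> topspace (simplex_coproduct g)"
  using assms by (auto elim!: glue.cases simp: topspace_simplex_coproduct simplex_push_in face_map_in_classes)

lemma equiv_glue_rel: "equiv (topspace (simplex_coproduct g)) (glue_rel g)"
  by (rule equivI) (auto simp: refl_on_def sym_def trans_def glue_rel_def intro: equivclp_sym equivclp_trans)

lemma delta_point_glue:
  assumes "inj_on \<theta> {..p}" "\<theta> ` {..p} \<subseteq> {..q}" "x \<in> labelled_classes g q" "a \<in> standard_simplex p"
  shows "delta_point g q x (simplex_push p \<theta> a) = delta_point g p (face_map g p \<theta> x) a"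
proof -
  have "glue g (q, x, simplex_push p \<theta> a) (p, face_map g p \<theta> x, a)" using assms by (rule glue.intros)
  then have "((q, x, simplex_push p \<theta> a), (p, face_map g p \<theta> x, a)) \<in> glue_rel g"
    using glue_topspace by (auto simp: glue_rel_def)
  then show ?thesis unfolding delta_point_def by (rule equiv_class_eq[OF equiv_glue_rel])
qed

lemma delta_point_eqD:
  assumes "delta_point g p x a = delta_point g q y b" "x \<in> labelled_classes g p" "a \<in> standard_simplex p"
  shows "((p, x, a), (q, y, b)) \<in> glue_rel g"
proof -
  have "(p, x, a) \<in> delta_point g p x a"
    using equiv_class_self[OF equiv_glue_rel] assms(2,3) by (simp add: delta_point_def topspace_simplex_coproduct)
  then have "(p, x, a) \<in> delta_point g q y b" using assms(1) by metis
  then have "((q, y, b), (p, x, a)) \<in> glue_rel g" by (simp add: delta_point_def)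
  then show ?thesis using equiv_glue_rel by (meson equivE symE)
qed

text \<open>Turns the generated equivalence into a check on elementary gluings, for any
  \<open>R\<close> that is itself an equivalence on the coproduct.\<close>

lemma glue_rel_induct [consumes 1, case_names step refl sym trans]:
  assumes "(s, t) \<in> glue_rel g" and step: "\<And>s t. glue g s t \<Longrightarrow> R s t"
    and refl: "\<And>s. s \<in> topspace (simplex_coproduct g) \<Longrightarrow> R s s"
    and sym: "\<And>s t. R s t \<Longrightarrow> R t s" and trans: "\<And>s t u. R s t \<Longrightarrow> R t u \<Longrightarrow> R s u"
  shows "R s t"
proof -
  have s: "s \<in> topspace (simplex_coproduct g)" and "equivclp (glue g) s t" using assms(1) by (auto simp: glue_rel_def)
  from this(2) show ?thesis
  proof (induction rule: equivclp_induct)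
    case base
    show ?case using refl[OF s] .
  next
    case (step y z)
    then show ?case using assms(2) sym trans by metis
  qed
qed

lemma topspace_tropical_Delta:
  "topspace (tropical_Delta g) = {delta_point g p x a | p x a. x \<in> labelled_classes g p \<and> a \<in> standard_simplex p}"
  by (auto simp: tropical_Delta_def quotient_def delta_point_def topspace_simplex_coproduct)

lemma delta_point_in: "x \<in> labelled_classes g p \<Longrightarrow> a \<in> standard_simplex p \<Longrightarrow> delta_point g p x a \<in> topspace (tropical_Delta g)"
  by (auto simp: topspace_tropical_Delta)

lemma quotient_map_tropical_Delta: "quotient_map (simplex_coproduct g) (tropical_Delta g) (\<lambda>(p, x, a). delta_point g p x a)"
  using quotient_map_quotient_topology[of "simplex_coproduct g" "glue_rel g"]
  by (simp add: tropical_Delta_def delta_point_def case_prod_beta')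

lemma continuous_map_delta_point:
  assumes "x \<in> labelled_classes g p"
  shows "continuous_map (simplex_space p) (tropical_Delta g) (delta_point g p x)"
proof -
  have "continuous_map (simplex_space p) (prod_topology (discrete_topology (labelled_classes g p)) (simplex_space p)) (\<lambda>a. (x, a))"
    using assms by (simp add: continuous_map_pairwise o_def continuous_map_id[unfolded id_def])
  from continuous_map_compose[OF this continuous_map_component_injection[of p UNIV
      "\<lambda>p. prod_topology (discrete_topology (labelled_classes g p)) (simplex_space p)"]]
  have "continuous_map (simplex_space p) (simplex_coproduct g) (\<lambda>a. (p, x, a))"
    by (simp add: simplex_coproduct_def o_def)
  from continuous_map_compose[OF this quotient_imp_continuous_map[OF quotient_map_tropical_Delta]]
  show ?thesis by (simp add: o_def)
qed

section \<open>Continuous maps and open sets on the coproduct\<close>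

lemma continuous_map_from_sum_topology:
  "continuous_map (sum_topology X I) Y f \<longleftrightarrow> (\<forall>i\<in>I. continuous_map (X i) Y (\<lambda>x. f (i, x)))"
proof
  assume "continuous_map (sum_topology X I) Y f"
  then show "\<forall>i\<in>I. continuous_map (X i) Y (\<lambda>x. f (i, x))"
    using continuous_map_compose[OF continuous_map_component_injection] by (force simp: o_def)
next
  assume R: "\<forall>i\<in>I. continuous_map (X i) Y (\<lambda>x. f (i, x))"
  show "continuous_map (sum_topology X I) Y f"
    unfolding continuous_map_def
  proof (intro conjI allI impI)
    show "f \<in> topspace (sum_topology X I) \<rightarrow> topspace Y"
      using R by (fastforce simp: continuous_map_def)
    fix U assume U: "openin Y U"
    have "{x. (i, x) \<in> {z \<in> topspace (sum_topology X I). f z \<in> U}} = {x \<in> topspace (X i). f (i, x) \<in> U}" if "i \<in> I" for i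
      using that by auto
    then show "openin (sum_topology X I) {z \<in> topspace (sum_topology X I). f z \<in> U}"
      unfolding openin_sum_topology using R U by (auto simp: openin_continuous_map_preimage)
  qed
qed

lemma openin_simplex_coproduct:
  assumes "U \<subseteq> topspace (simplex_coproduct g)"
    and "\<And>p x. x \<in> labelled_classes g p \<Longrightarrow> openin (simplex_space p) {a. (p, x, a) \<in> U}"
  shows "openin (simplex_coproduct g) U"
  unfolding simplex_coproduct_def openin_sum_topology
proof (intro conjI ballI)
  show "U \<subseteq> Sigma UNIV (topspace \<circ> (\<lambda>p. prod_topology (discrete_topology (labelled_classes g p)) (simplex_space p)))"
    using assms(1) by (auto simp: topspace_simplex_coproduct)
  fix p
  have "{y. (p, y) \<in> U} = (\<Union>x\<in>labelled_classes g p. {x} \<times> {a. (p, x, a) \<in> U})"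
    using assms(1) by (auto simp: topspace_simplex_coproduct)
  moreover have "openin (prod_topology (discrete_topology (labelled_classes g p)) (simplex_space p)) ({x} \<times> {a. (p, x, a) \<in> U})"
    if "x \<in> labelled_classes g p" for x
    using assms(2)[OF that] that by (simp add: openin_prod_Times_iff)
  ultimately show "openin (prod_topology (discrete_topology (labelled_classes g p)) (simplex_space p)) {y. (p, y) \<in> U}"
    by (auto intro!: openin_Union)
qed

lemma continuous_map_coordinate:
  "continuous_map (simplex_coproduct g) euclideanreal (\<lambda>s. snd (snd s) j)"
proof -
  have "continuous_map (prod_topology (discrete_topology (labelled_classes g p)) (simplex_space p)) euclideanreal (\<lambda>y. snd y j)" for p
  proof -
    have "continuous_map (simplex_space p) euclideanreal (\<lambda>a. a j)"
      by (intro continuous_map_from_subtopology continuous_map_product_projection) auto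
    from continuous_map_compose[OF continuous_map_snd this] show ?thesis by (simp add: o_def)
  qed
  then show ?thesis by (simp add: simplex_coproduct_def continuous_map_from_sum_topology)
qed

text \<open>\<open>j\<close> ranges over all indices, so on a simplex the entries in
  \<open>S\<close> also exceed the zeros beyond \<open>p\<close> and are positive. The condition
  makes no reference to the simplex containing \<open>a\<close>.\<close>

definition gap :: "nat \<Rightarrow> nat set \<Rightarrow> (nat \<Rightarrow> real) \<Rightarrow> bool" where
  "gap k S a \<longleftrightarrow> finite S \<and> card S = k \<and> (\<forall>i\<in>S. \<forall>j. j \<notin> S \<longrightarrow> a j < a i)"

definition barycentre :: "nat set \<Rightarrow> nat \<Rightarrow> real" where
  "barycentre S j = (if j \<in> S then 1 / card S else 0)"

definition interpolate :: "(nat \<Rightarrow> real) \<Rightarrow> (nat \<Rightarrow> real) \<Rightarrow> real \<Rightarrow> nat \<Rightarrow> real" where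
  "interpolate a b t j = (1 - t) * a j + t * b j"

lemma interpolate_in:
  "a \<in> standard_simplex p \<Longrightarrow> b \<in> standard_simplex p \<Longrightarrow> t \<in> {0..1} \<Longrightarrow> interpolate a b t \<in> standard_simplex p"
  unfolding interpolate_def[abs_def] by (rule convex_standard_simplex) auto

lemma interpolate_ends [simp]: "interpolate a b 0 = a" "interpolate a b 1 = b"
  by (auto simp: interpolate_def)

lemma simplex_push_interpolate:
  "simplex_push p \<theta> (interpolate a b t) = interpolate (simplex_push p \<theta> a) (simplex_push p \<theta> b) t"
  by (auto simp: simplex_push_def interpolate_def sum.distrib sum_distrib_left)

text \<open>Two different sets of equal size each contain an index missing in the other, and each of
  these two entries would exceed the other.\<close>

lemma gap_unique: "gap k S a \<Longrightarrow> gap k T a \<Longrightarrow> S = T"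
proof (rule ccontr)
  assume S: "gap k S a" and T: "gap k T a" and "S \<noteq> T"
  then have "\<not> S \<subseteq> T" "\<not> T \<subseteq> S" unfolding gap_def by (metis card_subset_eq)+
  then obtain i j where "i \<in> S" "i \<notin> T" "j \<in> T" "j \<notin> S" by blast
  then show False using S T unfolding gap_def by (meson less_asym)
qed

lemma gap_pos:
  assumes "gap k S a" "a \<in> standard_simplex p" "i \<in> S"
  shows "a i > 0" "i \<le> p"
proof -
  obtain j where "j \<notin> S" using assms(1) by (metis gap_def ex_new_if_finite infinite_UNIV_nat)
  then have "a j < a i" using assms by (auto simp: gap_def)
  moreover have "0 \<le> a j" using assms(2) by (auto simp: standard_simplex_def)
  ultimately show *: "a i > 0" by simp
  show "i \<le> p"
  proof (rule ccontr)
    assume "\<not> i \<le> p"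
    then have "a i = 0" using assms(2) by (simp add: standard_simplex_def)
    then show False using * by simp
  qed
qed

lemma barycentre_in:
  assumes "S \<subseteq> {..p}" "S \<noteq> {}"
  shows "barycentre S \<in> standard_simplex p"
proof -
  have fin: "finite S" using assms(1) finite_subset by blast
  then have c: "card S > 0" using assms by (simp add: card_gt_0_iff)
  have "(\<Sum>j\<le>p. barycentre S j) = (\<Sum>j\<in>S. 1 / card S)"
    unfolding barycentre_def using assms(1) by (simp add: sum.If_cases Int_absorb1)
  then have sum: "(\<Sum>j\<le>p. barycentre S j) = 1" using c by simp
  have "0 \<le> barycentre S j \<and> barycentre S j \<le> 1" for j using c by (simp add: barycentre_def)
  moreover have "barycentre S j = 0" if "j > p" for j using that assms(1) by (auto simp: barycentre_def)
  ultimately show ?thesis using sum by (simp add: standard_simplex_def)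
qed

lemma gap_push:
  assumes inj: "inj_on \<theta> {..p}" and a: "a \<in> standard_simplex p"  and S: "gap k S a"
  shows "gap k (\<theta> ` S) (simplex_push p \<theta> a)"
proof -
  have Sp: "S \<subseteq> {..p}" using gap_pos[OF S a] by auto
  have "card (\<theta> ` S) = k" using S inj Sp by (metis card_image gap_def inj_on_subset)
  moreover have "simplex_push p \<theta> a j < simplex_push p \<theta> a (\<theta> i)" if i: "i \<in> S" and j: "j \<notin> \<theta> ` S" for i j
  proof (cases "j \<in> \<theta> ` {..p}")
    case True
    then obtain j' where j': "j = \<theta> j'" "j' \<le> p" by auto
    then have "a j' < a i" using S i j by (auto simp: gap_def)
    then show ?thesis using simplex_push_image[OF inj] j' i Sp by auto
  next
    case False
    then show ?thesis using simplex_push_image[OF inj] i Sp gap_pos(1)[OF S a i] by (auto simp: simplex_push_outside)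
  qed
  ultimately show ?thesis using S by (auto simp: gap_def)
qed

text \<open>Entries in \<open>T\<close> are positive, and a pushed point vanishes outside the image
  of \<open>\<theta>\<close>; so \<open>T\<close> comes from the smaller simplex. Together with
  \<open>gap_push\<close> this makes gaps invariant under gluing.\<close>

lemma gap_push_iff:
  assumes inj: "inj_on \<theta> {..p}" and sub: "\<theta> ` {..p} \<subseteq> {..q}" and a: "a \<in> standard_simplex p"
    and T: "gap k T (simplex_push p \<theta> a)"
  obtains S where "T = \<theta> ` S" "gap k S a" "S \<subseteq> {..p}"
proof -
  define S where "S = {i. i \<le> p \<and> \<theta> i \<in> T}"
  have "T \<subseteq> \<theta> ` {..p}"
    using gap_pos(1)[OF T simplex_push_in[OF inj sub a]] simplex_push_outside[of _ \<theta> p a] by force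
  then have TS: "T = \<theta> ` S" by (auto simp: S_def)
  have Sp: "S \<subseteq> {..p}" by (auto simp: S_def)
  have "card S = k" using T TS inj Sp by (metis card_image gap_def inj_on_subset)
  moreover have "a j < a i" if i: "i \<in> S" and j: "j \<notin> S" for i j
  proof (cases "j \<le> p")
    case True
    then have "\<theta> j \<notin> T" using j by (auto simp: S_def)
    then have "simplex_push p \<theta> a (\<theta> j) < simplex_push p \<theta> a (\<theta> i)" using T i by (auto simp: gap_def S_def)
    then show ?thesis using simplex_push_image[OF inj] True i Sp by auto
  next
    case False
    then have "a j = 0" using a by (auto simp: standard_simplex_def)
    moreover have "simplex_push p \<theta> a (\<theta> i) > 0"
      using gap_pos(1)[OF T simplex_push_in[OF inj sub a]] i by (auto simp: S_def)
    ultimately show ?thesis using simplex_push_image[OF inj] i Sp by auto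
  qed
  moreover have "finite S" using Sp finite_subset by blast
  ultimately show ?thesis using that TS Sp by (auto simp: gap_def)
qed

lemma barycentre_push:
  assumes inj: "inj_on \<theta> {..p}" and S: "S \<subseteq> {..p}"
  shows "simplex_push p \<theta> (barycentre S) = barycentre (\<theta> ` S)"
proof
  fix j
  have c: "card (\<theta> ` S) = card S" using inj S by (metis card_image inj_on_subset)
  show "simplex_push p \<theta> (barycentre S) j = barycentre (\<theta> ` S) j"
  proof (cases "j \<in> \<theta> ` {..p}")
    case True
    then obtain i where i: "j = \<theta> i" "i \<le> p" by auto
    then have "j \<in> \<theta> ` S \<longleftrightarrow> i \<in> S" using inj S by (auto simp: inj_on_def)
    then show ?thesis using simplex_push_image[OF inj i(2)] i c by (simp add: barycentre_def)
  next
    case False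
    then show ?thesis using S by (auto simp: simplex_push_outside barycentre_def)
  qed
qed

lemma openin_gap: "openin (simplex_space p) {a \<in> standard_simplex p. gap k S a}"
proof (cases "finite S \<and> card S = k")
  case True
  \<comment> \<open>The entry at \<open>N\<close> is zero, like all later ones, and \<open>N\<close>
    is outside \<open>S\<close>. Comparisons with the indices up to \<open>N\<close> therefore imply
    all others, and finitely many strict inequalities remain.\<close>
  define N where "N = Suc (Max (insert p S))"
  have "i \<le> Max (insert p S)" if "i \<in> insert p S" for i using True that by (intro Max_ge) auto
  then have "i < N" if "i \<in> insert p S" for i using that unfolding N_def by (simp add: less_Suc_eq_le)
  then have N: "p < N" "N \<notin> S" by auto
  let ?W = "\<Inter>i\<in>S. \<Inter>j\<in>{..N} - S. {a::nat \<Rightarrow> real. a j < a i}"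
  have eq: "{a \<in> standard_simplex p. gap k S a} = standard_simplex p \<inter> ?W"
  proof (intro equalityI subsetI)
    fix a assume a: "a \<in> standard_simplex p \<inter> ?W"
    have "a j < a i" if ij: "i \<in> S" "j \<notin> S" for i j
    proof (cases "j \<le> N")
      case True then show ?thesis using a ij by auto
    next
      case False
      then have "a j = 0" "a N = 0" using a N by (auto simp: standard_simplex_def)
      moreover have "a N < a i" using a ij N by auto
      ultimately show ?thesis by simp
    qed
    then show "a \<in> {a \<in> standard_simplex p. gap k S a}" using a True by (auto simp: gap_def)
  qed (auto simp: gap_def)
  have "open ?W"
    using True by (intro open_INT ballI open_Collect_less continuous_on_product_coordinates) auto
  then show ?thesis unfolding eq euclidean_product_topology by (simp add: openin_subtopology_Int2)
next
  case False
  then show ?thesis by (auto simp: gap_def)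
qed

section \<open>Segments and triangles in a simplex\<close>

definition segment :: "nat \<Rightarrow> nat \<Rightarrow> lgraph set \<Rightarrow> (nat \<Rightarrow> real) \<Rightarrow> (nat \<Rightarrow> real) \<Rightarrow> real \<Rightarrow> (nat \<times> lgraph set \<times> (nat \<Rightarrow> real)) set" where
  "segment g p x a b t = delta_point g p x (interpolate a b t)"

lemma segment_ends [simp]: "segment g p x a b 0 = delta_point g p x a" "segment g p x a b 1 = delta_point g p x b"
  by (simp_all add: segment_def)

lemma pathin_segment:
  assumes "x \<in> labelled_classes g p" "a \<in> standard_simplex p" "b \<in> standard_simplex p"
  shows "pathin (tropical_Delta g) (segment g p x a b)"
proof -
  have "continuous_map unit_interval (powertop_real UNIV) (interpolate a b)"
    unfolding interpolate_def[abs_def] continuous_map_componentwise_UNIV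
    by (auto intro!: continuous_intros)
  then have "continuous_map unit_interval (simplex_space p) (interpolate a b)"
    using interpolate_in[OF assms(2,3)] by (auto simp: continuous_map_in_subtopology)
  from continuous_map_compose[OF this continuous_map_delta_point[OF assms(1)]]
  show ?thesis by (simp add: pathin_def segment_def[abs_def] o_def)
qed

lemma segment_glue:
  assumes "inj_on \<theta> {..p}" "\<theta> ` {..p} \<subseteq> {..q}" "x \<in> labelled_classes g q" "a \<in> standard_simplex p" "b \<in> standard_simplex p"
    and "t \<in> {0..1}"
  shows "segment g q x (simplex_push p \<theta> a) (simplex_push p \<theta> b) t = segment g p (face_map g p \<theta> x) a b t"
  unfolding segment_def simplex_push_interpolate[symmetric]
  by (rule delta_point_glue) (use assms interpolate_in in auto)

lemma segment_triangle:
  assumes x: "x \<in> labelled_classes g p" and abc: "a \<in> standard_simplex p" "b \<in> standard_simplex p" "c \<in> standard_simplex p"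
  shows "path_homotopic (tropical_Delta g) (segment g p x a b \<frown> segment g p x b c) (segment g p x a c)"
proof -
  let ?S = "{z :: real \<times> real. 0 \<le> snd z \<and> snd z \<le> fst z \<and> fst z \<le> 1}"
  \<comment> \<open>At \<open>z = (t, s)\<close> with \<open>0 \<le> s \<le> t \<le> 1\<close> the
    barycentric coordinates are \<open>1 - t\<close>, \<open>t - s\<close> and \<open>s\<close>. Two
    sides of the triangle lead from \<open>a\<close> through \<open>b\<close> to \<open>c\<close>,
    and the diagonal is the direct segment.\<close>
  define m where "m = (\<lambda>(z::real \<times> real) j. (1 - fst z) * a j + (fst z - snd z) * b j + snd z * c j)"
  have m_in: "m z \<in> standard_simplex p" if "z \<in> ?S" for z
  proof (cases "fst z = 0")
    case True
    then have "m z = a" using that by (auto simp: m_def)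
    then show ?thesis using abc by simp
  next
    case False
    then have z: "fst z > 0" using that by auto
    have "m z = interpolate a (interpolate b c (snd z / fst z)) (fst z)"
      using z by (auto simp: m_def interpolate_def field_simps)
    moreover have "snd z / fst z \<in> {0..1}" using z that by auto
    ultimately show ?thesis using that abc by (auto intro!: interpolate_in)
  qed
  have "continuous_map (top_of_set ?S) (powertop_real UNIV) m"
    unfolding m_def continuous_map_componentwise_UNIV by (auto intro!: continuous_intros)
  then have "continuous_map (top_of_set ?S) (simplex_space p) m"
    using m_in by (auto simp: continuous_map_in_subtopology)
  from continuous_map_compose[OF this continuous_map_delta_point[OF x]]
  have f: "continuous_map (top_of_set ?S) (tropical_Delta g) (delta_point g p x \<circ> m)" .
  let ?p = "(\<lambda>t. (t, 0)) \<frown> (\<lambda>t. (1, t)) :: real \<Rightarrow> real \<times> real" and ?q = "\<lambda>t. (t, t) :: real \<times> real"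
  have "convex ?S"
  proof -
    have eq: "?S = {z. (0, -1) \<bullet> z \<le> 0} \<inter> {z. (-1, 1) \<bullet> z \<le> 0} \<inter> {z. (1, 0) \<bullet> z \<le> 1}" by (auto simp: inner_prod_def)
    show ?thesis unfolding eq by (intro convex_Int convex_halfspace_le)
  qed
  then have "path_homotopic (tropical_Delta g) ((delta_point g p x \<circ> m) \<circ> ?p) ((delta_point g p x \<circ> m) \<circ> ?q)"
  proof (rule path_homotopic_convex_image[OF _ f])
    show "pathin (top_of_set ?S) ?p"
      by (intro pathin_join) (auto simp: pathin_def continuous_map_in_subtopology intro!: continuous_intros)
    show "pathin (top_of_set ?S) ?q"
      by (auto simp: pathin_def continuous_map_in_subtopology intro!: continuous_intros)
  qed auto
  moreover have "(delta_point g p x \<circ> m) \<circ> ?p = segment g p x a b \<frown> segment g p x b c"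
    by (rule ext) (simp add: join_path_def segment_def m_def interpolate_def[abs_def])
  moreover have "(delta_point g p x \<circ> m) \<circ> ?q = segment g p x a c"
    by (rule ext) (simp add: segment_def m_def interpolate_def[abs_def])
  ultimately show ?thesis by simp
qed

text \<open>
  The neighbourhood consists of all curves whose \<open>k\<close> longest edges form a given graph.  The
  contraction is compatible with gluing and continuous before gluing; it descends because the
  product of a quotient map with the unit interval is a quotient map.
\<close>

lemma local_contraction:
  assumes z: "z \<in> topspace (tropical_Delta g)"
  obtains U H c where "openin (tropical_Delta g) U" "z \<in> U"
    "continuous_map (prod_topology unit_interval (subtopology (tropical_Delta g) U)) (tropical_Delta g) H"
    "\<And>u. u \<in> U \<Longrightarrow> H (0, u) = u" "\<And>u. u \<in> U \<Longrightarrow> H (1, u) = c"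
    "\<And>u. u \<in> U \<Longrightarrow> \<exists>p x a b. x \<in> labelled_classes g p \<and> a \<in> standard_simplex p \<and> b \<in> standard_simplex p \<and>
        (\<forall>t\<in>{0..1}. H (t, u) = segment g p x a b t)"
proof -
  let ?T = "simplex_coproduct g" and ?X = "tropical_Delta g"
  define q where "q = (\<lambda>(p, x, a). delta_point g p x a)"
  have quot: "quotient_map ?T ?X q" using quotient_map_tropical_Delta by (simp add: q_def)
  obtain p0 x0 a0 where z0: "z = delta_point g p0 x0 a0" "x0 \<in> labelled_classes g p0" "a0 \<in> standard_simplex p0"
    using z by (auto simp: topspace_tropical_Delta)
  \<comment> \<open>The edges of positive length of \<open>z\<close> serve as its \<open>k\<close>
    longest ones: their lengths exceed the zeros, so \<open>a0\<close> has a gap at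
    \<open>S0\<close>.\<close>
  define S0 where "S0 = {i. a0 i \<noteq> 0}"
  define k where "k = card S0"
  have "a0 i = 0" if "\<not> i \<le> p0" for i using z0(3) that by (simp add: standard_simplex_def)
  then have S0p: "S0 \<subseteq> {..p0}" by (auto simp: S0_def)
  then have finS0: "finite S0" using finite_subset by blast
  have "S0 \<noteq> {}"
  proof
    assume "S0 = {}"
    then have "\<forall>i. a0 i = 0" by (auto simp: S0_def)
    then show False using z0(3) by (simp add: standard_simplex_def)
  qed
  then have k0: "k > 0" using finS0 by (simp add: k_def card_gt_0_iff)
  have gap0: "gap k S0 a0"
    using finS0 z0(3) by (auto simp: gap_def k_def S0_def standard_simplex_def less_le)
  define c where "c = delta_point g p0 x0 (barycentre S0)"
  \<comment> \<open>Asking the barycentre of the \<open>k\<close> longest edges to be the point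
    \<open>c\<close> fixes their graph by a condition that does not depend on the simplex.\<close>
  define W where "W = {(p, x, a). x \<in> labelled_classes g p \<and> a \<in> standard_simplex p \<and>
     (\<exists>S. gap k S a \<and> delta_point g p x (barycentre S) = c)}"
  define f where "f = (\<lambda>(t, (p, x, a)). segment g p x a (barycentre (THE S. gap k S a)) t)"
  have the_gap: "(THE S. gap k S a) = S" if "gap k S a" for a S
    using that by (rule the_equality) (use that gap_unique in blast)
  have bary: "barycentre S \<in> standard_simplex p" if "gap k S a" "a \<in> standard_simplex p" for S a p
    using gap_pos(2)[OF that] that(1) k0 by (intro barycentre_in) (auto simp: gap_def)
  have W_top: "W \<subseteq> topspace ?T" by (auto simp: W_def topspace_simplex_coproduct)
  have W_f: "f (0, s) = q s" "f (1, s) = c" if "s \<in> W" for s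
    using that by (auto simp: W_def f_def q_def the_gap)
  \<comment> \<open>A gluing carries the gap set along by \<open>gap_push\<close> and
    \<open>gap_push_iff\<close>, and with it the barycentre and the segment. So \<open>W\<close> is
    saturated and \<open>f\<close> is constant on classes.\<close>
  have compat: "(s \<in> W \<longleftrightarrow> s' \<in> W) \<and> (s \<in> W \<longrightarrow> (\<forall>t\<in>{0..1}. f (t, s) = f (t, s')))" if "(s, s') \<in> glue_rel g" for s s'
    using that
  proof (induction rule: glue_rel_induct)
    case (step s s')
    then show ?case
    proof (cases rule: glue.cases)
      case (1 \<theta> p r x a)
      let ?a = "simplex_push p \<theta> a" and ?y = "face_map g p \<theta> x"
      have y: "?y \<in> labelled_classes g p" and a: "?a \<in> standard_simplex r"
        using 1 by (auto simp: face_map_in_classes simplex_push_in)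
      have main: "delta_point g r x (barycentre (\<theta> ` S)) = delta_point g p ?y (barycentre S)
          \<and> (\<forall>t\<in>{0..1}. f (t, s) = f (t, s'))"
        if S: "gap k S a" for S
      proof -
        have Sp: "S \<subseteq> {..p}" using gap_pos(2)[OF S 1(6)] by auto
        have push: "barycentre (\<theta> ` S) = simplex_push p \<theta> (barycentre S)" using barycentre_push[OF 1(3) Sp] by simp
        show ?thesis
          unfolding 1(1,2) f_def prod.case the_gap[OF S] the_gap[OF gap_push[OF 1(3) 1(6) S]] push
          using delta_point_glue[OF 1(3-5) bary[OF S 1(6)]] segment_glue[OF 1(3-6) bary[OF S 1(6)]] by blast
      qed
      have "s \<in> W \<longleftrightarrow> s' \<in> W"
      proof
        assume "s \<in> W"
        then obtain T where T: "gap k T ?a" "delta_point g r x (barycentre T) = c" by (auto simp: W_def 1)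
        then obtain S where "T = \<theta> ` S" "gap k S a" using gap_push_iff[OF 1(3,4,6)] by metis
        then show "s' \<in> W" using T main y 1 by (auto simp: W_def)
      next
        assume "s' \<in> W"
        then obtain S where S: "gap k S a" "delta_point g p ?y (barycentre S) = c" by (auto simp: W_def 1)
        then have "gap k (\<theta> ` S) ?a" using gap_push 1 by blast
        then show "s \<in> W" using S main[OF S(1)] a 1 by (auto simp: W_def)
      qed
      moreover have "\<forall>t\<in>{0..1}. f (t, s) = f (t, s')" if "s' \<in> W"
        using that main by (auto simp: W_def 1)
      ultimately show ?thesis by blast
    qed
  qed auto
  have q_rel: "(s, s') \<in> glue_rel g" if "q s = q s'" "s \<in> topspace ?T" for s s'
    using that by (cases s; cases s') (auto simp: q_def topspace_simplex_coproduct intro: delta_point_eqD)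
  have openW: "openin ?T W"
  proof (rule openin_simplex_coproduct[OF W_top])
    fix p x assume x: "x \<in> labelled_classes g p"
    have "{a. (p, x, a) \<in> W} = (\<Union>S\<in>{S. delta_point g p x (barycentre S) = c}. {a \<in> standard_simplex p. gap k S a})"
      using x by (auto simp: W_def)
    then show "openin (simplex_space p) {a. (p, x, a) \<in> W}" by (auto intro!: openin_Union openin_gap)
  qed
  define U where "U = q ` W"
  have preU: "{s \<in> topspace ?T. q s \<in> U} = W"
  proof (intro equalityI subsetI)
    fix s assume "s \<in> {s \<in> topspace ?T. q s \<in> U}"
    then obtain s' where "s' \<in> W" "q s = q s'" "s \<in> topspace ?T" by (auto simp: U_def)
    then show "s \<in> W" using compat[OF q_rel[of s s']] by blast
  qed (use W_top in \<open>auto simp: U_def\<close>)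
  have Utop: "U \<subseteq> topspace ?X" using quot W_top by (auto simp: U_def quotient_map_def)
  have "openin ?T {s \<in> topspace ?T. q s \<in> U} \<longleftrightarrow> openin ?X U"
    using quot Utop unfolding quotient_map_def by blast
  then have openU: "openin ?X U" using openW preU by simp
  have quotU: "quotient_map (subtopology ?T W) (subtopology ?X U) q"
    by (rule quotient_map_restriction[OF quot preU]) (use openU in simp)
  have quotI: "quotient_map (prod_topology unit_interval (subtopology ?T W)) (prod_topology unit_interval (subtopology ?X U)) (\<lambda>(t, s). (t, q s))"
    by (rule quotient_map_prod_right[OF _ _ quotU])
       (auto intro!: compact_imp_locally_compact_space compact_space_subtopology Hausdorff_space_subtopology)
  define H where "H = (\<lambda>(t, u). f (t, SOME s. s \<in> W \<and> q s = u))"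
  have H: "H (t, q s) = f (t, s)" if "t \<in> {0..1}" "s \<in> W" for t s
  proof -
    let ?s = "SOME s'. s' \<in> W \<and> q s' = q s"
    have "?s \<in> W \<and> q ?s = q s" by (rule someI[of _ s]) (use that in auto)
    then show ?thesis using compat[OF q_rel[of ?s s]] W_top that by (auto simp: H_def)
  qed
  \<comment> \<open>On a cell the set \<open>S\<close> is fixed, which removes the description
    operator from \<open>f\<close>. Cells are open because a strict gap persists nearby, and pieces
    agree on overlaps because \<open>S\<close> is unique.\<close>
  define I where "I = {(p, x, S :: nat set). x \<in> labelled_classes g p}"
  define cell where "cell = (\<lambda>(p, x, S). {0..1::real} \<times> {s \<in> W. fst s = p \<and> fst (snd s) = x \<and> gap k S (snd (snd s))})"
  define piece where "piece = (\<lambda>(p, x, S) (t, s :: nat \<times> lgraph set \<times> (nat \<Rightarrow> real)). segment g p x (snd (snd s)) (barycentre S) t)"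
  have contf: "continuous_map (prod_topology unit_interval (subtopology ?T W)) ?X f"
  proof (rule pasting_lemma[where I=I and f=piece and T=cell])
    fix i assume "i \<in> I"
    then obtain p x S where i: "i = (p, x, S)" "x \<in> labelled_classes g p" by (auto simp: I_def)
    let ?O = "{s \<in> W. fst s = p \<and> fst (snd s) = x \<and> gap k S (snd (snd s))}"
    have openO: "openin ?T ?O"
    proof (rule openin_simplex_coproduct)
      fix p' x' assume x': "x' \<in> labelled_classes g p'"
      have "{a. (p', x', a) \<in> ?O} = (if p' = p \<and> x' = x \<and> delta_point g p x (barycentre S) = c then {a \<in> standard_simplex p. gap k S a} else {})"
        using gap_unique i(2) by (auto simp: W_def)
      then show "openin (simplex_space p') {a. (p', x', a) \<in> ?O}" using openin_gap by auto
    qed (use W_top in auto)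
    then have "openin (subtopology ?T W) ?O" using openin_open_subtopology[OF openW] by auto
    then show "openin (prod_topology unit_interval (subtopology ?T W)) (cell i)"
      unfolding i(1) by (simp add: cell_def openin_prod_Times_iff)
    let ?P = "subtopology (prod_topology unit_interval (subtopology ?T W)) ({0..1} \<times> ?O)"
    have "continuous_map ?P (simplex_space p) (\<lambda>z. interpolate (snd (snd (snd z))) (barycentre S) (fst z))"
      unfolding continuous_map_in_subtopology
    proof
      have t: "continuous_map ?P euclideanreal fst"
        by (intro continuous_map_from_subtopology continuous_map_into_fulltopology[OF continuous_map_fst])
      have a: "continuous_map ?P euclideanreal (\<lambda>z. snd (snd (snd z)) j)" for j
        using continuous_map_compose[OF continuous_map_snd continuous_map_from_subtopology[OF continuous_map_coordinate]]
        by (intro continuous_map_from_subtopology) (simp add: o_def)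
      show "continuous_map ?P (powertop_real UNIV) (\<lambda>z. interpolate (snd (snd (snd z))) (barycentre S) (fst z))"
        unfolding continuous_map_componentwise_UNIV interpolate_def
        by (intro allI continuous_map_add continuous_map_real_mult continuous_map_diff t a) auto
      show "(\<lambda>z. interpolate (snd (snd (snd z))) (barycentre S) (fst z)) \<in> topspace ?P \<rightarrow> standard_simplex p"
        using bary by (auto simp: W_def intro!: interpolate_in)
    qed
    from continuous_map_compose[OF this continuous_map_delta_point[OF i(2)]]
    show "continuous_map (subtopology (prod_topology unit_interval (subtopology ?T W)) (cell i)) ?X
       (piece i)"
      unfolding i(1) by (simp add: cell_def piece_def segment_def o_def case_prod_beta')
  next
    fix z assume "z \<in> topspace (prod_topology unit_interval (subtopology ?T W))"
    then obtain t p x a where z: "z = (t, (p, x, a))" "t \<in> {0..1}" "(p, x, a) \<in> W" by auto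
    then obtain S where S: "gap k S a" "x \<in> labelled_classes g p" by (auto simp: W_def)
    then show "\<exists>j. j \<in> I \<and> z \<in> cell j
      \<and> f z = piece j z"
      by (intro exI[of _ "(p, x, S)"]) (use z in \<open>auto simp: I_def cell_def piece_def f_def the_gap\<close>)
  next
    fix i j z
    assume "i \<in> I" "j \<in> I"
      "z \<in> topspace (prod_topology unit_interval (subtopology ?T W)) \<inter> cell i
         \<inter> cell j"
    then show "piece i z = piece j z"
      by (auto simp: cell_def piece_def dest: gap_unique)
  qed
  have "continuous_map (prod_topology unit_interval (subtopology ?T W)) ?X (H \<circ> (\<lambda>(t, s). (t, q s)))"
    by (rule continuous_map_eq[OF contf]) (use H in auto)
  then have contH: "continuous_map (prod_topology unit_interval (subtopology ?X U)) ?X H"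
    using continuous_compose_quotient_map_eq[OF quotI] by blast
  show thesis
  proof (rule that[OF openU _ contH])
    have "(p0, x0, a0) \<in> W" using z0 gap0 by (auto simp: W_def c_def)
    then show "z \<in> U" using z0 by (force simp: U_def q_def)
    show "H (0, u) = u" "H (1, u) = c" if "u \<in> U" for u
      using that H W_f by (auto simp: U_def)
    show "\<exists>p x a b. x \<in> labelled_classes g p \<and> a \<in> standard_simplex p \<and> b \<in> standard_simplex p \<and>
        (\<forall>t\<in>{0..1}. H (t, u) = segment g p x a b t)" if u: "u \<in> U" for u
    proof -
      obtain p x a where s: "(p, x, a) \<in> W" "u = q (p, x, a)" using u by (auto simp: U_def)
      then obtain S where S: "gap k S a" "x \<in> labelled_classes g p" "a \<in> standard_simplex p" by (auto simp: W_def)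
      have "H (t, u) = segment g p x a (barycentre S) t" if "t \<in> {0..1}" for t
        using H[OF that s(1)] s(2) by (simp add: f_def the_gap[OF S(1)])
      then show ?thesis using S bary[OF S(1,3)] by blast
    qed
  qed
qed


section \<open>Paths from the base point\<close>

definition corner :: "nat \<Rightarrow> nat \<Rightarrow> real" where
  "corner i j = (if j = i then 1 else 0)"

lemma corner_in: "i \<le> p \<Longrightarrow> corner i \<in> standard_simplex p"
  unfolding corner_def[abs_def] by simp

lemma simplex_push_corner:
  assumes "inj_on \<theta> {..p}" "i \<le> p"
  shows "simplex_push p \<theta> (corner i) = corner (\<theta> i)"
proof
  fix j
  show "simplex_push p \<theta> (corner i) j = corner (\<theta> i) j"
  proof (cases "j \<in> \<theta> ` {..p}")
    case True
    then obtain k where k: "j = \<theta> k" "k \<le> p" by auto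
    have "\<theta> k = \<theta> i \<longleftrightarrow> k = i" using assms k by (auto simp: inj_on_def)
    then show ?thesis using simplex_push_image[OF assms(1) k(2)] k by (simp add: corner_def)
  next
    case False
    then have "j \<noteq> \<theta> i" using assms by auto
    then show ?thesis using False by (simp add: simplex_push_outside corner_def)
  qed
qed

lemma corner_face:
  assumes "x \<in> labelled_classes g q" "inj_on \<theta> {..p}" "\<theta> ` {..p} \<subseteq> {..q}" "i \<le> p"
  shows "delta_point g q x (corner (\<theta> i)) = delta_point g p (face_map g p \<theta> x) (corner i)"
  using delta_point_glue[OF assms(2,3,1) corner_in[OF assms(4)]] by (simp add: simplex_push_corner assms)

lemma segment_face:
  assumes "x \<in> labelled_classes g q" "inj_on \<theta> {..p}" "\<theta> ` {..p} \<subseteq> {..q}" "i \<le> p" "j \<le> p" "t \<in> {0..1}"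
  shows "segment g q x (corner (\<theta> i)) (corner (\<theta> j)) t = segment g p (face_map g p \<theta> x) (corner i) (corner j) t"
  using segment_glue[OF assms(2,3,1) corner_in[OF assms(4)] corner_in[OF assms(5)] assms(6)]
  by (simp add: simplex_push_corner assms)

lemma segment_face_homotopic:
  assumes "x \<in> labelled_classes g q" "inj_on \<theta> {..p}" "\<theta> ` {..p} \<subseteq> {..q}" "i \<le> p" "j \<le> p"
  shows "path_homotopic (tropical_Delta g) (segment g q x (corner (\<theta> i)) (corner (\<theta> j)))
     (segment g p (face_map g p \<theta> x) (corner i) (corner j))"
proof (rule path_homotopic_eq)
  show "pathin (tropical_Delta g) (segment g q x (corner (\<theta> i)) (corner (\<theta> j)))"
    using assms by (intro pathin_segment corner_in) auto
qed (use segment_face[OF assms] in simp)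

lemma contracts_to_id_class:
  assumes "A \<in> labelled_graphs g p" "B \<in> labelled_graphs g p" "contracts_to \<pi> id A B"
  shows "labelled_class g p A = labelled_class g p B"
  using contracts_to_unique[OF assms(1,1,2) contracts_to_id assms(3)] labelled_graphsD(4)[OF assms(1)]
    labelled_class_eq_iff[OF assms(1,2)] by simp

text \<open>Surviving loops stay loops, and a connected graph all of whose edges are loops has one
  vertex.\<close>

lemma contracts_to_loops:
  assumes A: "A \<in> labelled_graphs g q" and B: "B \<in> labelled_graphs g p" and AB: "contracts_to \<pi> \<theta> A B"
    and loops: "\<And>e. e \<in> edges (fst A) \<Longrightarrow> snd A e \<in> \<theta> ` {..p} \<Longrightarrow> is_loop (fst A) e"
  shows "\<exists>v. verts (fst B) = {v}"
proof (rule single_vertex[OF labelled_graphsD(5)[OF B]])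
  fix e assume e: "e \<in> edges (fst B)"
  obtain h where h: "contraction_via (fst A) (fst B) \<pi> h" "snd A (h e) = \<theta> (snd B e)"
    using AB e by (auto simp: contracts_to_def)
  have "h e \<in> edges (fst A)" using contraction_viaD(3)[OF h(1)] e by auto
  moreover have "snd B e \<le> p" using labelled_graphsD(3)[OF B] e by (auto simp: bij_betw_def)
  ultimately have "is_loop (fst A) (h e)" using loops h(2) by auto
  then show "is_loop (fst B) e" using contraction_viaD(4)[OF h(1) e] by (auto simp: is_loop_def)
qed

text \<open>Relabelling yields another graph with one vertex, which is isomorphic to
  \<open>A\<close>. On \<open>{0, 1}\<close> the exchange of labels is \<open>1 - i\<close>.\<close>

lemma single_vertex_swap:
  assumes A: "A \<in> labelled_graphs g 1" and v: "verts (fst A) = {v}"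
  shows "face_map g 1 (\<lambda>i. 1 - i) (labelled_class g 1 A) = labelled_class g 1 A"
proof -
  let ?\<theta> = "\<lambda>i. 1 - i :: nat"
  note a = labelled_graphsD[OF A]
  have bij: "bij_betw ?\<theta> {..1} {..1}" by (rule bij_betw_byWitness[of _ ?\<theta>]) auto
  let ?B = "(fst A, ?\<theta> \<circ> snd A)"
  have B: "?B \<in> labelled_graphs g 1"
    using a(1,2) bij_betw_trans[OF a(3) bij] by (simp add: labelled_graphs_def)
  have "snd A e \<le> 1" if "e \<in> edges (fst A)" for e using a(3) that by (auto simp: bij_betw_def)
  then have "contracts_to id ?\<theta> A ?B"
    unfolding contracts_to_def fst_conv snd_conv
    by (intro exI[of _ id] conjI contraction_via_id a(4)) auto
  then have "face_map g 1 ?\<theta> (labelled_class g 1 A) = labelled_class g 1 ?B"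
    using bij by (intro face_map_class[OF A B]) (auto simp: bij_betw_def)
  also have "\<dots> = labelled_class g 1 A"
    using single_vertex_isomorphic[OF B A] v labelled_class_eq_iff[OF B A] by simp
  finally show ?thesis .
qed

lemma segment_single_vertex:
  assumes A: "A \<in> labelled_graphs g 1" and v: "verts (fst A) = {v}"
  shows "path_homotopic (tropical_Delta g) (segment g 1 (labelled_class g 1 A) (corner 0) (corner 1))
    (\<lambda>_. delta_point g 1 (labelled_class g 1 A) (corner 0))"
proof -
  let ?x = "labelled_class g 1 A" and ?s = "segment g 1 (labelled_class g 1 A) (corner 0) (corner 1)"
  have x: "?x \<in> labelled_classes g 1" using labelled_class_in[OF A] .
  have inj: "inj_on (\<lambda>i. 1 - i :: nat) {..1}" and sub: "(\<lambda>i. 1 - i :: nat) ` {..1} \<subseteq> {..1}"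
    by (auto simp: inj_on_def)
  have sym: "?s (1 - t) = ?s t" if "t \<in> {0..1}" for t
  proof -
    have "segment g 1 ?x (corner 1) (corner 0) t = ?s t"
      using segment_face[OF x inj sub, of 0 1 t] that single_vertex_swap[OF A v] by simp
    then show ?thesis by (simp add: segment_def interpolate_def[abs_def] add.commute)
  qed
  show ?thesis
  \<comment> \<open>By \<open>sym\<close> the segment returns from its midpoint the way it came, so
    it factors through \<open>min t (1 - t)\<close>, which starts and ends at 0.\<close>
  proof (rule path_homotopic_reparametrize[where p="?s" and \<phi>="\<lambda>t. min t (1 - t)" and \<psi>="\<lambda>t. 0"])
    show "pathin (tropical_Delta g) ?s" using x by (intro pathin_segment corner_in) auto
    show "continuous_on {0..1} (\<lambda>t::real. min t (1 - t))" by (intro continuous_intros)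
    show "min t (1 - t) \<in> {0..1}" if "t \<in> {0..1}" for t :: real using that by auto
    show "?s t = ?s (min t (1 - t))" if "t \<in> {0..1}" for t using sym[OF that] by (simp add: min_def)
  qed auto
qed

section \<open>Spokes: paths from the base point to the vertices\<close>

definition base_point :: "nat \<Rightarrow> (nat \<times> lgraph set \<times> (nat \<Rightarrow> real)) set" where
  "base_point g = delta_point g 0 (labelled_class g 0
     (\<lparr>verts = {0}, edges = {0}, ends = \<lambda>_. {#0, 0#}, weight = \<lambda>_. g - 1\<rparr>, \<lambda>_. 0)) (corner 0)"

definition spokes :: "nat \<Rightarrow> lgraph set \<Rightarrow> (real \<Rightarrow> (nat \<times> lgraph set \<times> (nat \<Rightarrow> real)) set) set" where
  "spokes g y = {segment g 1 (labelled_class g 1 (loop_ext u l A)) (corner 0) (corner 1) | A u l.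
     A \<in> labelled_graphs g 0 \<and> y = labelled_class g 0 A \<and> u \<in> verts (fst A) \<and> l \<notin> edges (fst A)}"

lemma fresh_edge:
  assumes "finite (edges G)"
  obtains l :: nat where "l \<notin> edges G"
  using assms by (metis ex_new_if_finite infinite_UNIV_nat)

lemma spoke_ends:
  assumes g: "g \<ge> 2" and p: "p \<in> spokes g y"
  shows "pathin (tropical_Delta g) p" "p 0 = base_point g" "p 1 = delta_point g 0 y (corner 0)"
proof -
  obtain A u l where A: "A \<in> labelled_graphs g 0" "y = labelled_class g 0 A" "u \<in> verts (fst A)" "l \<notin> edges (fst A)"
    and p_def: "p = segment g 1 (labelled_class g 1 (loop_ext u l A)) (corner 0) (corner 1)"
    using p by (auto simp: spokes_def)
  let ?B = "loop_ext u l A"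
  have w: "weight (fst A) u > 0" using one_edge_weight_pos[OF A(1,3)] .
  have B: "?B \<in> labelled_graphs g 1" using loop_ext_in[OF A(1,3) w A(4)] by simp
  have x: "labelled_class g 1 ?B \<in> labelled_classes g 1" using labelled_class_in[OF B] .
  show "pathin (tropical_Delta g) p" unfolding p_def using x by (intro pathin_segment corner_in) auto
  have "face_map g 0 Suc (labelled_class g 1 ?B) = y"
    using face_map_class[OF B A(1) _ _ loop_ext_contracts_to[OF A(1,3) w A(4)]] A(2) by simp
  then show "p 1 = delta_point g 0 y (corner 0)"
    using corner_face[OF x, of Suc 0 0] by (simp add: p_def)
  \<comment> \<open>In \<open>C\<close> only the loop survives, so one vertex remains and
    \<open>C\<close> is isomorphic to the graph of the base point.\<close>
  obtain C \<pi> where C: "C \<in> labelled_graphs g 0" "contracts_to \<pi> (\<lambda>_. 0) ?B C"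
    by (rule face_exists[OF B, of "\<lambda>_. 0" 0]) auto
  have "\<exists>v. verts (fst C) = {v}"
    by (rule contracts_to_loops[OF B C]) (auto simp: loop_ext_def is_loop_def split: if_splits)
  then have "labelled_class g 0 C = labelled_class g 0 (\<lparr>verts = {0}, edges = {0}, ends = \<lambda>_. {#0, 0#}, weight = \<lambda>_. g - 1\<rparr>, \<lambda>_. 0)"
    using labelled_class_eq_iff[OF C(1) rose_in[OF g]] single_vertex_isomorphic[OF C(1) rose_in[OF g]] by auto
  moreover have "face_map g 0 (\<lambda>_. 0) (labelled_class g 1 ?B) = labelled_class g 0 C"
    using face_map_class[OF B C(1) _ _ C(2)] by simp
  ultimately show "p 0 = base_point g"
    using corner_face[OF x, of "\<lambda>_. 0" 0 0] by (simp add: p_def base_point_def)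
qed

lemma spokes_nonempty:
  assumes "y \<in> labelled_classes g 0"
  shows "spokes g y \<noteq> {}"
proof -
  obtain A where A: "A \<in> labelled_graphs g 0" "y = labelled_class g 0 A" using assms labelled_classesE by blast
  obtain u where "u \<in> verts (fst A)" using labelled_graphsD(5)[OF A(1)] by (auto simp: connected_graph_def)
  moreover obtain l where "l \<notin> edges (fst A)" using fresh_edge[OF labelled_graphsD(8)[OF A(1)]] .
  ultimately show ?thesis using A unfolding spokes_def by blast
qed

text \<open>An isomorphism extends over the added loops because
  \<open>case_nat 0 (Suc \<circ> id)\<close> is again \<open>id\<close>.\<close>

lemma loop_ext_class_cong:
  assumes A: "A \<in> labelled_graphs g p" "B \<in> labelled_graphs g p" "contracts_to \<pi> id A B"
    and u: "u \<in> verts (fst A)" "weight (fst A) u > 0" and l: "l \<notin> edges (fst A)" "l' \<notin> edges (fst B)"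
  shows "labelled_class g (Suc p) (loop_ext u l A) = labelled_class g (Suc p) (loop_ext (\<pi> u) l' B)"
    and "\<pi> u \<in> verts (fst B)" "weight (fst B) (\<pi> u) > 0"
proof -
  show w: "weight (fst B) (\<pi> u) > 0"
    using labelled_isomorphic_weight[OF labelled_graphsD(4)[OF A(1)] A(3,1,2) u(1)] u(2) by simp
  show v: "\<pi> u \<in> verts (fst B)" using A(3) contraction_viaD(1) u(1) unfolding contracts_to_def by blast
  have "case_nat 0 (Suc \<circ> id) = id" by (auto split: nat.splits)
  then have "contracts_to \<pi> id (loop_ext u l A) (loop_ext (\<pi> u) l' B)"
    using loop_ext_lift[OF A(1,3) u w l] by simp
  then show "labelled_class g (Suc p) (loop_ext u l A) = labelled_class g (Suc p) (loop_ext (\<pi> u) l' B)"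
    using contracts_to_id_class loop_ext_in[OF A(1) u l(1)] loop_ext_in[OF A(2) v w l(2)] by blast
qed

text \<open>
  Loops added at two different vertices are compared in the triangle obtained by adding both of
  them: its third side is a segment of graphs with one vertex.
\<close>

lemma spoke_two_vertices:
  assumes A: "A \<in> labelled_graphs g 0" and u: "u \<in> verts (fst A)" "u' \<in> verts (fst A)" "u \<noteq> u'"
    and l: "l \<notin> edges (fst A)" "l' \<notin> edges (fst A)"
  shows "path_homotopic (tropical_Delta g)
     (segment g 1 (labelled_class g 1 (loop_ext u l A)) (corner 0) (corner 1))
     (segment g 1 (labelled_class g 1 (loop_ext u' l' A)) (corner 0) (corner 1))"
proof -
  let ?X = "tropical_Delta g"
  note w = one_edge_weight_pos[OF A u(1)] and w' = one_edge_weight_pos[OF A u(2)]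
  define B where "B = loop_ext u' l' A"
  have B: "B \<in> labelled_graphs g 1" using loop_ext_in[OF A u(2) w' l(2)] by (simp add: B_def)
  obtain m where m: "m \<notin> edges (fst B)" using fresh_edge[OF labelled_graphsD(8)[OF B]] .
  \<comment> \<open>This uses \<open>u \<noteq> u'\<close>: a vertex of weight 1 could not pay for
    both loops.\<close>
  have uB: "u \<in> verts (fst B)" "weight (fst B) u > 0" using u w by (auto simp: B_def loop_ext_def)
  \<comment> \<open>In \<open>D\<close> label 0 is the loop at \<open>u\<close>, 1 the loop at
    \<open>u'\<close> and 2 the old edge. Contracting 0, 1 or 2 gives the second spoke, the first
    spoke or a graph with one vertex.\<close>
  define D where "D = loop_ext u m B"
  have D: "D \<in> labelled_graphs g 2" using loop_ext_in[OF B uB m] by (simp add: D_def numeral_2_eq_2)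
  define x where "x = labelled_class g 2 D"
  have x: "x \<in> labelled_classes g 2" using labelled_class_in[OF D] by (simp add: x_def)
  have f12: "face_map g 1 Suc x = labelled_class g 1 B"
    unfolding x_def using loop_ext_contracts_to[OF B uB m]
    by (intro face_map_class[OF D B]) (auto simp: D_def)
  let ?\<theta> = "case_nat 0 (Suc \<circ> Suc)"
  have inj: "inj_on ?\<theta> {..1}" and sub: "?\<theta> ` {..1} \<subseteq> {..2}" by (auto simp: inj_on_def split: nat.splits)
  have "contracts_to id ?\<theta> D (loop_ext (id u) l A)"
    unfolding D_def
    by (rule loop_ext_lift[OF B]) (use loop_ext_contracts_to[OF A u(2) w' l(2)] uB w m l in \<open>auto simp: B_def\<close>)
  then have f02: "face_map g 1 ?\<theta> x = labelled_class g 1 (loop_ext u l A)"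
    unfolding x_def using loop_ext_in[OF A u(1) w l(1)] inj sub
    by (intro face_map_class[OF D]) auto
  obtain C \<pi> where C: "C \<in> labelled_graphs g 1" "contracts_to \<pi> id D C"
    by (rule face_exists[OF D, of id 1]) auto
  have "\<exists>v. verts (fst C) = {v}"
    by (rule contracts_to_loops[OF D C]) (auto simp: D_def B_def loop_ext_def is_loop_def split: if_splits)
  then obtain v where v: "verts (fst C) = {v}" by blast
  have f01: "face_map g 1 id x = labelled_class g 1 C"
    unfolding x_def using C by (intro face_map_class[OF D C(1)]) auto
  have s01: "path_homotopic ?X (segment g 2 x (corner 0) (corner 1)) (\<lambda>_. delta_point g 1 (labelled_class g 1 C) (corner 0))"
    using path_homotopic_trans[OF segment_face_homotopic[OF x, of id 1 0 1, unfolded f01] segment_single_vertex[OF C(1) v]] by simp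
  have s12: "path_homotopic ?X (segment g 2 x (corner 1) (corner 2)) (segment g 1 (labelled_class g 1 B) (corner 0) (corner 1))"
    using segment_face_homotopic[OF x, of Suc 1 0 1, unfolded f12]
    by (simp add: numeral_2_eq_2 image_subset_iff)
  have s02: "path_homotopic ?X (segment g 2 x (corner 0) (corner 2)) (segment g 1 (labelled_class g 1 (loop_ext u l A)) (corner 0) (corner 1))"
    using segment_face_homotopic[OF x inj sub, of 0 1, unfolded f02] by (simp add: numeral_2_eq_2)
  have "path_homotopic ?X (segment g 1 (labelled_class g 1 (loop_ext u l A)) (corner 0) (corner 1)) (segment g 2 x (corner 0) (corner 2))"
    using path_homotopic_sym[OF s02] .
  also have "path_homotopic ?X \<dots> (segment g 2 x (corner 0) (corner 1) \<frown> segment g 2 x (corner 1) (corner 2))"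
    by (rule path_homotopic_sym, rule segment_triangle[OF x]) (auto intro: corner_in)
  also have "path_homotopic ?X \<dots> ((\<lambda>_. delta_point g 1 (labelled_class g 1 C) (corner 0)) \<frown> segment g 1 (labelled_class g 1 B) (corner 0) (corner 1))"
    by (rule path_homotopic_join[OF s01 s12]) simp
  also have "path_homotopic ?X \<dots> (segment g 1 (labelled_class g 1 B) (corner 0) (corner 1))"
    using path_homotopicD[OF s01] path_homotopicD[OF s12]
    by (intro path_homotopic_const_join) auto
  finally show ?thesis by (simp add: B_def)
qed

text \<open>Once both loops are carried to the same representative, they sit either at one vertex,
  where the extended classes coincide, or at two vertices, where the triangle applies.\<close>

lemma spokes_homotopic:
  assumes p: "p \<in> spokes g y" and q: "q \<in> spokes g y"
  shows "path_homotopic (tropical_Delta g) p q"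
proof -
  obtain A u l where A: "A \<in> labelled_graphs g 0" "y = labelled_class g 0 A" "u \<in> verts (fst A)" "l \<notin> edges (fst A)"
    and p_def: "p = segment g 1 (labelled_class g 1 (loop_ext u l A)) (corner 0) (corner 1)"
    using p by (auto simp: spokes_def)
  obtain B v m where B: "B \<in> labelled_graphs g 0" "y = labelled_class g 0 B" "v \<in> verts (fst B)" "m \<notin> edges (fst B)"
    and q_def: "q = segment g 1 (labelled_class g 1 (loop_ext v m B)) (corner 0) (corner 1)"
    using q by (auto simp: spokes_def)
  have "labelled_isomorphic A B" using labelled_class_eq_iff[OF A(1) B(1)] A(2) B(2) by simp
  then obtain \<pi> where \<pi>: "contracts_to \<pi> id A B" using isomorphic_contracts_to labelled_graphsD(4)[OF A(1)] by blast
  note c = loop_ext_class_cong[OF A(1) B(1) \<pi> A(3) one_edge_weight_pos[OF A(1,3)] A(4) B(4)]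
  have p': "p = segment g 1 (labelled_class g 1 (loop_ext (\<pi> u) m B)) (corner 0) (corner 1)"
    using c(1) by (simp add: p_def)
  show ?thesis
  proof (cases "\<pi> u = v")
    case True
    have "loop_ext v m B \<in> labelled_graphs g 1" using loop_ext_in[OF B(1,3) one_edge_weight_pos[OF B(1,3)] B(4)] by simp
    then have "pathin (tropical_Delta g) q" unfolding q_def by (intro pathin_segment labelled_class_in corner_in) auto
    then show ?thesis using True p' q_def by (simp add: path_homotopic_refl)
  next
    case False
    then show ?thesis unfolding p' q_def by (intro spoke_two_vertices[OF B(1) c(2) B(3) _ B(4,4)])
  qed
qed

definition spoke :: "nat \<Rightarrow> lgraph set \<Rightarrow> real \<Rightarrow> (nat \<times> lgraph set \<times> (nat \<Rightarrow> real)) set" where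
  "spoke g y = (SOME p. p \<in> spokes g y)"

lemma spoke_in: "y \<in> labelled_classes g 0 \<Longrightarrow> spoke g y \<in> spokes g y"
  by (simp add: spoke_def some_in_eq spokes_nonempty)

lemma vertex_in: "x \<in> labelled_classes g q \<Longrightarrow> i \<le> q \<Longrightarrow> face_map g 0 (\<lambda>_. i) x \<in> labelled_classes g 0"
  by (intro face_map_in_classes) auto

text \<open>Contracting the old edge other than \<open>i\<close> commutes with adding the loop, so
  this side of the triangle is a spoke. Positive weight and the fresh name survive by
  \<open>face_exists\<close>.\<close>

lemma loop_ext_spoke:
  assumes A: "A \<in> labelled_graphs g 1" and u: "u \<in> verts (fst A)" "weight (fst A) u > 0" and l: "l \<notin> edges (fst A)" and i: "i \<le> 1"
  shows "path_homotopic (tropical_Delta g) (segment g 2 (labelled_class g 2 (loop_ext u l A)) (corner 0) (corner (Suc i)))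
     (spoke g (face_map g 0 (\<lambda>_. i) (labelled_class g 1 A)))"
proof -
  have D: "loop_ext u l A \<in> labelled_graphs g 2" using loop_ext_in[OF A u l] by (simp add: numeral_2_eq_2)
  have x: "labelled_class g 2 (loop_ext u l A) \<in> labelled_classes g 2" using labelled_class_in[OF D] .
  let ?y = "face_map g 0 (\<lambda>_. i) (labelled_class g 1 A)"
  obtain \<pi> B where B: "B \<in> labelled_graphs g 0" "contracts_to \<pi> (\<lambda>_. i) A B"
      "weight (fst A) u \<le> weight (fst B) (\<pi> u)" "edges (fst B) \<subseteq> edges (fst A)"
    by (rule face_exists[OF A, of "\<lambda>_. i" 0]) (use i in auto)
  have y: "?y = labelled_class g 0 B" by (rule face_map_class[OF A B(1) _ _ B(2)]) (use i in auto)
  have wB: "weight (fst B) (\<pi> u) > 0" and lB: "l \<notin> edges (fst B)" using B(3,4) u l by auto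
  have vB: "\<pi> u \<in> verts (fst B)" using B(2) contraction_viaD(1) u(1) unfolding contracts_to_def by blast
  let ?\<theta> = "case_nat 0 (Suc \<circ> (\<lambda>_. i))"
  have inj: "inj_on ?\<theta> {..1}" and sub: "?\<theta> ` {..1} \<subseteq> {..2}" using i by (auto simp: inj_on_def split: nat.splits)
  have "face_map g 1 ?\<theta> (labelled_class g 2 (loop_ext u l A)) = labelled_class g 1 (loop_ext (\<pi> u) l B)"
    using loop_ext_in[OF B(1) vB wB lB]
    by (intro face_map_class[OF D _ inj sub loop_ext_lift[OF A B(2) u wB l lB]]) simp
  then have "path_homotopic (tropical_Delta g) (segment g 2 (labelled_class g 2 (loop_ext u l A)) (corner 0) (corner (Suc i)))
     (segment g 1 (labelled_class g 1 (loop_ext (\<pi> u) l B)) (corner 0) (corner 1))"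
    using segment_face_homotopic[OF x inj sub, of 0 1] by simp
  also have "segment g 1 (labelled_class g 1 (loop_ext (\<pi> u) l B)) (corner 0) (corner 1) \<in> spokes g ?y"
    using B(1) vB lB y unfolding spokes_def by blast
  then have "path_homotopic (tropical_Delta g) (segment g 1 (labelled_class g 1 (loop_ext (\<pi> u) l B)) (corner 0) (corner 1)) (spoke g ?y)"
    using spokes_homotopic spoke_in vertex_in[OF labelled_class_in[OF A] i] by blast
  finally show ?thesis .
qed

lemma spoke_edge:
  assumes g: "g \<ge> 2" and x: "x \<in> labelled_classes g 1"
  shows "path_homotopic (tropical_Delta g)
    (spoke g (face_map g 0 (\<lambda>_. 0) x) \<frown> segment g 1 x (corner 0) (corner 1)) (spoke g (face_map g 0 (\<lambda>_. 1) x))"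
proof -
  let ?X = "tropical_Delta g"
  obtain A where A: "A \<in> labelled_graphs g 1" "x = labelled_class g 1 A" using x labelled_classesE by blast
  have ps: "pathin ?X (segment g 1 x (corner 0) (corner 1))" using x by (intro pathin_segment corner_in) auto
  note e0 = spoke_ends[OF g spoke_in[OF vertex_in[OF x, of 0]]]
  have end0: "spoke g (face_map g 0 (\<lambda>_. 0) x) 1 = segment g 1 x (corner 0) (corner 1) 0"
    using e0(3) corner_face[OF x, of "\<lambda>_. 0" 0 0] by simp
  from two_edges_cases[OF A(1)] show ?thesis
  proof (elim disjE exE bexE)
    fix v assume v: "verts (fst A) = {v}"
    \<comment> \<open>Exchanging the labels interchanges the two corners, so both ends of the
      segment have the same spoke.\<close>
    have "face_map g 0 (\<lambda>_. 0) x = face_map g 0 (\<lambda>_. 0) (face_map g 1 (\<lambda>i. 1 - i) x)"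
      using single_vertex_swap[OF A(1) v] A(2) by simp
    also have "\<dots> = face_map g 0 (\<lambda>_. 1) x"
      using x by (subst face_map_face_map[where r=1 and q=1]) (auto simp: inj_on_def o_def)
    finally have eq: "face_map g 0 (\<lambda>_. 1) x = face_map g 0 (\<lambda>_. 0) x" by simp
    have null: "path_homotopic ?X (segment g 1 x (corner 0) (corner 1)) (\<lambda>_. delta_point g 1 x (corner 0))"
      using segment_single_vertex[OF A(1) v] A(2) by simp
    have "path_homotopic ?X (spoke g (face_map g 0 (\<lambda>_. 0) x) \<frown> segment g 1 x (corner 0) (corner 1))
       (spoke g (face_map g 0 (\<lambda>_. 0) x) \<frown> (\<lambda>_. delta_point g 1 x (corner 0)))"
      by (rule path_homotopic_join[OF path_homotopic_refl null]) (use e0 end0 in auto)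
    also have "path_homotopic ?X \<dots> (spoke g (face_map g 0 (\<lambda>_. 0) x))"
      by (rule path_homotopic_join_const) (use e0 end0 in auto)
    finally show ?thesis unfolding eq .
  next
    fix u assume u: "u \<in> verts (fst A)" "weight (fst A) u > 0"
    obtain l where l: "l \<notin> edges (fst A)" using fresh_edge[OF labelled_graphsD(8)[OF A(1)]] .
    \<comment> \<open>Corner 0 of the triangle \<open>z\<close> is the added loop and the opposite
      side is \<open>x\<close>; the other two sides are spokes to the ends of
      \<open>x\<close>.\<close>
    define z where "z = labelled_class g 2 (loop_ext u l A)"
    have D: "loop_ext u l A \<in> labelled_graphs g 2" using loop_ext_in[OF A(1) u l] by (simp add: numeral_2_eq_2)
    have z: "z \<in> labelled_classes g 2" using labelled_class_in[OF D] by (simp add: z_def)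
    have f12: "face_map g 1 Suc z = x"
      unfolding z_def A(2) using loop_ext_contracts_to[OF A(1) u l]
      by (intro face_map_class[OF D A(1)]) auto
    have s12: "path_homotopic ?X (segment g 2 z (corner 1) (corner 2)) (segment g 1 x (corner 0) (corner 1))"
      using segment_face_homotopic[OF z, of Suc 1 0 1, unfolded f12]
      by (simp add: numeral_2_eq_2 image_subset_iff)
    have s01: "path_homotopic ?X (segment g 2 z (corner 0) (corner 1)) (spoke g (face_map g 0 (\<lambda>_. 0) x))"
      using loop_ext_spoke[OF A(1) u l, of 0] by (simp add: z_def A(2))
    have s02: "path_homotopic ?X (segment g 2 z (corner 0) (corner 2)) (spoke g (face_map g 0 (\<lambda>_. 1) x))"
      using loop_ext_spoke[OF A(1) u l, of 1] by (simp add: z_def A(2) numeral_2_eq_2)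
    have "path_homotopic ?X (spoke g (face_map g 0 (\<lambda>_. 0) x) \<frown> segment g 1 x (corner 0) (corner 1))
       (segment g 2 z (corner 0) (corner 1) \<frown> segment g 2 z (corner 1) (corner 2))"
      by (rule path_homotopic_join[OF path_homotopic_sym[OF s01] path_homotopic_sym[OF s12]]) (rule end0)
    also have "path_homotopic ?X \<dots> (segment g 2 z (corner 0) (corner 2))"
      by (rule segment_triangle[OF z]) (auto intro: corner_in)
    also note s02
    finally show ?thesis .
  qed
qed

section \<open>Rays: paths from the base point to arbitrary points\<close>

definition ray :: "nat \<Rightarrow> nat \<Rightarrow> lgraph set \<Rightarrow> nat \<Rightarrow> (nat \<Rightarrow> real) \<Rightarrow> real \<Rightarrow> (nat \<times> lgraph set \<times> (nat \<Rightarrow> real)) set" where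
  "ray g q x i a = spoke g (face_map g 0 (\<lambda>_. i) x) \<frown> segment g q x (corner i) a"

lemma spoke_vertex:
  assumes g: "g \<ge> 2" and x: "x \<in> labelled_classes g q" and i: "i \<le> q"
  shows "pathin (tropical_Delta g) (spoke g (face_map g 0 (\<lambda>_. i) x))" "spoke g (face_map g 0 (\<lambda>_. i) x) 0 = base_point g"
    "spoke g (face_map g 0 (\<lambda>_. i) x) 1 = delta_point g q x (corner i)"
  using spoke_ends[OF g spoke_in[OF vertex_in[OF x i]]] corner_face[OF x, of "\<lambda>_. i" 0 0] i by auto

lemma ray_ends:
  assumes g: "g \<ge> 2" and x: "x \<in> labelled_classes g q" and i: "i \<le> q" and a: "a \<in> standard_simplex q"
  shows "pathin (tropical_Delta g) (ray g q x i a)" "ray g q x i a 0 = base_point g" "ray g q x i a 1 = delta_point g q x a"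
  unfolding ray_def using spoke_vertex[OF g x i] pathin_segment[OF x corner_in[OF i] a] by (auto intro: pathin_join)

text \<open>The spoke stays fixed, and the triangle on \<open>corner i\<close>, \<open>a\<close> and
  \<open>b\<close> closes.\<close>

lemma ray_segment:
  assumes g: "g \<ge> 2" and x: "x \<in> labelled_classes g q" and i: "i \<le> q" and a: "a \<in> standard_simplex q" and b: "b \<in> standard_simplex q"
  shows "path_homotopic (tropical_Delta g) (ray g q x i a \<frown> segment g q x a b) (ray g q x i b)"
proof -
  let ?X = "tropical_Delta g" and ?e = "spoke g (face_map g 0 (\<lambda>_. i) x)"
  note e = spoke_vertex[OF g x i]
  have "path_homotopic ?X (ray g q x i a \<frown> segment g q x a b) (?e \<frown> (segment g q x (corner i) a \<frown> segment g q x a b))"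
    unfolding ray_def using e x i a b by (intro path_homotopic_assoc) (auto intro: pathin_segment corner_in)
  also have "path_homotopic ?X \<dots> (?e \<frown> segment g q x (corner i) b)"
    by (rule path_homotopic_join[OF path_homotopic_refl segment_triangle]) (use e x i a b in \<open>auto intro: corner_in\<close>)
  finally show ?thesis by (simp add: ray_def)
qed

text \<open>\<open>spoke_edge\<close>, applied to the side from \<open>i\<close> to
  \<open>j\<close>, exchanges one spoke for the other; the triangle whose third corner is
  \<open>a\<close> absorbs that side.\<close>

lemma ray_vertex_independent:
  assumes g: "g \<ge> 2" and x: "x \<in> labelled_classes g q" and i: "i \<le> q" and j: "j \<le> q" and a: "a \<in> standard_simplex q"
  shows "path_homotopic (tropical_Delta g) (ray g q x i a) (ray g q x j a)"
proof (cases "i = j")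
  case True
  then show ?thesis using ray_ends[OF g x i a] by (simp add: path_homotopic_refl)
next
  case False
  let ?X = "tropical_Delta g"
  define \<theta> where "\<theta> k = (if k = 0 then i else j)" for k :: nat
  have inj: "inj_on \<theta> {..1}" and sub: "\<theta> ` {..1} \<subseteq> {..q}" using False i j by (auto simp: \<theta>_def inj_on_def le_Suc_eq)
  let ?y = "face_map g 1 \<theta> x"
  have y: "?y \<in> labelled_classes g 1" using face_map_in_classes[OF x inj sub] .
  have f: "face_map g 0 (\<lambda>_. k) ?y = face_map g 0 (\<lambda>_. \<theta> k) x" if "k \<le> 1" for k
    by (subst face_map_face_map[OF x inj sub]) (use that in \<open>auto simp: o_def\<close>)
  have s: "path_homotopic ?X (segment g q x (corner i) (corner j)) (segment g 1 ?y (corner 0) (corner 1))"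
    using segment_face_homotopic[OF x inj sub, of 0 1] by (simp add: \<theta>_def)
  note ei = spoke_vertex[OF g x i] and ej = spoke_vertex[OF g x j]
  have "path_homotopic ?X (ray g q x i (corner j)) (spoke g (face_map g 0 (\<lambda>_. i) x) \<frown> segment g 1 ?y (corner 0) (corner 1))"
    unfolding ray_def by (rule path_homotopic_join[OF path_homotopic_refl s]) (use ei in auto)
  also have "path_homotopic ?X \<dots> (spoke g (face_map g 0 (\<lambda>_. j) x))"
    using spoke_edge[OF g y] f[of 0] f[of 1] by (simp add: \<theta>_def)
  finally have *: "path_homotopic ?X (ray g q x i (corner j)) (spoke g (face_map g 0 (\<lambda>_. j) x))" .
  have "path_homotopic ?X (ray g q x i a) (ray g q x i (corner j) \<frown> segment g q x (corner j) a)"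
    by (rule path_homotopic_sym, rule ray_segment[OF g x i corner_in[OF j] a])
  also have "path_homotopic ?X \<dots> (spoke g (face_map g 0 (\<lambda>_. j) x) \<frown> segment g q x (corner j) a)"
    by (rule path_homotopic_join[OF * path_homotopic_refl])
       (use pathin_segment[OF x corner_in[OF j] a] ray_ends[OF g x i corner_in[OF j]] in auto)
  finally show ?thesis by (simp add: ray_def[of g q x j])
qed

text \<open>A gluing takes corner 0 of a face to corner \<open>\<theta> 0\<close> of the larger
  simplex, so independence of the corner comes first; after that the two rays agree pointwise on
  \<open>[0,1]\<close>.\<close>

lemma ray_well_defined:
  assumes g: "g \<ge> 2" and "((p, x, a), (q, y, b)) \<in> glue_rel g"
  shows "path_homotopic (tropical_Delta g) (ray g p x 0 a) (ray g q y 0 b)"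
proof -
  let ?R = "\<lambda>(p, x, a) (q, y, b). path_homotopic (tropical_Delta g) (ray g p x 0 a) (ray g q y 0 b)"
  have "?R (p, x, a) (q, y, b)"
    using assms(2)
  proof (induction rule: glue_rel_induct)
    case (step s t)
    then show ?case
    proof (cases rule: glue.cases)
      case (1 \<theta> p q x a)
      have i: "\<theta> 0 \<le> q" using 1(4) by auto
      have pa: "simplex_push p \<theta> a \<in> standard_simplex q" using simplex_push_in 1 by blast
      have "path_homotopic (tropical_Delta g) (ray g q x 0 (simplex_push p \<theta> a)) (ray g q x (\<theta> 0) (simplex_push p \<theta> a))"
        by (rule ray_vertex_independent[OF g 1(5) _ i pa]) simp
      also have "path_homotopic (tropical_Delta g) \<dots> (ray g p (face_map g p \<theta> x) 0 a)"
      proof (rule path_homotopic_eq)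
        show "pathin (tropical_Delta g) (ray g q x (\<theta> 0) (simplex_push p \<theta> a))" using ray_ends[OF g 1(5) i pa] by blast
        have "face_map g 0 (\<lambda>_. 0) (face_map g p \<theta> x) = face_map g 0 (\<lambda>_. \<theta> 0) x"
          by (subst face_map_face_map[OF 1(5,3,4)]) (auto simp: o_def)
        moreover have "segment g q x (corner (\<theta> 0)) (simplex_push p \<theta> a) t = segment g p (face_map g p \<theta> x) (corner 0) a t"
          if "t \<in> {0..1}" for t
          using segment_glue[OF 1(3-5) corner_in 1(6) that, of 0] by (simp add: simplex_push_corner[OF 1(3)])
        ultimately show "ray g p (face_map g p \<theta> x) 0 a t = ray g q x (\<theta> 0) (simplex_push p \<theta> a) t" if "t \<in> {0..1}" for t
          using that by (simp add: ray_def join_path_def)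
      qed
      finally show ?thesis by (simp add: 1(1,2))
    qed
  next
    case (refl s)
    then show ?case using ray_ends[OF g] by (auto simp: topspace_simplex_coproduct intro!: path_homotopic_refl)
  next
    case (sym s t)
    then show ?case by (cases s; cases t) (simp add: path_homotopic_sym)
  next
    case (trans s t u)
    then show ?case by (cases s; cases t; cases u) (simp, rule path_homotopic_trans)
  qed
  then show ?thesis by simp
qed

text \<open>The representative is arbitrary; only the homotopy class of the ray is determined by
  \<open>z\<close>.\<close>

definition ray_family :: "nat \<Rightarrow> (nat \<times> lgraph set \<times> (nat \<Rightarrow> real)) set \<Rightarrow> real \<Rightarrow> (nat \<times> lgraph set \<times> (nat \<Rightarrow> real)) set" where
  "ray_family g z = (case SOME (p, x, a). x \<in> labelled_classes g p \<and> a \<in> standard_simplex p \<and> z = delta_point g p x a of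
     (p, x, a) \<Rightarrow> ray g p x 0 a)"

lemma ray_family_homotopic:
  assumes g: "g \<ge> 2" and x: "x \<in> labelled_classes g p" and a: "a \<in> standard_simplex p"
  shows "path_homotopic (tropical_Delta g) (ray_family g (delta_point g p x a)) (ray g p x 0 a)"
proof -
  define s where "s = (SOME (q, y, b). y \<in> labelled_classes g q \<and> b \<in> standard_simplex q \<and> delta_point g p x a = delta_point g q y b)"
  obtain q y b where s: "s = (q, y, b)" by (cases s)
  have "case s of (q, y, b) \<Rightarrow> y \<in> labelled_classes g q \<and> b \<in> standard_simplex q \<and> delta_point g p x a = delta_point g q y b"
    unfolding s_def by (rule someI[of _ "(p, x, a)"]) (use x a in auto)
  then have "y \<in> labelled_classes g q" "b \<in> standard_simplex q" "delta_point g q y b = delta_point g p x a" by (auto simp: s)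
  then have "path_homotopic (tropical_Delta g) (ray g q y 0 b) (ray g p x 0 a)"
    using ray_well_defined[OF g] delta_point_eqD by blast
  then show ?thesis by (simp add: ray_family_def s_def[symmetric] s)
qed

lemma path_family_ray_family:
  assumes g: "g \<ge> 2"
  shows "path_family (tropical_Delta g) (base_point g) (ray_family g)"
  unfolding path_family_def
proof
  fix z assume "z \<in> topspace (tropical_Delta g)"
  then obtain p x a where z: "z = delta_point g p x a" "x \<in> labelled_classes g p" "a \<in> standard_simplex p"
    by (auto simp: topspace_tropical_Delta)
  show "pathin (tropical_Delta g) (ray_family g z) \<and> ray_family g z 0 = base_point g \<and> ray_family g z 1 = z"
    using path_homotopicD[OF ray_family_homotopic[OF g z(2,3)]] ray_ends[OF g z(2) _ z(3), of 0] z(1) by auto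
qed

lemma transports_segment:
  assumes g: "g \<ge> 2" and x: "x \<in> labelled_classes g p" and a: "a \<in> standard_simplex p" and b: "b \<in> standard_simplex p"
  shows "transports (tropical_Delta g) (ray_family g) (segment g p x a b)"
proof -
  let ?X = "tropical_Delta g"
  have s: "pathin ?X (segment g p x a b)" using pathin_segment[OF x a b] .
  have "path_homotopic ?X (ray_family g (delta_point g p x a) \<frown> segment g p x a b) (ray g p x 0 a \<frown> segment g p x a b)"
    by (rule path_homotopic_join[OF ray_family_homotopic[OF g x a] path_homotopic_refl[OF s]])
       (use path_homotopicD(4)[OF ray_family_homotopic[OF g x a]] ray_ends[OF g x _ a, of 0] in simp)
  also have "path_homotopic ?X \<dots> (ray g p x 0 b)" by (rule ray_segment[OF g x _ a b]) simp
  also have "path_homotopic ?X \<dots> (ray_family g (delta_point g p x b))"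
    by (rule path_homotopic_sym[OF ray_family_homotopic[OF g x b]])
  finally show ?thesis using s by (simp add: transports_def)
qed

theorem theorem1p1:
  fixes g :: nat
  assumes "g \<ge> 2"
  shows "simply_connected_space (tropical_Delta g)"
proof -
  let ?X = "tropical_Delta g"
  note Q = path_family_ray_family[OF assms]
  show ?thesis
  proof (rule simply_connected_space_transports[OF _ Q])
    show "base_point g \<in> topspace ?X"
      unfolding base_point_def by (intro delta_point_in labelled_class_in rose_in assms corner_in) simp
    fix z assume "z \<in> topspace ?X"
    then obtain U H c where U: "openin ?X U" "z \<in> U"
      and H: "continuous_map (prod_topology unit_interval (subtopology ?X U)) ?X H"
        "\<And>u. u \<in> U \<Longrightarrow> H (0, u) = u" "\<And>u. u \<in> U \<Longrightarrow> H (1, u) = c"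
        "\<And>u. u \<in> U \<Longrightarrow> \<exists>p x a b. x \<in> labelled_classes g p \<and> a \<in> standard_simplex p \<and> b \<in> standard_simplex p \<and>
          (\<forall>t\<in>{0..1}. H (t, u) = segment g p x a b t)"
      by (rule local_contraction) blast
    have lines: "transports ?X (ray_family g) (\<lambda>t. H (t, u))" if u: "u \<in> U" for u
    proof -
      obtain p x a b where s: "x \<in> labelled_classes g p" "a \<in> standard_simplex p" "b \<in> standard_simplex p"
        "\<And>t. t \<in> {0..1} \<Longrightarrow> H (t, u) = segment g p x a b t" using H(4)[OF u] by blast
      have "path_homotopic ?X (\<lambda>t. H (t, u)) (segment g p x a b)"
        by (rule path_homotopic_sym[OF path_homotopic_eq[OF pathin_segment[OF s(1-3)] s(4)]])
      then show ?thesis using transports_homotopic[OF Q] transports_segment[OF assms s(1-3)] by blast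
    qed
    have "transports ?X (ray_family g) d" if d: "pathin ?X d" "d ` {0..1} \<subseteq> U" for d
    \<comment> \<open>The first parameter runs along \<open>d\<close>, the second is the time of the
      contraction \<open>H\<close>; the tracks of the ends are segments, covered by
      \<open>lines\<close>.\<close>
    proof (rule transports_contraction[OF Q d(1), of "\<lambda>(s, t). H (t, d s)"])
      have "continuous_map unit_interval (subtopology ?X U) d"
        using d by (auto simp: pathin_def continuous_map_in_subtopology)
      then have "continuous_map (prod_topology unit_interval unit_interval) (prod_topology unit_interval (subtopology ?X U)) (\<lambda>z. (snd z, d (fst z)))"
        by (intro continuous_map_pairedI continuous_map_snd continuous_map_compose[OF continuous_map_fst, unfolded o_def])
      from continuous_map_compose[OF this H(1)]
      show "continuous_map (prod_topology unit_interval unit_interval) ?X (\<lambda>(s, t). H (t, d s))"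
        by (simp add: o_def case_prod_beta')
      have dU: "d s \<in> U" if "s \<in> {0..1}" for s using d(2) that by auto
      show "(case (s, 0) of (s, t) \<Rightarrow> H (t, d s)) = d s" if "s \<in> {0..1}" for s using H(2)[OF dU[OF that]] by simp
      show "(case (s, 1) of (s, t) \<Rightarrow> H (t, d s)) = (case (0, 1) of (s, t) \<Rightarrow> H (t, d s))" if "s \<in> {0..1}" for s
        using H(3)[OF dU[OF that]] H(3)[OF dU[of 0]] by simp
      show "transports ?X (ray_family g) (\<lambda>t. case (0, t) of (s, t) \<Rightarrow> H (t, d s))"
        "transports ?X (ray_family g) (\<lambda>t. case (1, t) of (s, t) \<Rightarrow> H (t, d s))"
        using lines dU by auto
    qed
    then show "\<exists>U. openin ?X U \<and> z \<in> U \<and> (\<forall>d. pathin ?X d \<and> d ` {0..1} \<subseteq> U \<longrightarrow> transports ?X (ray_family g) d)"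
      using U by blast
  qed
qed

end
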